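(* In $\mathbb{Z}[t][[u]]$, \[ \sum_{n=1}^\infty Z_{W^n}(t) u^{n}=\frac{1}{\sqrt{(1-(t+1) u)^2-4 t u^2}}-1, \] where the square root is the power series in $u$ with constant term $1$.
   Context: For a matroid $M$ let $L(M)$ be its lattice of flats, $\mathrm{rk}\, M$ its rank, $\chi_M(t)$ its characteristic polynomial; for a flat $F$, $M_F$ is the localization (restriction to $F$) and $M^F$ the contraction at $F$. The Kazhdan–Lusztig polynomial is the unique assignment of $P_M(t)\in\mathbb{Z}[t]$ to each loopless matroid $M$ with: $P_M=1$ if $\mathrm{rk}\, M=0$; $\deg P_M<\frac12\mathrm{rk}\, M$ if $\mathrm{rk}\, M>0$; $t^{\mathrm{rk}\, M}P_M(t^{-1})=\sum_{F\in L(M)}\chi_{M_F}(t)P_{M^F}(t)$. The $Z$-polynomial is $Z_M(t)=\sum_{F\in L(M)}t^{\mathrm{rk}\, M_F}P_{M^F}(t)$. For $n\ge3$ let $W_n$ be the wheel graph (vertices $0,\dots,n$, edges of the cycle $1,2,\dots,n,1$ forming the set $O_n$, and edges $\{0,i\}$), and the whirl matroid $W^n$ the matroid on $E(W_n)$ whose independent sets are the edge sets of forests of $W_n$ together with $O_n$. $W^1$ is the graphic matroid of a single edge, and $W^2$ is the matroid obtained from the graphic matroid of the multigraph on $\{0,1,2\}$ with edges $(0,1),(0,2)$ and two parallel edges $e_1,e_2$ between $1$ and $2$ by declaring $\{e_1,e_2\}$ independent, i.e. the uniform matroid of rank $2$ on $4$ elements. *)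

theory Defs
  imports "HOL-Computational_Algebra.Computational_Algebra"
begin

section \<open>Finite matroids\<close>

record 'a matroid =
  ground :: "'a set"
  indeps :: "'a set set"

definition is_matroid :: "'a matroid \<Rightarrow> bool" where
  "is_matroid M \<longleftrightarrow>
     finite (ground M) \<and>
     (\<forall>I\<in>indeps M. I \<subseteq> ground M) \<and>
     {} \<in> indeps M \<and>
     (\<forall>I\<in>indeps M. \<forall>J\<subseteq>I. J \<in> indeps M) \<and>
     (\<forall>I\<in>indeps M. \<forall>J\<in>indeps M. card I < card J \<longrightarrow> (\<exists>x\<in>J - I. insert x I \<in> indeps M))"

definition loopless :: "'a matroid \<Rightarrow> bool" where
  "loopless M \<longleftrightarrow> (\<forall>x\<in>ground M. {x} \<in> indeps M)"

definition rank_of :: "'a matroid \<Rightarrow> 'a set \<Rightarrow> nat" where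
  "rank_of M X = Max (card ` {I \<in> indeps M. I \<subseteq> X})"

definition rk :: "'a matroid \<Rightarrow> nat" where
  "rk M = rank_of M (ground M)"

text \<open>The lattice of flats, as a family of sets ordered by inclusion.\<close>

definition flats :: "'a matroid \<Rightarrow> 'a set set" where
  "flats M = {F. F \<subseteq> ground M \<and> (\<forall>x\<in>ground M - F. rank_of M F < rank_of M (insert x F))}"

definition basis_of :: "'a matroid \<Rightarrow> 'a set \<Rightarrow> 'a set \<Rightarrow> bool" where
  "basis_of M X B \<longleftrightarrow>
     B \<in> indeps M \<and> B \<subseteq> X \<and> (\<forall>I\<in>indeps M. B \<subseteq> I \<and> I \<subseteq> X \<longrightarrow> I = B)"

definition localization :: "'a matroid \<Rightarrow> 'a set \<Rightarrow> 'a matroid" where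
  "localization M F = \<lparr>ground = F, indeps = {I \<in> indeps M. I \<subseteq> F}\<rparr>"

definition contraction :: "'a matroid \<Rightarrow> 'a set \<Rightarrow> 'a matroid" where
  "contraction M F =
     \<lparr>ground = ground M - F,
      indeps = {I. I \<subseteq> ground M - F \<and> (\<exists>B. basis_of M F B \<and> I \<union> B \<in> indeps M)}\<rparr>"

text \<open>The Moebius function of a family of finite sets ordered by inclusion. The finiteness
  guard only serves to make the recursion total.\<close>

function moebius :: "'a set set \<Rightarrow> 'a set \<Rightarrow> 'a set \<Rightarrow> int" where
  "moebius L F G =
     (if F = G then 1
      else if F \<subset> G \<and> finite G then - (\<Sum>H\<in>{H\<in>L. F \<subseteq> H \<and> H \<subset> G}. moebius L F H)
      else 0)"
  by pat_completeness auto
termination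
  by (relation "Wellfounded.measure (\<lambda>(L, F, G). card G)") (auto intro: psubset_card_mono)

declare moebius.simps [simp del]

text \<open>The least flat is the intersection of all flats; it is empty when the matroid is loopless.\<close>

definition char_poly :: "'a matroid \<Rightarrow> int poly" where
  "char_poly M =
     (\<Sum>F\<in>flats M. monom (moebius (flats M) (\<Inter>(flats M)) F) (rk M - rank_of M F))"


section \<open>Kazhdan--Lusztig polynomials and Z-polynomials\<close>

text \<open>For \<open>degree p \<le> d\<close> this is the polynomial \<open>t ^ d * p (1 / t)\<close>.\<close>

definition reverse_poly :: "nat \<Rightarrow> int poly \<Rightarrow> int poly" where
  "reverse_poly d p = monom 1 (d - degree p) * reflect_poly p"

definition kl_assignment :: "('a matroid \<Rightarrow> int poly) \<Rightarrow> bool" where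
  "kl_assignment P \<longleftrightarrow>
     (\<forall>M. is_matroid M \<and> loopless M \<longrightarrow>
        (rk M = 0 \<longrightarrow> P M = 1) \<and>
        (rk M > 0 \<longrightarrow> 2 * degree (P M) < rk M) \<and>
        reverse_poly (rk M) (P M) =
          (\<Sum>F\<in>flats M. char_poly (localization M F) * P (contraction M F)))"

text \<open>Values outside the loopless matroids are normalised to 0 so that the assignment is unique as
  a total function. All minors involved live on subsets of the ground set, so it suffices to work
  with the matroids over one fixed element type.\<close>

definition kl_poly :: "'a matroid \<Rightarrow> int poly" where
  "kl_poly = (THE P. kl_assignment P \<and> (\<forall>M. \<not> (is_matroid M \<and> loopless M) \<longrightarrow> P M = 0))"

definition z_poly :: "'a matroid \<Rightarrow> int poly" where
  "z_poly M = (\<Sum>F\<in>flats M. monom 1 (rk (localization M F)) * kl_poly (contraction M F))"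


section \<open>Multigraphs and whirls\<close>

text \<open>A multigraph is given by a set of edge names and a map sending an edge to its set of
  endpoints (a singleton for a loop). A cycle is a closed walk without repeated vertices and edges;
  length 1 is a loop, length 2 a pair of parallel edges.\<close>

definition is_cycle :: "('e \<Rightarrow> 'v set) \<Rightarrow> 'e list \<Rightarrow> bool" where
  "is_cycle ends es \<longleftrightarrow>
     es \<noteq> [] \<and> distinct es \<and>
     (\<exists>vs. length vs = length es \<and> distinct vs \<and>
        (\<forall>i<length es. ends (es ! i) = {vs ! i, vs ! (Suc i mod length es)}))"

definition is_forest :: "('e \<Rightarrow> 'v set) \<Rightarrow> 'e set \<Rightarrow> bool" where
  "is_forest ends X \<longleftrightarrow> \<not> (\<exists>es. is_cycle ends es \<and> set es \<subseteq> X)"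

definition graphic_matroid :: "('e \<Rightarrow> 'v set) \<Rightarrow> 'e set \<Rightarrow> 'e matroid" where
  "graphic_matroid ends E = \<lparr>ground = E, indeps = {X. X \<subseteq> E \<and> is_forest ends X}\<rparr>"

datatype wheel_edge = Rim nat | Spoke nat

text \<open>For \<open>n = 2\<close> the two rim edges are parallel edges between the vertices 1 and 2, so the
  multigraph used for the second whirl is the case \<open>n = 2\<close> of the wheel.\<close>

fun wheel_ends :: "nat \<Rightarrow> wheel_edge \<Rightarrow> nat set" where
  "wheel_ends n (Rim i) = {i, if i = n then 1 else i + 1}"
| "wheel_ends n (Spoke i) = {0, i}"

definition rim_edges :: "nat \<Rightarrow> wheel_edge set" where
  "rim_edges n = Rim ` {1..n}"

definition wheel_edges :: "nat \<Rightarrow> wheel_edge set" where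
  "wheel_edges n = rim_edges n \<union> Spoke ` {1..n}"

text \<open>The case \<open>n = 1\<close> is the graphic matroid of a single edge; the value at \<open>n = 0\<close> is
  irrelevant.\<close>

definition whirl :: "nat \<Rightarrow> wheel_edge matroid" where
  "whirl n =
     (if n = 1 then graphic_matroid (wheel_ends 1) {Spoke 1}
      else \<lparr>ground = wheel_edges n,
            indeps = insert (rim_edges n)
              (indeps (graphic_matroid (wheel_ends n) (wheel_edges n)))\<rparr>)"


section \<open>Square roots of power series\<close>

text \<open>The square root with constant term 1. The library's radicals of power series require a
  coefficient field, whereas here the coefficient ring is a polynomial ring over the integers.\<close>

definition fps_sqrt1 :: "'a::comm_ring_1 fps \<Rightarrow> 'a fps" where
  "fps_sqrt1 A = (THE S. fps_nth S 0 = 1 \<and> S ^ 2 = A)"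

end

(* Kazhdan--Lusztig polynomials exist and are characterised by the palindromicity of Z_M, through
   Moebius inversion. Hence a function f on the flats of M that is 1 at the top, satisfies the degree
   bounds and makes the sum over every upper interval of the lattice palindromic gives the
   Kazhdan--Lusztig polynomials of all contractions of M.

   A flat of the whirl is a cyclic word in the letters "spoke", "new block", "continued block", the
   arcs between spokes being fans. Let p_m and z_m be the Kazhdan--Lusztig and Z-polynomials of the
   fans, with series Phi and z; the p_m are Motzkin polynomials, the z_m Narayana polynomials, and
   z = 1 + (1 + t) u z + t u^2 z^2. Put f = the product of the p_m over the arcs, or the coefficient
   q_m of x Phi'/Phi if no spoke occurs. The sum over an upper interval is then a product of z_m's
   or, if no spoke occurs at its bottom, a coefficient of u z'/z. All of these are palindromic, and
   1 + u z'/z is the inverse of the square root 1 - (1 + t) u - 2 t u^2 z of the discriminant. *)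
theory Submission
  imports Defs
begin

subsection \<open>Rank, bases, contraction and localization\<close>

text \<open>The values of f on spokeless words are forced. Let a be the series of spokeless arcs,
  that is Phi after the substitution x = u / (1 - t u). A word on a fan is a sequence of arcs
  separated by spokes, so z = a / D with D = 1 - t u a, and u z'/z = u a'/a - u D'/D. The term - u
  D'/D is the series of cyclic words with a spoke, so the spokeless ones must contribute u a'/a,
  which is x Phi'/Phi after the same substitution, up to the factor 1 / (1 - t u) from the chain
  rule.

  Two facts make the words available. Independence in the whirl means that the edges can be matched
  to distinct rim endpoints, the rim being the only matchable set with a cycle; exchange, rank and
  flats all come from matchings. And the words describe the sets closed under the triangles of the
  wheel; the only one of these that is not a flat is the rim, and it does no harm because its weight
  is q_0 = 0.\<close>

lemma flat_subset: "F \<in> flats M \<Longrightarrow> F \<subseteq> ground M"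
  by (auto simp: flats_def)

context
  fixes M :: "'a matroid"
  assumes M: "is_matroid M"
begin

lemma finite_ground: "finite (ground M)"
  and indep_ground: "I \<in> indeps M \<Longrightarrow> I \<subseteq> ground M"
  and empty_indep: "{} \<in> indeps M"
  and indep_mono: "I \<in> indeps M \<Longrightarrow> J \<subseteq> I \<Longrightarrow> J \<in> indeps M"
  using M unfolding is_matroid_def by auto

lemma augment:
  "I \<in> indeps M \<Longrightarrow> J \<in> indeps M \<Longrightarrow> card I < card J \<Longrightarrow> \<exists>x\<in>J - I. insert x I \<in> indeps M"
  using M unfolding is_matroid_def by blast

lemma finite_indep: "I \<in> indeps M \<Longrightarrow> finite I"
  using finite_ground finite_subset indep_ground by blast

lemma finite_indeps: "finite (indeps M)"
  by (rule finite_subset[of _ "Pow (ground M)"]) (use finite_ground indep_ground in auto)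

lemma rank_ge: "I \<in> indeps M \<Longrightarrow> I \<subseteq> X \<Longrightarrow> card I \<le> rank_of M X"
  unfolding rank_of_def using finite_indeps by (intro Max_ge) auto

lemma rank_witness: obtains I where "I \<in> indeps M" "I \<subseteq> X" "card I = rank_of M X"
proof -
  have "rank_of M X \<in> card ` {I \<in> indeps M. I \<subseteq> X}"
    unfolding rank_of_def using finite_indeps empty_indep by (intro Max_in) auto
  then show ?thesis using that by auto
qed

lemma rank_mono: "X \<subseteq> Y \<Longrightarrow> rank_of M X \<le> rank_of M Y"
  by (rule rank_witness[of X]) (metis rank_ge subset_trans)

lemma rank_le_card: "finite X \<Longrightarrow> rank_of M X \<le> card X"
  by (rule rank_witness[of X]) (metis card_mono)

lemma rank_indep: "I \<in> indeps M \<Longrightarrow> rank_of M I = card I"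
  by (simp add: antisym finite_indep rank_ge rank_le_card)

lemma indep_if_rank: "finite X \<Longrightarrow> rank_of M X = card X \<Longrightarrow> X \<in> indeps M"
  by (rule rank_witness[of X]) (metis card_subset_eq)

lemma rank_empty: "rank_of M {} = 0"
  using rank_indep[OF empty_indep] by simp

lemma extend_indep:
  assumes "I \<in> indeps M" "I \<subseteq> X"
  obtains B where "B \<in> indeps M" "I \<subseteq> B" "B \<subseteq> X" "card B = rank_of M X"
proof -
  define \<B> where "\<B> = {B \<in> indeps M. I \<subseteq> B \<and> B \<subseteq> X}"
  have "finite \<B>" "I \<in> \<B>" using finite_indeps assms by (auto simp: \<B>_def)
  then have "Max (card ` \<B>) \<in> card ` \<B>" by (intro Max_in) auto
  then obtain B where "B \<in> \<B>" "card B = Max (card ` \<B>)" by force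
  then have B: "B \<in> \<B>" "\<And>C. C \<in> \<B> \<Longrightarrow> card C \<le> card B"
    using \<open>finite \<B>\<close> by auto
  have "card B = rank_of M X"
  proof (rule ccontr)
    assume "card B \<noteq> rank_of M X"
    moreover have "card B \<le> rank_of M X" using B by (intro rank_ge) (auto simp: \<B>_def)
    ultimately have less: "card B < rank_of M X" by simp
    obtain J where J: "J \<in> indeps M" "J \<subseteq> X" "card J = rank_of M X" by (rule rank_witness)
    then obtain x where x: "x \<in> J - B" "insert x B \<in> indeps M"
      using augment[of B J] B less by (auto simp: \<B>_def)
    then have "insert x B \<in> \<B>" using B J by (auto simp: \<B>_def)
    then have "card (insert x B) \<le> card B" using B by blast
    then show False using x finite_indep[of "insert x B"] by simp
  qed
  then show ?thesis using B that by (auto simp: \<B>_def)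
qed

lemma basis_of_iff: "basis_of M X B \<longleftrightarrow> B \<in> indeps M \<and> B \<subseteq> X \<and> card B = rank_of M X"
proof
  assume *: "basis_of M X B"
  then have B: "B \<in> indeps M" "B \<subseteq> X" by (auto simp: basis_of_def)
  obtain D where "D \<in> indeps M" "B \<subseteq> D" "D \<subseteq> X" "card D = rank_of M X"
    using extend_indep[OF B] .
  then show "B \<in> indeps M \<and> B \<subseteq> X \<and> card B = rank_of M X"
    using * unfolding basis_of_def by blast
next
  assume *: "B \<in> indeps M \<and> B \<subseteq> X \<and> card B = rank_of M X"
  then show "basis_of M X B"
    unfolding basis_of_def using card_seteq[OF finite_indep] rank_ge by metis
qed

lemma rank_insert_le: "rank_of M (insert x X) \<le> Suc (rank_of M X)"
proof -
  obtain I where I: "I \<in> indeps M" "I \<subseteq> insert x X" "card I = rank_of M (insert x X)"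
    by (rule rank_witness)
  have "card (I - {x}) \<le> rank_of M X"
    using I indep_mono[of I "I - {x}"] by (intro rank_ge) auto
  moreover have "card I \<le> Suc (card (I - {x}))"
    using card_insert_le_m1[of "Suc (card (I - {x}))" "I - {x}" x] finite_indep[OF I(1)]
    by (cases "x \<in> I") (auto simp: insert_absorb)
  ultimately show ?thesis using I by simp
qed

text \<open>Extend a basis B of X to a basis D of Y, and D to a basis of \<open>insert x Y\<close>.
  If the rank of Y grew, the last one would contain x, making \<open>insert x B\<close> independent
  inside \<open>insert x X\<close>.\<close>

lemma rank_insert_absorb:
  assumes "X \<subseteq> Y" "rank_of M (insert x X) = rank_of M X"
  shows "rank_of M (insert x Y) = rank_of M Y"
proof (rule ccontr)
  assume neq: "rank_of M (insert x Y) \<noteq> rank_of M Y"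
  obtain B where B: "B \<in> indeps M" "B \<subseteq> X" "card B = rank_of M X" by (rule rank_witness)
  obtain D where D: "D \<in> indeps M" "B \<subseteq> D" "D \<subseteq> Y" "card D = rank_of M Y"
    using extend_indep[OF B(1) subset_trans[OF B(2) assms(1)]] .
  obtain H where H: "H \<in> indeps M" "D \<subseteq> H" "H \<subseteq> insert x Y" "card H = rank_of M (insert x Y)"
    using extend_indep[OF D(1) subset_insertI2[OF D(3)]] .
  have "rank_of M Y < rank_of M (insert x Y)"
    using neq rank_mono[OF subset_insertI, of Y x] by linarith
  then have "x \<in> H" using rank_ge[OF H(1)] H by (metis not_le subset_insert)
  then have "insert x B \<in> indeps M" using B D H by (meson indep_mono insert_subset subset_trans)
  moreover have "x \<notin> B"
  proof
    assume "x \<in> B"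
    then have "insert x Y = Y" using D by blast
    then show False using neq by simp
  qed
  ultimately have "Suc (card B) \<le> rank_of M (insert x X)"
    using rank_ge[of "insert x B" "insert x X"] B finite_indep[OF B(1)] by (auto simp: insert_mono)
  then show False using B assms(2) by simp
qed

text \<open>A maximal superset of the same rank is a flat. It serves as the closure of a supposed
  non-flat in \<open>tri_closed_flat\<close>.\<close>

lemma flat_spanned:
  assumes "X \<subseteq> ground M" "x \<in> ground M" "rank_of M (insert x X) = rank_of M X"
  obtains F where "F \<in> flats M" "insert x X \<subseteq> F" "rank_of M F = rank_of M X"
proof -
  define \<F> where "\<F> = {F. insert x X \<subseteq> F \<and> F \<subseteq> ground M \<and> rank_of M F = rank_of M X}"
  have "finite \<F>" "insert x X \<in> \<F>"
    using finite_ground assms by (auto simp: \<F>_def intro: finite_subset[of _ "Pow (ground M)"])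
  then obtain F where F: "F \<in> \<F>" "\<And>H. H \<in> \<F> \<Longrightarrow> F \<subseteq> H \<Longrightarrow> F = H"
    using finite_has_maximal[of \<F>] by blast
  have "rank_of M F < rank_of M (insert y F)" if y: "y \<in> ground M - F" for y
  proof (rule ccontr)
    assume "\<not> ?thesis"
    then have "rank_of M (insert y F) = rank_of M F"
      using rank_mono[OF subset_insertI, of F y] by linarith
    then have "insert y F \<in> \<F>" using F y by (auto simp: \<F>_def)
    then show False using F y by blast
  qed
  then have "F \<in> flats M" using F by (auto simp: flats_def \<F>_def)
  then show ?thesis using F that by (auto simp: \<F>_def)
qed

lemma finite_flats: "finite (flats M)"
  using finite_ground by (auto simp: flats_def intro: finite_subset[of _ "Pow (ground M)"])

lemma flat_rank_strict:
  assumes "F \<in> flats M" "F \<subset> X" "X \<subseteq> ground M" shows "rank_of M F < rank_of M X"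
proof -
  obtain x where x: "x \<in> X - F" using assms by blast
  then have "rank_of M F < rank_of M (insert x F)" using assms by (auto simp: flats_def)
  also have "\<dots> \<le> rank_of M X" using x assms by (intro rank_mono) auto
  finally show ?thesis .
qed

lemma basis_inter:
  assumes "B \<in> indeps M" "card B = rank_of M F" "D \<in> indeps M" "B \<subseteq> D" "B \<subseteq> F"
  shows "D \<inter> F = B"
  by (rule card_seteq[symmetric])
    (use assms finite_indep indep_mono[of D "D \<inter> F"] rank_ge[of "D \<inter> F" F] in auto)

text \<open>The right-hand side does not mention B, so the existential over bases in
  \<open>contraction\<close> can be evaluated at any one basis of F; this yields
  \<open>indeps_contraction\<close>.\<close>

lemma indep_Un_basis_iff:
  assumes "B \<in> indeps M" "B \<subseteq> F" "card B = rank_of M F" "I \<subseteq> ground M - F"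
  shows "I \<union> B \<in> indeps M \<longleftrightarrow> rank_of M (I \<union> F) = card I + rank_of M F"
proof -
  have fin: "finite I" "finite B"
    using assms finite_ground finite_indep by (auto intro: finite_subset)
  have disj: "I \<inter> B = {}" using assms by auto
  obtain D where D: "D \<in> indeps M" "B \<subseteq> D" "D \<subseteq> I \<union> F" "card D = rank_of M (I \<union> F)"
    using extend_indep[of B "I \<union> F"] assms(1,2) by auto
  \<comment> \<open>A basis of \<open>I \<union> F\<close> that extends B takes nothing else from
    F.\<close>
  have "D \<inter> F = B" using basis_inter assms D by blast
  then have D_sub: "D \<subseteq> I \<union> B" using D by blast
  show ?thesis
  proof
    assume "I \<union> B \<in> indeps M"
    then have "card (I \<union> B) \<le> rank_of M (I \<union> F)" using assms by (intro rank_ge) auto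
    then show "rank_of M (I \<union> F) = card I + rank_of M F"
      using card_mono[OF _ D_sub] D(4) fin disj assms(3) by (simp add: card_Un_disjoint)
  next
    assume "rank_of M (I \<union> F) = card I + rank_of M F"
    then have "D = I \<union> B"
      using card_seteq[OF _ D_sub] D(4) fin disj assms(3) by (simp add: card_Un_disjoint)
    then show "I \<union> B \<in> indeps M" using D by simp
  qed
qed

lemma indeps_contraction:
  "indeps (contraction M F) =
     {I. I \<subseteq> ground M - F \<and> rank_of M (I \<union> F) = card I + rank_of M F}"
proof -
  obtain B where "B \<in> indeps M" "B \<subseteq> F" "card B = rank_of M F" by (rule rank_witness)
  then show ?thesis
    unfolding contraction_def basis_of_iff using indep_Un_basis_iff by auto
qed

lemma matroid_contraction: "is_matroid (contraction M F)"
proof -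
  obtain B where B: "B \<in> indeps M" "B \<subseteq> F" "card B = rank_of M F" by (rule rank_witness)
  have eq: "indeps (contraction M F) = {I. I \<subseteq> ground M - F \<and> I \<union> B \<in> indeps M}"
    using indeps_contraction indep_Un_basis_iff[OF B] by auto
  have "\<exists>x\<in>J - I. insert x I \<union> B \<in> indeps M \<and> insert x I \<subseteq> ground M - F"
    if IJ: "I \<subseteq> ground M - F" "I \<union> B \<in> indeps M" "J \<subseteq> ground M - F" "J \<union> B \<in> indeps M"
      "card I < card J" for I J
  proof -
    have "finite I" "finite J" "I \<inter> B = {}" "J \<inter> B = {}"
      using IJ B finite_ground by (auto intro: finite_subset)
    then have "card (I \<union> B) < card (J \<union> B)"
      using IJ finite_indep[OF B(1)] by (simp add: card_Un_disjoint)
    then obtain x where "x \<in> (J \<union> B) - (I \<union> B)" "insert x (I \<union> B) \<in> indeps M"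
      using augment IJ by blast
    then show ?thesis using IJ by (intro bexI[of _ x]) auto
  qed
  note augm = this
  have "ground (contraction M F) = ground M - F" by (simp add: contraction_def)
  then show ?thesis
    unfolding is_matroid_def eq
  proof (intro conjI ballI allI impI)
    fix I J assume "I \<in> {I. I \<subseteq> ground M - F \<and> I \<union> B \<in> indeps M}" "J \<subseteq> I"
    then show "J \<in> {I. I \<subseteq> ground M - F \<and> I \<union> B \<in> indeps M}"
      using indep_mono[of "I \<union> B" "J \<union> B"] by auto
  next
    fix I J
    assume "I \<in> {I. I \<subseteq> ground M - F \<and> I \<union> B \<in> indeps M}"
      "J \<in> {I. I \<subseteq> ground M - F \<and> I \<union> B \<in> indeps M}" "card I < card J"
    then show "\<exists>x\<in>J - I. insert x I \<in> {I. I \<subseteq> ground M - F \<and> I \<union> B \<in> indeps M}"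
      using augm[of I J] by auto
  qed (use finite_ground B in auto)
qed

lemma rank_contraction:
  assumes "X \<subseteq> ground M - F"
  shows "rank_of (contraction M F) X = rank_of M (X \<union> F) - rank_of M F"
proof -
  obtain B where B: "B \<in> indeps M" "B \<subseteq> F" "card B = rank_of M F" by (rule rank_witness)
  obtain D where D: "D \<in> indeps M" "B \<subseteq> D" "D \<subseteq> X \<union> F" "card D = rank_of M (X \<union> F)"
    using extend_indep[OF B(1) le_supI2[OF B(2)]] .
  have DF: "D \<inter> F = B" using basis_inter B D by blast
  have DB: "D - B \<subseteq> X" using D DF by blast
  have "(D - B) \<union> B = D" using D by blast
  then have "D - B \<in> indeps (contraction M F)"
    using indep_Un_basis_iff[OF B, of "D - B"] DB D assms by (auto simp: indeps_contraction)
  moreover have "card (D - B) = rank_of M (X \<union> F) - rank_of M F"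
    using D B finite_indep by (simp add: card_Diff_subset)
  moreover have "card I \<le> rank_of M (X \<union> F) - rank_of M F"
    if "I \<in> indeps (contraction M F)" "I \<subseteq> X" for I
  proof -
    have "rank_of M (I \<union> F) \<le> rank_of M (X \<union> F)" using that by (intro rank_mono) auto
    then show ?thesis using that by (simp add: indeps_contraction)
  qed
  moreover have "finite (indeps (contraction M F))"
    using finite_ground by (auto simp: indeps_contraction intro: finite_subset[of _ "Pow (ground M)"])
  ultimately show ?thesis
    unfolding rank_of_def[of "contraction M F"] using DB
    by (intro Max_eqI) (auto intro!: image_eqI[of _ card "D - B"])
qed

lemma rk_contraction: "F \<subseteq> ground M \<Longrightarrow> rk (contraction M F) = rk M - rank_of M F"
  unfolding rk_def using rank_contraction[of "ground M - F" F]
  by (simp add: contraction_def Un_absorb2)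

lemma flats_contraction:
  assumes "F \<subseteq> ground M"
  shows "flats (contraction M F) = (\<lambda>G. G - F) ` {G \<in> flats M. F \<subseteq> G}"
proof -
  have iff: "X \<in> flats (contraction M F) \<longleftrightarrow> X \<union> F \<in> flats M" if X: "X \<subseteq> ground M - F" for X
  proof -
    have "rank_of (contraction M F) X < rank_of (contraction M F) (insert x X) \<longleftrightarrow>
        rank_of M (X \<union> F) < rank_of M (insert x (X \<union> F))" if "x \<in> ground M - F - X" for x
      using that X rank_contraction[of X F] rank_contraction[of "insert x X" F]
        rank_mono[of F "X \<union> F"] by auto
    then show ?thesis using X assms unfolding flats_def by (auto simp: contraction_def)
  qed
  show ?thesis
  proof (intro set_eqI iffI)
    fix X assume X: "X \<in> flats (contraction M F)"
    then have sub: "X \<subseteq> ground M - F" by (auto simp: flats_def contraction_def)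
    then have "X = (X \<union> F) - F" by blast
    then show "X \<in> (\<lambda>G. G - F) ` {G \<in> flats M. F \<subseteq> G}" using iff[OF sub] X by blast
  next
    fix X assume "X \<in> (\<lambda>G. G - F) ` {G \<in> flats M. F \<subseteq> G}"
    then obtain G where G: "G \<in> flats M" "F \<subseteq> G" "X = G - F" by blast
    then have "X \<subseteq> ground M - F" "X \<union> F = G" using flat_subset by blast+
    then show "X \<in> flats (contraction M F)" using iff G by simp
  qed
qed

lemma contraction_empty: "contraction M {} = M"
proof -
  have "indeps (contraction M {}) = indeps M"
    unfolding indeps_contraction rank_empty
    using indep_ground indep_if_rank rank_indep finite_subset[OF _ finite_ground] by auto
  then show ?thesis by (simp add: contraction_def)
qed

lemma rank_localization: "X \<subseteq> F \<Longrightarrow> rank_of (localization M F) X = rank_of M X"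
  unfolding rank_of_def localization_def by (auto intro!: arg_cong[of _ _ "\<lambda>A. Max (card ` A)"])

lemma rk_localization: "rk (localization M F) = rank_of M F"
  using rank_localization[of F F] by (simp add: rk_def localization_def)

lemma flats_localization:
  assumes F: "F \<in> flats M"
  shows "flats (localization M F) = {G \<in> flats M. G \<subseteq> F}"
proof -
  have "rank_of M G < rank_of M (insert x G)"
    if "G \<subseteq> F" "x \<in> ground M" "x \<notin> F" for G x
  proof (rule ccontr)
    assume "\<not> ?thesis"
    then have "rank_of M (insert x G) = rank_of M G"
      using rank_mono[OF subset_insertI, of G x] by linarith
    then have "rank_of M (insert x F) = rank_of M F" using rank_insert_absorb that by blast
    moreover have "rank_of M F < rank_of M (insert x F)" using F that by (simp add: flats_def)
    ultimately show False by simp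
  qed
  moreover have "F \<subseteq> ground M" using F flat_subset by blast
  moreover have "ground (localization M F) = F" by (simp add: localization_def)
  ultimately show ?thesis
    unfolding flats_def by (auto simp: rank_localization) blast
qed

end

text \<open>An equality, not just an isomorphism, since contraction keeps the names of the elements.
  This is what lets iterated contractions be indexed by the flats of M.\<close>

lemma contraction_contraction:
  assumes M: "is_matroid M" and FG: "F \<subseteq> G" "G \<subseteq> ground M"
  shows "contraction (contraction M F) (G - F) = contraction M G"
proof -
  have ground: "ground (contraction M F) - (G - F) = ground M - G"
    using FG by (auto simp: contraction_def)
  have "rank_of (contraction M F) (I \<union> (G - F)) = card I + rank_of (contraction M F) (G - F)
      \<longleftrightarrow> rank_of M (I \<union> G) = card I + rank_of M G" if I: "I \<subseteq> ground M - G" for I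
  proof -
    have "I \<union> (G - F) \<union> F = I \<union> G" "G - F \<union> F = G"
      "I \<union> (G - F) \<subseteq> ground M - F" "G - F \<subseteq> ground M - F" using FG I by auto
    moreover have "rank_of M F \<le> rank_of M G" "rank_of M F \<le> rank_of M (I \<union> G)"
      using FG by (auto intro!: rank_mono[OF M])
    ultimately show ?thesis
      using rank_contraction[OF M, of "I \<union> (G - F)" F] rank_contraction[OF M, of "G - F" F]
      by auto
  qed
  then have "indeps (contraction (contraction M F) (G - F)) = indeps (contraction M G)"
    unfolding indeps_contraction[OF M] indeps_contraction[OF matroid_contraction[OF M]] ground
    by auto
  then show ?thesis using ground by (simp add: contraction_def)
qed

lemma loopless_contraction:
  assumes M: "is_matroid M" and F: "F \<in> flats M" shows "loopless (contraction M F)"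
proof -
  have "rank_of M (insert x F) = Suc (rank_of M F)" if "x \<in> ground M - F" for x
    using F that rank_insert_le[OF M, of x F] by (force simp: flats_def)
  then show ?thesis
    unfolding loopless_def indeps_contraction[OF M] by (simp add: contraction_def)
qed

lemma empty_flat:
  assumes M: "is_matroid M" and "loopless M" shows "{} \<in> flats M"
  using assms(2) rank_indep[OF M] rank_empty[OF M] by (auto simp: flats_def loopless_def)


subsection \<open>Palindromic polynomials\<close>

lemma coeff_reverse_poly:
  assumes "degree p \<le> d"
  shows "coeff (reverse_poly d p) i = (if i \<le> d then coeff p (d - i) else 0)"
  using assms unfolding reverse_poly_def coeff_monom_mult coeff_reflect_poly
  by (auto simp: coeff_eq_0)

lemma reverse_poly_sum:
  assumes "\<And>x. x \<in> A \<Longrightarrow> degree (p x) \<le> d"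
  shows "reverse_poly d (sum p A) = (\<Sum>x\<in>A. reverse_poly d (p x))"
proof (cases "finite A")
  case True
  have "degree (sum p A) \<le> d" using assms True by (intro degree_sum_le) auto
  then show ?thesis
    using assms by (intro poly_eqI) (auto simp: coeff_reverse_poly coeff_sum)
qed (simp add: reverse_poly_def)

lemma reverse_poly_monom_mult:
  assumes "degree p \<le> d"
  shows "reverse_poly (k + d) (monom 1 k * p) = reverse_poly d p"
proof -
  have "degree (monom 1 k * p) \<le> k + d"
    using degree_mult_le[of "monom 1 k" p] degree_monom_le[of "1::int" k] assms by linarith
  then show ?thesis
    using assms
    by (intro poly_eqI) (auto simp: coeff_reverse_poly coeff_monom_mult coeff_eq_0)
qed

lemma reverse_poly_mult:
  assumes "degree p \<le> d" "degree q \<le> e"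
  shows "reverse_poly (d + e) (p * q) = reverse_poly d p * reverse_poly e q"
proof (cases "p = 0 \<or> q = 0")
  case False
  then have "degree (p * q) = degree p + degree q" by (simp add: degree_mult_eq)
  then have "d + e - degree (p * q) = (d - degree p) + (e - degree q)" using assms by simp
  then have "monom (1::int) (d + e - degree (p * q)) =
      monom 1 (d - degree p) * monom 1 (e - degree q)"
    by (simp add: mult_monom)
  then show ?thesis by (simp only: reverse_poly_def reflect_poly_mult mult_ac)
qed (auto simp: reverse_poly_def)

text \<open>The length d is kept apart from the degree: 0 has every length and t has length 2.
  Lengths add under products.\<close>

definition palindromic :: "nat \<Rightarrow> int poly \<Rightarrow> bool" where
  "palindromic d p \<longleftrightarrow> degree p \<le> d \<and> reverse_poly d p = p"

lemma palindromic_iff_coeff: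
  "palindromic d p \<longleftrightarrow> degree p \<le> d \<and> (\<forall>i\<le>d. coeff p i = coeff p (d - i))"
proof (cases "degree p \<le> d")
  case True
  have "coeff (reverse_poly d p) i = coeff p i \<longleftrightarrow> (i \<le> d \<longrightarrow> coeff p i = coeff p (d - i))" for i
    unfolding coeff_reverse_poly[OF True] using True by (cases "i \<le> d") (auto simp: coeff_eq_0)
  then show ?thesis unfolding palindromic_def poly_eq_iff by blast
qed (simp add: palindromic_def)

lemma palindromic_0: "palindromic d 0"
  and palindromic_1: "palindromic 0 1"
  by (simp_all add: palindromic_def reverse_poly_def)

lemma palindromic_add:
  assumes "palindromic d p" "palindromic d q" shows "palindromic d (p + q)"
proof -
  have "coeff p i + coeff q i = coeff p (d - i) + coeff q (d - i)" if "i \<le> d" for i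
    using assms that unfolding palindromic_iff_coeff by metis
  moreover have "degree (p + q) \<le> d"
    using assms by (intro degree_add_le) (simp_all add: palindromic_def)
  ultimately show ?thesis unfolding palindromic_iff_coeff coeff_add by blast
qed

lemma palindromic_diff:
  assumes "palindromic d p" "palindromic d q" shows "palindromic d (p - q)"
proof -
  have "coeff p i - coeff q i = coeff p (d - i) - coeff q (d - i)" if "i \<le> d" for i
    using assms that unfolding palindromic_iff_coeff by metis
  moreover have "degree (p - q) \<le> d"
    using assms by (intro degree_diff_le) (simp_all add: palindromic_def)
  ultimately show ?thesis unfolding palindromic_iff_coeff coeff_diff by blast
qed

lemma palindromic_sum: "(\<And>x. x \<in> A \<Longrightarrow> palindromic d (p x)) \<Longrightarrow> palindromic d (sum p A)"
  by (induction A rule: infinite_finite_induct) (auto intro: palindromic_0 palindromic_add)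

lemma palindromic_mult:
  "palindromic d p \<Longrightarrow> palindromic e q \<Longrightarrow> palindromic (d + e) (p * q)"
  using degree_mult_le[of p q] unfolding palindromic_def by (simp add: reverse_poly_mult)

text \<open>The degree bounds kill the upper half of the coefficients of \<open>p - q\<close>, and
  the symmetry carries these zeros to the lower half.\<close>

lemma palindromic_unique:
  assumes "palindromic d (p - q)" "2 * degree p < d" "2 * degree q < d"
  shows "p = q"
proof (rule poly_eqI)
  fix i
  have zero: "coeff (p - q) j = 0" if "2 * j \<ge> d" for j
    using that assms(2,3) by (simp add: coeff_eq_0)
  have "coeff (p - q) i = 0"
  proof (cases "2 * i < d")
    case True
    then have "i \<le> d" by simp
    then have "coeff (p - q) i = coeff (p - q) (d - i)"
      using assms(1) unfolding palindromic_iff_coeff by blast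
    then show ?thesis using zero[of "d - i"] True by (simp del: coeff_diff)
  qed (use zero in simp)
  then show "coeff p i = coeff q i" by simp
qed

text \<open>For d > 0 the only polynomial of degree below d/2 that can make r palindromic when
  added: each low coefficient must supply the difference to its mirror image.\<close>

definition pal_complement :: "nat \<Rightarrow> int poly \<Rightarrow> int poly" where
  "pal_complement d r = (\<Sum>i | 2 * i < d. monom (coeff r (d - i) - coeff r i) i)"

lemma coeff_pal_complement:
  "coeff (pal_complement d r) i = (if 2 * i < d then coeff r (d - i) - coeff r i else 0)"
proof -
  have "finite {i. 2 * i < d}" by (rule finite_subset[of _ "{..d}"]) auto
  then show ?thesis by (simp add: pal_complement_def coeff_sum)
qed

lemma degree_pal_complement: "d > 0 \<Longrightarrow> 2 * degree (pal_complement d r) < d"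
proof -
  assume d: "d > 0"
  have "degree (pal_complement d r) \<le> (d - 1) div 2"
    using d by (intro degree_le) (auto simp: coeff_pal_complement)
  then show ?thesis using d by linarith
qed

text \<open>Of i and \<open>d - i\<close> exactly one lies in the lower half and is corrected there,
  unless both are the middle.\<close>

lemma palindromic_complement:
  assumes "degree r \<le> d" shows "palindromic d (pal_complement d r + r)"
proof (cases "d = 0")
  case False
  then have "degree (pal_complement d r) \<le> d" using degree_pal_complement[of d r] by simp
  then have "degree (pal_complement d r + r) \<le> d" using assms by (intro degree_add_le)
  moreover have "coeff (pal_complement d r + r) i = coeff (pal_complement d r + r) (d - i)"
    if "i \<le> d" for i
  proof (cases "2 * i = d")
    case True
    then have "d - i = i" by simp
    then show ?thesis by simp
  next
    case False
    then have "2 * i < d \<and> \<not> 2 * (d - i) < d \<or> \<not> 2 * i < d \<and> 2 * (d - i) < d" 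
      using that by auto
    then show ?thesis using that by (auto simp: coeff_pal_complement)
  qed
  ultimately show ?thesis unfolding palindromic_iff_coeff by blast
next
  case True
  then show ?thesis using assms by (simp add: palindromic_iff_coeff pal_complement_def)
qed


subsection \<open>Existence and uniqueness of Kazhdan--Lusztig polynomials\<close>

lemma rk_eq_0_ground:
  assumes M: "is_matroid M" and "loopless M" and "rk M = 0"
  shows "ground M = {}"
proof (rule ccontr)
  assume "ground M \<noteq> {}"
  then obtain x where "x \<in> ground M" "{x} \<in> indeps M" using assms by (auto simp: loopless_def)
  then show False using rank_ge[OF M, of "{x}" "ground M"] assms(3) by (simp add: rk_def)
qed

text \<open>In the palindromic sum the flat {} contributes the polynomial of M itself; the other
  summands come from contractions with fewer elements and determine it. The value 0 elsewhere is the
  normalisation in \<open>kl_poly\<close>.\<close>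

function kl_rec :: "'a matroid \<Rightarrow> int poly" where
  "kl_rec M =
     (if is_matroid M \<and> loopless M then
        if rk M = 0 then 1
        else pal_complement (rk M)
          (\<Sum>F\<in>flats M - {{}}. monom 1 (rank_of M F) * kl_rec (contraction M F))
      else 0)"
  by pat_completeness auto
termination
proof (relation "Wellfounded.measure (\<lambda>M. card (ground M))")
  fix M :: "'a matroid" and F
  assume "is_matroid M \<and> loopless M" "F \<in> flats M - {{}}"
  then have "ground M - F \<subset> ground M" "finite (ground M)"
    using flat_subset[of F M] finite_ground[of M] by auto
  then show "(contraction M F, M) \<in> Wellfounded.measure (\<lambda>M. card (ground M))"
    by (simp add: contraction_def psubset_card_mono)
qed auto

declare kl_rec.simps [simp del]

lemma kl_rec_undefined: "\<not> (is_matroid M \<and> loopless M) \<Longrightarrow> kl_rec M = 0"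
  by (subst kl_rec.simps) auto

lemma kl_rec_degree:
  assumes "is_matroid M" "loopless M"
  shows "rk M = 0 \<Longrightarrow> kl_rec M = 1" "rk M > 0 \<Longrightarrow> 2 * degree (kl_rec M) < rk M"
    "degree (kl_rec M) \<le> rk M"
proof -
  show *: "rk M = 0 \<Longrightarrow> kl_rec M = 1" "rk M > 0 \<Longrightarrow> 2 * degree (kl_rec M) < rk M"
    using assms degree_pal_complement by (subst kl_rec.simps; simp)+
  show "degree (kl_rec M) \<le> rk M" using * by (cases "rk M = 0") auto
qed

lemma kl_rec_contraction_degree:
  assumes "is_matroid M" "F \<in> flats M"
  shows "degree (kl_rec (contraction M F)) \<le> rk M - rank_of M F"
  using kl_rec_degree(3)[OF matroid_contraction loopless_contraction]
    rk_contraction flat_subset assms by metis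

lemma rank_le_rk: "is_matroid M \<Longrightarrow> F \<in> flats M \<Longrightarrow> rank_of M F \<le> rk M"
  unfolding rk_def by (simp add: flat_subset rank_mono)

lemma degree_monom_mult_le:
  "degree p \<le> d \<Longrightarrow> degree (monom (1::int) k * p) \<le> k + d"
  using degree_mult_le[of "monom 1 k" p] degree_monom_le[of "1::int" k] by linarith

lemma kl_rec_palindromic:
  assumes M: "is_matroid M" and ll: "loopless M"
  shows "palindromic (rk M) (\<Sum>F\<in>flats M. monom 1 (rank_of M F) * kl_rec (contraction M F))"
proof (cases "rk M = 0")
  case True
  then have ground: "ground M = {}" using rk_eq_0_ground M ll by blast
  then have "flats M = {{}}" by (auto simp: flats_def)
  moreover have "kl_rec M = 1" using True kl_rec_degree M ll by blast
  ultimately show ?thesis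
    using True by (simp add: contraction_empty[OF M] rank_empty[OF M] palindromic_1)
next
  case False
  let ?R = "\<Sum>F\<in>flats M - {{}}. monom 1 (rank_of M F) * kl_rec (contraction M F)"
  have "degree ?R \<le> rk M"
  proof (rule degree_sum_le)
    fix F assume "F \<in> flats M - {{}}"
    then have F: "F \<in> flats M" by simp
    show "degree (monom 1 (rank_of M F) * kl_rec (contraction M F)) \<le> rk M"
      using degree_monom_mult_le[OF kl_rec_contraction_degree[OF M F], of "rank_of M F"]
        rank_le_rk[OF M F] by simp
  qed (use finite_flats[OF M] in simp)
  moreover have "kl_rec M = pal_complement (rk M) ?R"
    using False M ll by (subst kl_rec.simps) simp
  ultimately have "palindromic (rk M) (kl_rec M + ?R)"
    by (simp add: palindromic_complement)
  then show ?thesis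
    using empty_flat[OF M ll] finite_flats[OF M]
    by (simp add: sum.remove contraction_empty[OF M] rank_empty[OF M])
qed

lemma sum_flats_contraction:
  assumes M: "is_matroid M" and G: "G \<in> flats M"
  shows "(\<Sum>F\<in>flats (contraction M G).
            monom 1 (rank_of (contraction M G) F) * h (contraction (contraction M G) F)) =
         (\<Sum>F\<in>{F \<in> flats M. G \<subseteq> F}. monom 1 (rank_of M F - rank_of M G) * h (contraction M F))"
proof -
  have "inj_on (\<lambda>F. F - G) {F \<in> flats M. G \<subseteq> F}" by (auto simp: inj_on_def)
  moreover have "rank_of (contraction M G) (F - G) = rank_of M F - rank_of M G"
    if "F \<in> flats M" "G \<subseteq> F" for F
  proof -
    have "F - G \<subseteq> ground M - G" "F - G \<union> G = F" using that flat_subset[OF that(1)] by auto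
    then show ?thesis using rank_contraction[OF M, of "F - G" G] by simp
  qed
  ultimately show ?thesis
    unfolding flats_contraction[OF M flat_subset[OF G]]
    by (subst sum.reindex) (auto intro!: sum.cong simp: contraction_contraction[OF M] flat_subset)
qed

lemma kl_rec_palindromic_interval:
  assumes M: "is_matroid M" and G: "G \<in> flats M"
  shows "palindromic (rk M - rank_of M G)
    (\<Sum>F\<in>{F \<in> flats M. G \<subseteq> F}. monom 1 (rank_of M F - rank_of M G) * kl_rec (contraction M F))"
  using kl_rec_palindromic[OF matroid_contraction[OF M, of G] loopless_contraction[OF M G]]
  unfolding sum_flats_contraction[OF M G] rk_contraction[OF M flat_subset[OF G]] .

text \<open>The recursion at G visits only members of L below G, so cutting L off above F changes
  nothing.\<close>

lemma moebius_restrict: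
  assumes "finite F" "G \<subseteq> F"
  shows "moebius {H \<in> L. H \<subseteq> F} A G = moebius L A G"
  using finite_subset[OF assms(2,1)] assms(2)
proof (induction G rule: finite_psubset_induct)
  case (psubset G)
  have "{H \<in> {H \<in> L. H \<subseteq> F}. A \<subseteq> H \<and> H \<subset> G} = {H \<in> L. A \<subseteq> H \<and> H \<subset> G}"
    using psubset.prems by auto
  moreover have "(\<Sum>H\<in>{H \<in> L. A \<subseteq> H \<and> H \<subset> G}. moebius {H \<in> L. H \<subseteq> F} A H) =
      (\<Sum>H\<in>{H \<in> L. A \<subseteq> H \<and> H \<subset> G}. moebius L A H)"
    using psubset by (intro sum.cong) auto
  ultimately show ?case
    by (simp only: moebius.simps[of _ A G])
qed

lemma moebius_sum:
  assumes "finite F" "F \<in> L" "{} \<in> L"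
  shows "(\<Sum>G\<in>{G \<in> L. G \<subseteq> F}. moebius L {} G) = (if F = {} then 1 else 0)"
proof (cases "F = {}")
  case True
  then have "{G \<in> L. G \<subseteq> F} = {{}}" using assms by auto
  then show ?thesis using True by (simp add: moebius.simps)
next
  case False
  have "{G \<in> L. G \<subseteq> F} = insert F {G \<in> L. {} \<subseteq> G \<and> G \<subset> F}" using assms by auto
  moreover have "finite {G \<in> L. {} \<subseteq> G \<and> G \<subset> F}"
    using assms by (auto intro: finite_subset[of _ "Pow F"])
  moreover have "moebius L {} F = - (\<Sum>G\<in>{G \<in> L. {} \<subseteq> G \<and> G \<subset> F}. moebius L {} G)"
    using False assms by (subst moebius.simps) auto
  ultimately show ?thesis using False by simp
qed

lemma char_poly_localization:
  assumes M: "is_matroid M" and ll: "loopless M" and F: "F \<in> flats M"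
  shows "char_poly (localization M F) =
    (\<Sum>G\<in>{G \<in> flats M. G \<subseteq> F}. monom (moebius (flats M) {} G) (rank_of M F - rank_of M G))"
proof -
  have "\<Inter>{G \<in> flats M. G \<subseteq> F} = {}" using empty_flat[OF M ll] by auto
  moreover have "finite F" using flat_subset[OF F] finite_ground[OF M] finite_subset by blast
  ultimately show ?thesis
    unfolding char_poly_def flats_localization[OF M F] rk_localization[OF M]
    by (auto intro!: sum.cong simp: moebius_restrict rank_localization[OF M])
qed

lemma char_poly_localization_empty:
  assumes M: "is_matroid M" and ll: "loopless M"
  shows "char_poly (localization M {}) = 1"
proof -
  have "{G \<in> flats M. G \<subseteq> {}} = {{}}" using empty_flat[OF M ll] by auto
  then show ?thesis
    by (simp add: char_poly_localization[OF M ll empty_flat[OF M ll]] moebius.simps)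
qed

text \<open>Palindromicity over the upper interval of G equates a sum of reversed polynomials with a
  sum of plain ones. Weighted with the Moebius value of G and summed over G, one side isolates the
  reversed polynomial of M and the other collects characteristic polynomials.\<close>

lemma kl_rec_equation:
  assumes M: "is_matroid M" and ll: "loopless M"
  shows "reverse_poly (rk M) (kl_rec M) =
    (\<Sum>F\<in>flats M. char_poly (localization M F) * kl_rec (contraction M F))"
proof -
  let ?L = "flats M" and ?r = "rank_of M" and ?n = "rk M"
  define f where "f F = kl_rec (contraction M F)" for F
  define \<mu> where "\<mu> = moebius ?L {}"
  have fin: "finite ?L" using finite_flats[OF M] .
  have E: "{} \<in> ?L" using empty_flat[OF M ll] .
  have A: "(\<Sum>F\<in>{F \<in> ?L. G \<subseteq> F}. reverse_poly (?n - ?r F) (f F)) =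
      (\<Sum>F\<in>{F \<in> ?L. G \<subseteq> F}. monom 1 (?r F - ?r G) * f F)" if G: "G \<in> ?L" for G
  proof -
    have eq: "?r F - ?r G + (?n - ?r F) = ?n - ?r G" if "F \<in> ?L" "G \<subseteq> F" for F
      using rank_le_rk[OF M that(1)] rank_mono[OF M that(2)] by simp
    have deg: "degree (f F) \<le> ?n - ?r F" if "F \<in> ?L" for F
      unfolding f_def using kl_rec_contraction_degree[OF M that] .
    have "(\<Sum>F\<in>{F \<in> ?L. G \<subseteq> F}. monom 1 (?r F - ?r G) * f F) =
        reverse_poly (?n - ?r G) (\<Sum>F\<in>{F \<in> ?L. G \<subseteq> F}. monom 1 (?r F - ?r G) * f F)"
      using kl_rec_palindromic_interval[OF M G] by (simp add: palindromic_def f_def)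
    also have "\<dots> = (\<Sum>F\<in>{F \<in> ?L. G \<subseteq> F}. reverse_poly (?n - ?r G) (monom 1 (?r F - ?r G) * f F))"
      using degree_monom_mult_le[OF deg] eq by (intro reverse_poly_sum) (metis mem_Collect_eq)
    also have "\<dots> = (\<Sum>F\<in>{F \<in> ?L. G \<subseteq> F}. reverse_poly (?n - ?r F) (f F))"
      using reverse_poly_monom_mult[OF deg] eq by (intro sum.cong refl) (metis mem_Collect_eq)
    finally show ?thesis ..
  qed
  have swap: "(\<Sum>G\<in>?L. \<Sum>F\<in>{F \<in> ?L. G \<subseteq> F}. g G F) = (\<Sum>F\<in>?L. \<Sum>G\<in>{G \<in> ?L. G \<subseteq> F}. g G F)"
    for g :: "'a set \<Rightarrow> 'a set \<Rightarrow> int poly"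
    using sum.swap_restrict[OF fin fin] .
  have smult_sum_right: "smult c (sum g A) = (\<Sum>x\<in>A. smult c (g x))"
    for c and g :: "'a set \<Rightarrow> int poly" and A
    by (induction A rule: infinite_finite_induct) (auto simp: smult_add_right)
  \<comment> \<open>After exchanging the sums, the Moebius values of all G below F add up to 0
    unless F is empty.\<close>
  have "(\<Sum>G\<in>?L. smult (\<mu> G) (\<Sum>F\<in>{F \<in> ?L. G \<subseteq> F}. reverse_poly (?n - ?r F) (f F))) =
      (\<Sum>F\<in>?L. smult (\<Sum>G\<in>{G \<in> ?L. G \<subseteq> F}. \<mu> G) (reverse_poly (?n - ?r F) (f F)))"
    by (simp add: smult_sum_right swap smult_sum)
  also have "\<dots> = (\<Sum>F\<in>?L. if F = {} then reverse_poly ?n (kl_rec M) else 0)"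
  proof (intro sum.cong refl)
    fix F assume F: "F \<in> ?L"
    then have "finite F" using flat_subset finite_ground[OF M] finite_subset by blast
    then show "smult (\<Sum>G\<in>{G \<in> ?L. G \<subseteq> F}. \<mu> G) (reverse_poly (?n - ?r F) (f F)) =
        (if F = {} then reverse_poly ?n (kl_rec M) else 0)"
      using moebius_sum[OF _ F E]
      by (simp add: \<mu>_def rank_empty[OF M] f_def contraction_empty[OF M])
  qed
  also have "\<dots> = reverse_poly ?n (kl_rec M)" using fin E by simp
  finally have left: "(\<Sum>G\<in>?L. smult (\<mu> G) (\<Sum>F\<in>{F \<in> ?L. G \<subseteq> F}. reverse_poly (?n - ?r F) (f F)))
      = reverse_poly ?n (kl_rec M)" .
  \<comment> \<open>The same exchange on the other side: the inner sum becomes the characteristic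
    polynomial of the localization at F.\<close>
  have "(\<Sum>G\<in>?L. smult (\<mu> G) (\<Sum>F\<in>{F \<in> ?L. G \<subseteq> F}. monom 1 (?r F - ?r G) * f F)) =
      (\<Sum>F\<in>?L. (\<Sum>G\<in>{G \<in> ?L. G \<subseteq> F}. monom (\<mu> G) (?r F - ?r G)) * f F)"
    by (simp add: smult_sum_right swap sum_distrib_right smult_monom flip: mult_smult_left)
  also have "\<dots> = (\<Sum>F\<in>?L. char_poly (localization M F) * f F)"
    by (intro sum.cong refl) (simp add: char_poly_localization[OF M ll] \<mu>_def)
  finally show ?thesis using left A by (simp add: f_def)
qed

lemma kl_assignment_kl_rec: "kl_assignment kl_rec"
  unfolding kl_assignment_def using kl_rec_degree kl_rec_equation by blast

text \<open>By induction P and Q agree on all proper contractions. The summand of {} is the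
  polynomial of M times 1, so \<open>P M - Q M\<close> is its own reversal, and the degree bounds
  make it 0.\<close>

lemma kl_assignment_unique:
  assumes P: "kl_assignment P" and Q: "kl_assignment Q" and "is_matroid M" "loopless M"
  shows "P M = Q M"
  using assms(3,4)
proof (induction "card (ground M)" arbitrary: M rule: less_induct)
  case less
  note M = less.prems(1) and ll = less.prems(2)
  show ?case
  proof (cases "rk M = 0")
    case True
    then show ?thesis using P Q M ll unfolding kl_assignment_def by metis
  next
    case False
    let ?S = "\<lambda>P. \<Sum>F\<in>flats M - {{}}. char_poly (localization M F) * P (contraction M F)"
    have deg: "2 * degree (P M) < rk M" "2 * degree (Q M) < rk M"
      using P Q M ll False by (auto simp: kl_assignment_def)
    have eq: "reverse_poly (rk M) (P M) = P M + ?S P"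
      if "kl_assignment P" for P :: "'a matroid \<Rightarrow> int poly"
    proof -
      have "reverse_poly (rk M) (P M) =
          (\<Sum>F\<in>flats M. char_poly (localization M F) * P (contraction M F))"
        using that M ll by (simp add: kl_assignment_def)
      then show ?thesis
        using finite_flats[OF M] empty_flat[OF M ll]
        by (simp add: sum.remove contraction_empty[OF M] char_poly_localization_empty[OF M ll])
    qed
    have "P (contraction M F) = Q (contraction M F)" if F: "F \<in> flats M - {{}}" for F
    proof (rule less.hyps)
      have "ground M - F \<subset> ground M" using F flat_subset[of F M] by auto
      then show "card (ground (contraction M F)) < card (ground M)"
        by (simp add: contraction_def psubset_card_mono finite_ground[OF M])
    qed (use matroid_contraction[OF M] loopless_contraction[OF M] F in auto)
    then have "?S P = ?S Q" by simp
    then have rev: "reverse_poly (rk M) (P M) - reverse_poly (rk M) (Q M) = P M - Q M"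
      using eq[OF P] eq[OF Q] by simp
    have "palindromic (rk M) (P M - Q M)"
    proof -
      have "degree (P M - Q M) \<le> rk M" using deg by (intro degree_diff_le) auto
      moreover from this have
        "reverse_poly (rk M) (P M - Q M) = reverse_poly (rk M) (P M) - reverse_poly (rk M) (Q M)"
        using deg by (intro poly_eqI) (simp add: coeff_reverse_poly)
      ultimately show ?thesis by (simp add: palindromic_def rev)
    qed
    then show ?thesis using palindromic_unique deg by blast
  qed
qed

lemma kl_poly_eq_kl_rec: "kl_poly = kl_rec"
  unfolding kl_poly_def
proof (rule the_equality)
  show "kl_assignment kl_rec \<and> (\<forall>M. \<not> (is_matroid M \<and> loopless M) \<longrightarrow> kl_rec M = 0)"
    using kl_assignment_kl_rec kl_rec_undefined by blast
  fix P :: "'a matroid \<Rightarrow> int poly"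
  assume P: "kl_assignment P \<and> (\<forall>M. \<not> (is_matroid M \<and> loopless M) \<longrightarrow> P M = 0)"
  show "P = kl_rec"
  proof
    fix M show "P M = kl_rec M"
      using P kl_assignment_unique[OF _ kl_assignment_kl_rec, of P M]
      by (cases "is_matroid M \<and> loopless M") (auto simp: kl_rec_undefined)
  qed
qed

text \<open>The Kazhdan--Lusztig polynomials of all contractions of \<open>M\<close> are recognised at once inside
  the lattice of flats of \<open>M\<close>, so neither direct sums nor isomorphisms of minors are needed.\<close>

theorem z_poly_eqI:
  assumes M: "is_matroid M" and ll: "loopless M"
    and top: "f (ground M) = 1"
    and deg: "\<And>F. F \<in> flats M \<Longrightarrow> F \<noteq> ground M \<Longrightarrow> 2 * degree (f F) < rk M - rank_of M F"
    and pal: "\<And>G. G \<in> flats M \<Longrightarrow> palindromic (rk M - rank_of M G)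
      (\<Sum>F\<in>{F \<in> flats M. G \<subseteq> F}. monom 1 (rank_of M F - rank_of M G) * f F)"
  shows "z_poly M = (\<Sum>F\<in>flats M. monom 1 (rank_of M F) * f F)"
proof -
  have kl: "kl_rec (contraction M G) = f G" if "G \<in> flats M" for G
    using that
  proof (induction "card (ground M - G)" arbitrary: G rule: less_induct)
    case less
    note G = less.prems
    let ?I = "{F \<in> flats M. G \<subseteq> F}" and ?d = "rk M - rank_of M G"
    let ?N = "contraction M G"
    have N: "is_matroid ?N" "loopless ?N" "rk ?N = ?d"
      using matroid_contraction[OF M] loopless_contraction[OF M G]
        rk_contraction[OF M flat_subset[OF G]] by auto
    show ?case
    proof (cases "G = ground M")
      case True
      then have "?d = 0" by (simp add: rk_def)
      then show ?thesis using kl_rec_degree(1)[OF N(1,2)] N(3) top True by simp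
    next
      case False
      then have "G \<subset> ground M" using flat_subset[OF G] by blast
      then have pos: "?d > 0" using flat_rank_strict[OF M G] by (simp add: rk_def)
      have fin: "finite ?I" "G \<in> ?I" using finite_flats[OF M] G by auto
      have "kl_rec (contraction M F) = f F" if F: "F \<in> ?I - {G}" for F
      proof (rule less.hyps)
        have "ground M - F \<subset> ground M - G" using F flat_subset[of F M] by blast
        then show "card (ground M - F) < card (ground M - G)"
          by (intro psubset_card_mono) (auto simp: finite_ground[OF M])
      qed (use F in simp)
      then have "(\<Sum>F\<in>?I - {G}. monom 1 (rank_of M F - rank_of M G) * kl_rec (contraction M F)) =
          (\<Sum>F\<in>?I - {G}. monom 1 (rank_of M F - rank_of M G) * f F)"
        by (intro sum.cong) auto
      \<comment> \<open>Both interval sums are palindromic and by induction differ only in their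
        bottom term F = G.\<close>
      then have "palindromic ?d (kl_rec ?N - f G)"
        using palindromic_diff[OF kl_rec_palindromic_interval[OF M G] pal[OF G]]
        by (simp add: sum.remove[OF fin])
      then show ?thesis
        using palindromic_unique deg[OF G False] kl_rec_degree(2)[OF N(1,2)] N(3) pos by metis
    qed
  qed
  show ?thesis
    unfolding z_poly_def kl_poly_eq_kl_rec
    by (intro sum.cong refl) (simp add: rk_localization[OF M] kl)
qed


subsection \<open>Generating functions of fans and whirls\<close>

abbreviation (input) tp :: "int poly" where "tp \<equiv> monom 1 (Suc 0)"

text \<open>The coefficient of t^k counts Motzkin paths of length n with k up steps. The recursion
  splits off a level first step, or an up step with its matching down step.\<close>

fun motzkin :: "nat \<Rightarrow> int poly" where
  "motzkin 0 = 1"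
| "motzkin (Suc n) = motzkin n + tp * (\<Sum>i<n. motzkin i * motzkin (n - 1 - i))"

text \<open>The index is the number of rim vertices of the fan, that is its rank; the shift by one
  gives degree below n/2 for n > 0.\<close>

definition fan_kl :: "nat \<Rightarrow> int poly" where
  "fan_kl n = (if n = 0 then 1 else motzkin (n - 1))"

lemma degree_motzkin: "2 * degree (motzkin n) \<le> n"
proof (induction n rule: less_induct)
  case (less n)
  show ?case
  proof (cases n)
    case (Suc m)
    have "degree (tp * (\<Sum>i<m. motzkin i * motzkin (m - 1 - i))) \<le> Suc m div 2"
    proof (cases m)
      case (Suc l)
      have "degree (\<Sum>i<m. motzkin i * motzkin (m - 1 - i)) \<le> l div 2"
      proof (intro degree_sum_le)
        fix i assume i: "i \<in> {..<m}"
        then have "2 * degree (motzkin i) \<le> i" "2 * degree (motzkin (m - 1 - i)) \<le> m - 1 - i"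
          using less[of i] less[of "m - 1 - i"] \<open>n = Suc m\<close> by auto
        then show "degree (motzkin i * motzkin (m - 1 - i)) \<le> l div 2"
          using degree_mult_le[of "motzkin i" "motzkin (m - 1 - i)"] i Suc by simp
      qed simp
      then show ?thesis using degree_monom_mult_le[of _ "l div 2" 1] Suc by fastforce
    qed simp
    moreover have "degree (motzkin m) \<le> Suc m div 2" using less[of m] Suc by simp
    ultimately have "degree (motzkin n) \<le> Suc m div 2"
      unfolding Suc motzkin.simps by (intro degree_add_le)
    then show ?thesis using Suc by simp
  qed simp
qed

lemma degree_fan_kl: "2 * degree (fan_kl n) \<le> n - 1"
  using degree_motzkin[of "n - 1"] by (simp add: fan_kl_def)

definition motzkin_fps :: "int poly fps" where "motzkin_fps = Abs_fps motzkin"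

definition fan_fps :: "int poly fps" where "fan_fps = Abs_fps fan_kl"

lemma fan_fps_eq: "fan_fps = 1 + fps_X * motzkin_fps"
  by (rule fps_ext) (simp add: fan_fps_def motzkin_fps_def fan_kl_def)

lemma motzkin_fps_eq:
  "motzkin_fps = 1 + fps_X * motzkin_fps + fps_const tp * fps_X ^ 2 * motzkin_fps ^ 2"
proof (rule fps_ext)
  fix n
  have sq: "(motzkin_fps ^ 2) $ m = (\<Sum>i\<le>m. motzkin i * motzkin (m - i))" for m
    by (simp add: power2_eq_square fps_mult_nth motzkin_fps_def atLeast0AtMost)
  show "motzkin_fps $ n =
      (1 + fps_X * motzkin_fps + fps_const tp * fps_X ^ 2 * motzkin_fps ^ 2) $ n"
  proof (cases n)
    case (Suc m)
    then show ?thesis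
    proof (cases m)
      case (Suc l)
      then show ?thesis using \<open>n = Suc m\<close>
        by (simp add: mult.assoc fps_X_power_mult_nth sq lessThan_Suc_atMost)
          (simp add: motzkin_fps_def lessThan_Suc_atMost)
    qed (simp add: motzkin_fps_def mult.assoc fps_X_power_mult_nth)
  qed (simp add: motzkin_fps_def mult.assoc fps_X_power_mult_nth)
qed

section \<open>Grouping rim vertices into blocks\<close>

definition geo :: "int poly fps" where "geo = Abs_fps (\<lambda>n. tp ^ n)"

lemma geo: "(1 - fps_const tp * fps_X) * geo = 1"
proof (rule fps_ext)
  fix n show "((1 - fps_const tp * fps_X) * geo) $ n = 1 $ n"
    by (cases n) (simp_all add: geo_def left_diff_distrib mult.assoc)
qed

abbreviation (input) geo_sub :: "int poly fps" where "geo_sub \<equiv> fps_X * geo"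

text \<open>The substitution \<open>x = u / (1 - t u)\<close> sums over all ways of grouping consecutive vertices into
  blocks, where each rim edge inside a block has weight \<open>t\<close>.\<close>

definition block_sum :: "int poly fps \<Rightarrow> int poly fps" where
  "block_sum f = geo * (f oo geo_sub)"

lemma block_sum_eq: "(1 - fps_const tp * fps_X) * block_sum f = f oo geo_sub"
  unfolding block_sum_def using geo by (simp flip: mult.assoc)

lemma block_sum_0: "block_sum f $ 0 = f $ 0"
  by (simp add: block_sum_def geo_def fps_compose_nth_0)

text \<open>\<open>block_sum f $ j\<close> is the sum over k of binomial(j, k) t^(j - k) times the
  k-th coefficient of f: each of j vertices starts a block or continues one. The recursion decides
  the first vertex, as in Pascal's rule.\<close>

lemma block_sum_Suc:
  "block_sum f $ Suc j = block_sum (fps_shift 1 f) $ j + tp * block_sum f $ j"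
proof -
  have "f = fps_const (f $ 0) + fps_X * fps_shift 1 f"
    by (rule fps_ext) (simp add: fps_X_mult_nth)
  then have "f oo geo_sub = (fps_const (f $ 0) + fps_X * fps_shift 1 f) oo geo_sub" by simp
  also have "\<dots> = fps_const (f $ 0) + geo_sub * (fps_shift 1 f oo geo_sub)"
    by (simp add: fps_compose_add_distrib fps_compose_mult_distrib)
  also have "\<dots> = fps_const (f $ 0) + fps_X * block_sum (fps_shift 1 f)"
    by (simp add: block_sum_def mult_ac)
  finally have "(1 - fps_const tp * fps_X) * block_sum f =
      fps_const (f $ 0) + fps_X * block_sum (fps_shift 1 f)"
    by (simp add: block_sum_eq)
  then have "((1 - fps_const tp * fps_X) * block_sum f) $ Suc j =
      (fps_const (f $ 0) + fps_X * block_sum (fps_shift 1 f)) $ Suc j" by simp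
  then show ?thesis by (simp add: left_diff_distrib mult.assoc algebra_simps)
qed

fun block_rec :: "(nat \<Rightarrow> int poly) \<Rightarrow> nat \<Rightarrow> nat \<Rightarrow> int poly" where
  "block_rec h k 0 = h k"
| "block_rec h k (Suc j) = block_rec h (Suc k) j + tp * block_rec h k j"

lemma block_rec_eq: "block_rec h k j = block_sum (Abs_fps (\<lambda>n. h (n + k))) $ j"
proof (induction j arbitrary: k)
  case (Suc j)
  have "fps_shift 1 (Abs_fps (\<lambda>n. h (n + k))) = Abs_fps (\<lambda>n. h (n + Suc k))"
    by (rule fps_ext) simp
  then show ?case using Suc by (simp add: block_sum_Suc)
qed (simp add: block_sum_0)

text \<open>The n-th coefficient sums over spokeless words on an arc of n + 1 vertices, the first of
  which must start a block (\<open>arc_rec_0\<close>). That it is also the sum over all words on a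
  fan with n rim vertices is \<open>word_rec_fan_z\<close>.\<close>

definition fan_z :: "int poly fps" where "fan_z = block_sum motzkin_fps"

lemma geo_cancel: "fps_const tp * fps_X * geo = geo - 1"
  using geo by (simp add: algebra_simps)

lemma motzkin_compose: "motzkin_fps oo geo_sub = (1 - fps_const tp * fps_X) * fan_z"
  by (simp add: fan_z_def block_sum_eq)

text \<open>Composing the Motzkin equation with x = u / (1 - t u) produces x always together with (1
  - t u) z, and x (1 - t u) = u.\<close>

lemma fan_z_eq:
  "fan_z = 1 + (1 + fps_const tp) * fps_X * fan_z + fps_const tp * fps_X ^ 2 * fan_z ^ 2"
proof -
  let ?u = "1 - fps_const tp * fps_X"
  have v: "geo_sub * ?u = fps_X" using geo by (simp add: mult_ac)
  have "motzkin_fps oo geo_sub =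
      (1 + fps_X * motzkin_fps + fps_const tp * fps_X ^ 2 * motzkin_fps ^ 2) oo geo_sub"
    using motzkin_fps_eq by simp
  also have "\<dots> = 1 + geo_sub * (motzkin_fps oo geo_sub)
      + fps_const tp * geo_sub ^ 2 * (motzkin_fps oo geo_sub) ^ 2"
    by (simp add: fps_compose_add_distrib fps_compose_mult_distrib power2_eq_square)
  also have "\<dots> = 1 + (geo_sub * ?u) * fan_z + fps_const tp * (geo_sub * ?u) ^ 2 * fan_z ^ 2"
    unfolding motzkin_compose by (simp only: mult_ac power_mult_distrib)
  finally have "?u * fan_z = 1 + fps_X * fan_z + fps_const tp * fps_X ^ 2 * fan_z ^ 2"
    unfolding v motzkin_compose .
  then show ?thesis by (simp add: algebra_simps)
qed

lemma fan_z_0: "fan_z $ 0 = 1"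
  by (simp add: fan_z_def block_sum_0 motzkin_fps_def)

lemma fan_z_Suc:
  "fan_z $ Suc n = (1 + tp) * fan_z $ n + tp * (\<Sum>i<n. fan_z $ i * fan_z $ (n - 1 - i))"
proof -
  have "fan_z $ Suc n = (1 + (1 + fps_const tp) * fps_X * fan_z +
      fps_const tp * fps_X ^ 2 * fan_z ^ 2) $ Suc n"
    using fan_z_eq by simp
  also have "\<dots> = (1 + tp) * fan_z $ n + (if n = 0 then 0 else tp * (fan_z ^ 2) $ (n - 1))"
    by (simp add: mult.assoc fps_X_power_mult_nth algebra_simps)
  finally show ?thesis
    by (cases n) (simp_all add: power2_eq_square fps_mult_nth atLeast0AtMost lessThan_Suc_atMost)
qed

lemma palindromic_tp: "palindromic 2 tp"
  by (auto simp: palindromic_iff_coeff degree_monom_eq)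

lemma palindromic_1_tp: "palindromic 1 (1 + tp)"
proof -
  have "degree (1 + tp) \<le> 1" by (intro degree_add_le) (auto simp: degree_monom_eq)
  then show ?thesis by (auto simp: palindromic_iff_coeff le_Suc_eq)
qed

text \<open>In \<open>fan_z_Suc\<close> all lengths match because t counts as length 2 and 1 + t as
  length 1.\<close>

lemma palindromic_fan_z: "palindromic n (fan_z $ n)"
proof (induction n rule: less_induct)
  case (less n)
  show ?case
  proof (cases n)
    case (Suc m)
    have "palindromic (1 + m) ((1 + tp) * fan_z $ m)"
      using less Suc by (intro palindromic_mult palindromic_1_tp) auto
    moreover have "palindromic (1 + m) (tp * (\<Sum>i<m. fan_z $ i * fan_z $ (m - 1 - i)))"
      unfolding sum_distrib_left
    proof (rule palindromic_sum)
      fix i assume i: "i \<in> {..<m}"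
      then have "palindromic (2 + (i + (m - 1 - i))) (tp * (fan_z $ i * fan_z $ (m - 1 - i)))"
        using less Suc by (intro palindromic_mult palindromic_tp) auto
      moreover have "2 + (i + (m - 1 - i)) = 1 + m" using i by simp
      ultimately show "palindromic (1 + m) (tp * (fan_z $ i * fan_z $ (m - 1 - i)))" by simp
    qed
    ultimately show ?thesis unfolding Suc fan_z_Suc using palindromic_add by simp
  qed (simp add: fan_z_0 palindromic_1)
qed

section \<open>Logarithmic derivatives and spokeless arcs\<close>

definition whirl_fps :: "int poly fps" where
  "whirl_fps = fps_X * fps_deriv fan_fps * fps_right_inverse fan_fps 1"

definition whirl_kl :: "nat \<Rightarrow> int poly" where "whirl_kl n = whirl_fps $ n"

lemma whirl_fps_eq: "whirl_fps * fan_fps = fps_X * fps_deriv fan_fps"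
proof -
  have "fan_fps * fps_right_inverse fan_fps 1 = 1"
    by (rule fps_right_inverse) (simp add: fan_fps_def fan_kl_def)
  then show ?thesis by (simp add: whirl_fps_def mult_ac)
qed

lemma whirl_kl_0: "whirl_kl 0 = 0"
  by (simp add: whirl_kl_def whirl_fps_def)

text \<open>A division-free recursion for the coefficients of x f'/f. It passes degree bounds from
  \<open>fan_fps\<close> to \<open>whirl_fps\<close> and palindromicity from \<open>fan_z\<close> to
  \<open>whirl_z\<close>.\<close>

lemma log_deriv_coeff:
  fixes f g :: "int poly fps"
  assumes "g * f = fps_X * fps_deriv f" "f $ 0 = 1" "n > 0"
  shows "g $ n = of_nat n * f $ n - (\<Sum>i<n. g $ i * f $ (n - i))"
proof -
  have "(g * f) $ n = (\<Sum>i<n. g $ i * f $ (n - i)) + g $ n * f $ 0"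
    by (simp add: fps_mult_nth atLeast0AtMost flip: lessThan_Suc_atMost)
  moreover have "(fps_X * fps_deriv f) $ n = of_nat n * f $ n"
    using assms(3) by (cases n) auto
  ultimately show ?thesis using assms by (simp add: algebra_simps)
qed

lemma degree_of_nat_mult_le: "degree (of_nat n * p :: int poly) \<le> degree p"
  using degree_mult_le[of "of_nat n" p] by simp

lemma degree_whirl_kl: "n > 0 \<Longrightarrow> 2 * degree (whirl_kl n) < n"
proof (induction n rule: less_induct)
  case (less n)
  have eq: "whirl_kl n = of_nat n * fan_kl n - (\<Sum>i<n. whirl_kl i * fan_kl (n - i))"
    using log_deriv_coeff[OF whirl_fps_eq _ less.prems]
    by (simp add: whirl_kl_def fan_fps_def fan_kl_def)
  have "degree (of_nat n * fan_kl n) \<le> (n - 1) div 2"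
    using degree_of_nat_mult_le[of n "fan_kl n"] degree_fan_kl[of n] by linarith
  moreover have "degree (\<Sum>i<n. whirl_kl i * fan_kl (n - i)) \<le> (n - 1) div 2"
  proof (rule degree_sum_le)
    fix i assume i: "i \<in> {..<n}"
    show "degree (whirl_kl i * fan_kl (n - i)) \<le> (n - 1) div 2"
    proof (cases "i = 0")
      case False
      then have "2 * degree (whirl_kl i) < i" using less.IH i by simp
      then show ?thesis
        using degree_mult_le[of "whirl_kl i" "fan_kl (n - i)"] degree_fan_kl[of "n - i"] i by simp
    qed (simp add: whirl_kl_0)
  qed simp
  ultimately have "degree (whirl_kl n) \<le> (n - 1) div 2" unfolding eq by (rule degree_diff_le)
  then show ?case using less.prems by simp
qed

text \<open>k blocks have been read since the last spoke and j vertices remain before the spoke that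
  closes the arc. For k = 0 the preceding letter is a spoke, after which no block can be
  continued.\<close>

fun arc_rec :: "nat \<Rightarrow> nat \<Rightarrow> int poly" where
  "arc_rec k 0 = fan_kl k"
| "arc_rec k (Suc j) = arc_rec (Suc k) j + (if k = 0 then 0 else tp * arc_rec k j)"

lemma arc_rec_Suc: "arc_rec (Suc k) j = block_rec fan_kl (Suc k) j"
  by (induction j arbitrary: k) simp_all

definition arc_fps :: "int poly fps" where "arc_fps = 1 + fps_X * fan_z"

lemma arc_rec_0: "arc_rec 0 j = arc_fps $ j"
proof (cases j)
  case (Suc i)
  have "Abs_fps (\<lambda>n. fan_kl (n + Suc 0)) = motzkin_fps"
    by (rule fps_ext) (simp add: fan_kl_def motzkin_fps_def)
  then show ?thesis using Suc by (simp add: arc_rec_Suc block_rec_eq arc_fps_def fan_z_def)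
qed (simp add: fan_kl_def arc_fps_def)

text \<open>The prefactor \<open>geo\<close> of \<open>block_sum\<close> is absent because the first
  vertex of an arc has to start a block.\<close>

lemma arc_fps_eq: "arc_fps = fan_fps oo geo_sub"
proof -
  have "geo_sub * (1 - fps_const tp * fps_X) = fps_X" using geo by (simp add: mult_ac)
  then show ?thesis
    unfolding fan_fps_eq arc_fps_def
    by (simp add: fps_compose_add_distrib fps_compose_mult_distrib motzkin_compose
        flip: mult.assoc)
qed

text \<open>The chain rule multiplies the derivative by \<open>geo ^ 2\<close>. One factor
  \<open>geo\<close> is absorbed by x = u \<open>geo\<close>, the other is the prefactor of
  \<open>block_sum\<close>.\<close>

lemma block_sum_whirl: "block_sum whirl_fps * arc_fps = fps_X * fps_deriv arc_fps"
proof -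
  let ?c = "fps_const tp"
  let ?u = "1 - ?c * fps_X"
  have "fps_deriv (?u * geo) = fps_deriv 1" by (simp only: geo)
  then have *: "?u * fps_deriv geo = ?c * geo" by (simp add: algebra_simps)
  have "fps_deriv geo = (?u * geo) * fps_deriv geo" by (simp only: geo mult_1)
  also have "\<dots> = geo * (?u * fps_deriv geo)" by (simp only: mult_ac)
  also have "\<dots> = ?c * geo ^ 2" unfolding * by (simp only: power2_eq_square mult_ac)
  finally have "fps_deriv geo = ?c * geo ^ 2" .
  then have "fps_deriv geo_sub = geo + ?c * fps_X * geo * geo"
    by (simp add: power2_eq_square mult_ac)
  then have d: "fps_deriv geo_sub = geo ^ 2"
    unfolding geo_cancel by (simp add: left_diff_distrib power2_eq_square)
  have "fps_X * fps_deriv arc_fps = fps_X * ((fps_deriv fan_fps oo geo_sub) * geo ^ 2)"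
    unfolding arc_fps_eq d[symmetric] by (subst fps_compose_deriv) simp_all
  also have "\<dots> = geo * (geo_sub * (fps_deriv fan_fps oo geo_sub))"
    by (simp add: power2_eq_square mult_ac)
  also have "geo_sub * (fps_deriv fan_fps oo geo_sub) = (whirl_fps * fan_fps) oo geo_sub"
    unfolding whirl_fps_eq by (simp add: fps_compose_mult_distrib)
  also have "\<dots> = (whirl_fps oo geo_sub) * arc_fps"
    unfolding arc_fps_eq by (simp add: fps_compose_mult_distrib)
  finally show ?thesis by (simp add: block_sum_def mult_ac)
qed

section \<open>Words with spokes, linear and cyclic\<close>

text \<open>The weighted count of continuations when \<open>k\<close> blocks have been read since the last spoke, \<open>m\<close>
  unrestricted vertices and then \<open>j\<close> vertices that must not get a spoke remain, and a spoke closes the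
  word; \<open>arc_rec\<close> is the case \<open>m = 0\<close>.\<close>

fun word_rec :: "nat \<Rightarrow> nat \<Rightarrow> nat \<Rightarrow> int poly" where
  "word_rec k 0 j = arc_rec k j"
| "word_rec k (Suc m) j = tp * fan_kl k * word_rec 0 m j + word_rec (Suc k) m j
     + (if k = 0 then 0 else tp * word_rec k m j)"

text \<open>Split at the first spoke: either none of the m unrestricted vertices gets one, or i of
  them precede it and the rest starts afresh with k = 0.\<close>

lemma word_rec_unfold:
  "word_rec k m j = arc_rec k (m + j) + tp * (\<Sum>i<m. arc_rec k i * word_rec 0 (m - 1 - i) j)"
proof (induction m arbitrary: k)
  case (Suc m)
  have "(\<Sum>i<Suc m. arc_rec k i * word_rec 0 (Suc m - 1 - i) j) =
      fan_kl k * word_rec 0 m j + (\<Sum>i<m. arc_rec k (Suc i) * word_rec 0 (m - 1 - i) j)"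
    unfolding sum.lessThan_Suc_shift by simp
  also have "(\<Sum>i<m. arc_rec k (Suc i) * word_rec 0 (m - 1 - i) j) =
      (\<Sum>i<m. arc_rec (Suc k) i * word_rec 0 (m - 1 - i) j) +
      (if k = 0 then 0 else tp * (\<Sum>i<m. arc_rec k i * word_rec 0 (m - 1 - i) j))"
    by (cases "k = 0") (simp_all add: distrib_right sum.distrib sum_distrib_left mult.assoc)
  finally show ?case
    unfolding word_rec.simps Suc[of k] Suc[of "Suc k"]
    by (cases "k = 0") (simp_all add: distrib_left mult.assoc add_ac)
qed simp

text \<open>Its reciprocal is the series of sequences of arcs, each followed by a spoke of weight
  t.\<close>

definition word_den :: "int poly fps" where "word_den = 1 - fps_const tp * fps_X * arc_fps"

lemma word_den_nonzero: "word_den \<noteq> 0"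
proof -
  have "word_den $ 0 = 1" by (simp add: word_den_def mult.assoc)
  then show ?thesis by auto
qed

lemma fan_z_den: "fan_z * word_den = arc_fps"
proof -
  have "fan_z * word_den =
      fan_z - fps_const tp * fps_X * fan_z - fps_const tp * fps_X ^ 2 * fan_z ^ 2"
    by (simp add: word_den_def arc_fps_def algebra_simps power2_eq_square)
  also have "\<dots> = 1 + fps_X * fan_z" using fan_z_eq by (simp add: algebra_simps)
  finally show ?thesis by (simp add: arc_fps_def)
qed

text \<open>For k = j = 0 the unfolded recursion reads Y = a + t u a Y, which by
  \<open>fan_z_den\<close> is also satisfied by z.\<close>

lemma word_rec_fan_z: "word_rec 0 m 0 = fan_z $ m"
proof -
  define Y where "Y = Abs_fps (\<lambda>m. word_rec 0 m 0)"
  have "Y = arc_fps + fps_const tp * fps_X * arc_fps * Y"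
  proof (rule fps_ext)
    fix m
    have "(arc_fps * Y) $ l = (\<Sum>i\<le>l. arc_rec 0 i * word_rec 0 (l - i) 0)" for l
      by (simp add: fps_mult_nth Y_def arc_rec_0 atLeast0AtMost)
    then have "(fps_X * (arc_fps * Y)) $ m = (\<Sum>i<m. arc_rec 0 i * word_rec 0 (m - 1 - i) 0)"
      by (cases m) (simp_all add: lessThan_Suc_atMost)
    then show "Y $ m = (arc_fps + fps_const tp * fps_X * arc_fps * Y) $ m"
      using word_rec_unfold[of 0 m 0] by (simp add: mult.assoc) (simp add: Y_def arc_rec_0)
  qed
  then have "Y * word_den = arc_fps" by (simp add: word_den_def algebra_simps)
  then have "Y = fan_z" using fan_z_den word_den_nonzero by (metis mult_cancel_right)
  then show ?thesis by (metis Y_def fps_nth_Abs_fps)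
qed

text \<open>Cyclic words with a spoke, cut open at the first spoke: the \<open>j\<close> letters before it are moved to the
  end.\<close>

definition cyc_sum :: "nat \<Rightarrow> int poly" where
  "cyc_sum m = (\<Sum>j<m. tp * word_rec 0 (m - 1 - j) j)"

text \<open>Unfold each summand at its next spoke. If there is none, the other m vertices form one
  arc, for each of the m + 1 values of j; otherwise an arc of length i and a spoke are removed,
  leaving a cyclic word on m - i vertices.\<close>

lemma cyc_sum_Suc:
  "cyc_sum (Suc m) = tp * (of_nat (Suc m) * arc_fps $ m) +
     tp * (\<Sum>i<m. arc_fps $ i * cyc_sum (m - i))"
proof -
  have "cyc_sum (Suc m) = (\<Sum>j<Suc m. tp * (arc_fps $ m) +
      tp * (\<Sum>i<m - j. arc_fps $ i * (tp * word_rec 0 (m - j - 1 - i) j)))"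
    unfolding cyc_sum_def
  proof (intro sum.cong refl)
    fix j assume "j \<in> {..<Suc m}"
    then have "arc_rec 0 (m - j + j) = arc_fps $ m" by (simp add: arc_rec_0)
    then show "tp * word_rec 0 (Suc m - 1 - j) j = tp * (arc_fps $ m) +
        tp * (\<Sum>i<m - j. arc_fps $ i * (tp * word_rec 0 (m - j - 1 - i) j))"
      unfolding word_rec_unfold[of 0 "Suc m - 1 - j"]
      by (simp add: arc_rec_0 distrib_left sum_distrib_left mult_ac)
  qed
  also have "\<dots> = tp * (of_nat (Suc m) * arc_fps $ m) +
      tp * (\<Sum>j<Suc m. \<Sum>i<m - j. arc_fps $ i * (tp * word_rec 0 (m - j - 1 - i) j))"
    by (simp only: sum.distrib sum_distrib_left[symmetric] sum_constant card_lessThan mult_ac)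
  \<comment> \<open>The summand j = m is empty; the rest runs over the triangle i + j < m, ready for
    exchanging the sums.\<close>
  also have "(\<Sum>j<Suc m. \<Sum>i<m - j. arc_fps $ i * (tp * word_rec 0 (m - j - 1 - i) j)) =
      (\<Sum>j<m. \<Sum>i\<in>{i \<in> {..<m}. i + j < m}. arc_fps $ i * (tp * word_rec 0 (m - j - 1 - i) j))"
    by (simp, intro sum.cong) auto
  also have "\<dots> =
      (\<Sum>i<m. \<Sum>j\<in>{j \<in> {..<m}. i + j < m}. arc_fps $ i * (tp * word_rec 0 (m - j - 1 - i) j))"
    by (rule sum.swap_restrict) auto
  also have "\<dots> = (\<Sum>i<m. arc_fps $ i * cyc_sum (m - i))"
    unfolding cyc_sum_def sum_distrib_left
    by (intro sum.cong) (auto simp: diff_diff_add add_ac)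
  finally show ?thesis .
qed

definition cyc_fps :: "int poly fps" where "cyc_fps = Abs_fps cyc_sum"

text \<open>The factor m + 1 in \<open>cyc_sum_Suc\<close> turns the numerator into the derivative
  of u a. So \<open>cyc_fps\<close> is - u D'/D, the logarithmic derivative of 1/D times u.\<close>

lemma cyc_fps_den: "cyc_fps * word_den = fps_const tp * fps_X * (arc_fps + fps_X * fps_deriv arc_fps)"
proof -
  have "cyc_fps = fps_const tp * fps_X * (arc_fps + fps_X * fps_deriv arc_fps)
      + fps_const tp * fps_X * arc_fps * cyc_fps"
  proof (rule fps_ext)
    fix n
    show "cyc_fps $ n = (fps_const tp * fps_X * (arc_fps + fps_X * fps_deriv arc_fps)
      + fps_const tp * fps_X * arc_fps * cyc_fps) $ n"
    proof (cases n)
      case (Suc m)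
      have "cyc_sum 0 = 0" by (simp add: cyc_sum_def)
      then have "(arc_fps * cyc_fps) $ m = (\<Sum>i<m. arc_fps $ i * cyc_sum (m - i))"
        by (simp add: fps_mult_nth cyc_fps_def atLeast0AtMost flip: lessThan_Suc_atMost)
      moreover have "(arc_fps + fps_X * fps_deriv arc_fps) $ m = of_nat (Suc m) * arc_fps $ m"
        by (cases m) (simp_all add: algebra_simps)
      moreover have "cyc_fps $ Suc m = cyc_sum (Suc m)" by (simp add: cyc_fps_def)
      ultimately show ?thesis unfolding Suc cyc_sum_Suc by (simp add: mult.assoc)
    qed (simp add: cyc_fps_def cyc_sum_def mult.assoc)
  qed
  then show ?thesis by (simp add: word_den_def algebra_simps)
qed

definition whirl_z :: "int poly fps" where "whirl_z = block_sum whirl_fps + cyc_fps"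

text \<open>Logarithmic differentiation of z = a / D: the two summands of \<open>whirl_z\<close> are
  u a'/a and - u D'/D. Quotients are avoided by multiplying with D twice and cancelling at the
  end.\<close>

lemma whirl_z_eq: "whirl_z * fan_z = fps_X * fps_deriv fan_z"
proof -
  let ?c = "fps_const tp" and ?a = arc_fps and ?D = word_den and ?z = fan_z
  let ?a' = "fps_deriv arc_fps"
  have D': "fps_deriv ?D = - (?c * (?a + fps_X * ?a'))"
    by (simp add: word_den_def algebra_simps)
  have "fps_deriv (?z * ?D) = ?a'" by (simp add: fan_z_den)
  then have z': "fps_deriv ?z * ?D = ?a' + ?z * (?c * (?a + fps_X * ?a'))"
    by (simp add: D' algebra_simps)
  have "(whirl_z * ?z) * (?D * ?D) = whirl_z * (?z * ?D) * ?D" by (simp only: mult_ac)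
  also have "\<dots> = (block_sum whirl_fps * ?a) * ?D + (cyc_fps * ?D) * ?a"
    unfolding fan_z_den whirl_z_def by (simp only: algebra_simps)
  also have "\<dots> = fps_X * ?a' * ?D + ?c * fps_X * (?a + fps_X * ?a') * (?z * ?D)"
    unfolding block_sum_whirl cyc_fps_den fan_z_den ..
  also have "\<dots> = fps_X * (?a' + ?z * (?c * (?a + fps_X * ?a'))) * ?D"
    by (simp only: algebra_simps)
  also have "\<dots> = (fps_X * fps_deriv ?z) * (?D * ?D)"
    unfolding z'[symmetric] by (simp only: mult_ac)
  finally show ?thesis using word_den_nonzero by simp
qed

lemma whirl_z_0: "whirl_z $ 0 = 0"
  by (simp add: whirl_z_def block_sum_0 whirl_fps_def cyc_fps_def cyc_sum_def)

lemma palindromic_of_nat_mult: "palindromic n p \<Longrightarrow> palindromic n (of_nat k * p)"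
  by (induction k) (auto simp: distrib_right palindromic_0 intro: palindromic_add)

lemma palindromic_whirl_z: "palindromic n (whirl_z $ n)"
proof (induction n rule: less_induct)
  case (less n)
  show ?case
  proof (cases "n = 0")
    case False
    have "palindromic n (\<Sum>i<n. whirl_z $ i * fan_z $ (n - i))"
    proof (rule palindromic_sum)
      fix i assume "i \<in> {..<n}"
      then show "palindromic n (whirl_z $ i * fan_z $ (n - i))"
        using palindromic_mult[OF less.IH[of i] palindromic_fan_z[of "n - i"]] by simp
    qed
    then show ?thesis
      using log_deriv_coeff[OF whirl_z_eq fan_z_0, of n] False
        palindromic_diff palindromic_of_nat_mult palindromic_fan_z by simp
  qed (simp add: whirl_z_0 palindromic_0)
qed

section \<open>The square root of the discriminant\<close>

definition disc_root :: "int poly fps" where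
  "disc_root = 1 - (1 + fps_const tp) * fps_X - 2 * fps_const tp * fps_X ^ 2 * fan_z"

text \<open>Completing the square in the quadratic equation of z: what multiplies 4 t u^2 is the
  combination that \<open>fan_z_eq\<close> evaluates to 1.\<close>

lemma disc_root_square:
  "disc_root ^ 2 = (1 - fps_const (tp + 1) * fps_X) ^ 2 - 4 * fps_const tp * fps_X ^ 2"
proof -
  let ?c = "fps_const tp" and ?z = fan_z
  have c: "fps_const (tp + 1) = 1 + ?c" by (simp flip: fps_const_add)
  have "disc_root ^ 2 = (1 - (1 + ?c) * fps_X) ^ 2 - 4 * ?c * fps_X ^ 2 *
      (?z - ((1 + ?c) * fps_X * ?z + ?c * fps_X ^ 2 * ?z ^ 2))"
    unfolding disc_root_def by (simp add: power2_eq_square algebra_simps)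
  also have "?z - ((1 + ?c) * fps_X * ?z + ?c * fps_X ^ 2 * ?z ^ 2) = 1"
    using fan_z_eq by (simp add: algebra_simps)
  finally show ?thesis by (simp only: c mult_1_right)
qed

text \<open>Differentiating the quadratic equation expresses z' times the root as a polynomial in z;
  with it the root times z + u z' collapses to z.\<close>

lemma whirl_z_disc_root: "disc_root * (1 + whirl_z) = 1"
proof -
  let ?c = "fps_const tp" and ?z = fan_z
  have "fps_deriv ?z = fps_deriv (1 + (1 + ?c) * fps_X * ?z + ?c * fps_X ^ 2 * ?z ^ 2)"
    using fan_z_eq by simp
  then have d: "fps_deriv ?z * disc_root = (1 + ?c) * ?z + 2 * ?c * fps_X * ?z ^ 2"
    unfolding disc_root_def by (simp add: power2_eq_square algebra_simps)
  have "(disc_root * (1 + whirl_z)) * ?z = disc_root * ?z + disc_root * (whirl_z * ?z)"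
    by (simp add: algebra_simps)
  also have "\<dots> = disc_root * ?z + fps_X * (fps_deriv ?z * disc_root)"
    unfolding whirl_z_eq by (simp only: mult_ac)
  also have "\<dots> = disc_root * ?z + fps_X * ((1 + ?c) * ?z + 2 * ?c * fps_X * ?z ^ 2)"
    unfolding d ..
  also have "\<dots> = ?z - (1 + ?c) * fps_X * ?z - 2 * ?c * fps_X ^ 2 * ?z ^ 2 +
      ((1 + ?c) * fps_X * ?z + 2 * ?c * fps_X ^ 2 * ?z ^ 2)"
    unfolding disc_root_def power2_eq_square by (simp add: algebra_simps)
  finally have "(disc_root * (1 + whirl_z)) * ?z = 1 * ?z" by simp
  moreover have "?z \<noteq> 0" using fan_z_0 by auto
  ultimately show ?thesis by (metis mult_cancel_right)
qed

text \<open>In a domain the only other root is - S, whose constant term -1 differs from 1 in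
  characteristic 0.\<close>

lemma fps_sqrt1_eqI:
  fixes S :: "'a::{idom,ring_char_0} fps"
  assumes "S $ 0 = 1" "S ^ 2 = A"
  shows "fps_sqrt1 A = S"
  unfolding fps_sqrt1_def
proof (rule the_equality)
  fix R assume R: "R $ 0 = 1 \<and> R ^ 2 = A"
  then have "R = S \<or> R = - S" using assms power2_eq_iff by metis
  moreover have "R \<noteq> - S"
  proof
    assume "R = - S"
    then have "R $ 0 = - S $ 0" by simp
    then show False using R assms by simp
  qed
  ultimately show "R = S" by simp
qed (use assms in simp)

lemma whirl_z_closed_form:
  "whirl_z = fps_right_inverse
     (fps_sqrt1 ((1 - fps_const (tp + 1) * fps_X) ^ 2 - 4 * fps_const tp * fps_X ^ 2)) 1 - 1"
proof -
  have 0: "disc_root $ 0 = 1" by (simp add: disc_root_def mult.assoc)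
  then have "disc_root * fps_right_inverse disc_root 1 = disc_root * (1 + whirl_z)"
    by (simp add: fps_right_inverse whirl_z_disc_root)
  moreover have "disc_root \<noteq> 0" using 0 by auto
  ultimately have "fps_right_inverse disc_root 1 = 1 + whirl_z" by (metis mult_cancel_left)
  then show ?thesis by (simp add: fps_sqrt1_eqI[OF 0 disc_root_square])
qed


subsection \<open>Cyclic words\<close>

text \<open>The letters of the rim vertices for a flat \<open>F\<close>: \<open>Spk\<close> if the spoke at the vertex is in \<open>F\<close>,
  \<open>Ext\<close> if it is not but the preceding rim edge is, \<open>New\<close> otherwise. \<open>Bar\<close> only occurs in constraints,
  as a \<open>New\<close> that must not become a spoke. \<open>ok a x y\<close> says that a vertex with letter \<open>x\<close> in a flat may
  have letter \<open>y\<close> in a larger flat whose preceding letter is \<open>a\<close>.\<close>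

datatype label = Spk | New | Ext | Bar

fun ok :: "label \<Rightarrow> label \<Rightarrow> label \<Rightarrow> bool" where
  "ok a Spk y \<longleftrightarrow> y = Spk"
| "ok a New y \<longleftrightarrow> y = Spk \<or> y = New \<or> y = Ext \<and> a \<noteq> Spk"
| "ok a Ext y \<longleftrightarrow> y = (if a = Spk then Spk else Ext)"
| "ok a Bar y \<longleftrightarrow> y = New \<or> y = Ext \<and> a \<noteq> Spk"

text \<open>The first argument is the letter to the left of the word, which \<open>ok\<close> needs
  for the first vertex.\<close>

fun words :: "label \<Rightarrow> label list \<Rightarrow> label list set" where
  "words a [] = {[]}"
| "words a (x # g) = (\<Union>y\<in>{y. ok a x y}. (#) y ` words y g)"

text \<open>For the word of a flat this is its corank, see \<open>free_word\<close>.\<close>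

definition free :: "label list \<Rightarrow> nat" where
  "free w = length (filter (\<lambda>x. x = New \<or> x = Bar) w)"

lemma free_simps [simp]:
  "free [] = 0" "free (New # w) = Suc (free w)" "free (Bar # w) = Suc (free w)"
  "free (Spk # w) = free w" "free (Ext # w) = free w" "free (u @ v) = free u + free v"
  by (simp_all add: free_def)

text \<open>k counts the blocks since the last spoke; a spoke closes their arc with the factor
  \<open>fan_kl k\<close>. An arc still open at the end gets no factor, so cyclic weights apply
  \<open>wt\<close> to words that end in a spoke.\<close>

fun wt :: "nat \<Rightarrow> label list \<Rightarrow> int poly" where
  "wt k [] = 1"
| "wt k (Spk # w) = fan_kl k * wt 0 w"
| "wt k (New # w) = wt (Suc k) w"
| "wt k (Ext # w) = wt k w"
| "wt k (Bar # w) = wt (Suc k) w"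

text \<open>The value of the sum in \<open>sum_words_wt\<close>. For k = 0 a letter
  \<open>Ext\<close> is forced to become a spoke, but its factor \<open>fan_kl 0\<close> is 1, so
  one equation serves both states.\<close>

fun lin :: "nat \<Rightarrow> label list \<Rightarrow> int poly" where
  "lin k [] = 1"
| "lin k (Spk # g) = fan_kl k * lin 0 g"
| "lin k (New # g) = tp * fan_kl k * lin 0 g + lin (Suc k) g + (if k = 0 then 0 else tp * lin k g)"
| "lin k (Ext # g) = lin k g"
| "lin k (Bar # g) = lin (Suc k) g + (if k = 0 then 0 else tp * lin k g)"

lemma UNIV_label: "UNIV = {Spk, New, Ext, Bar}"
proof -
  have "y = Spk \<or> y = New \<or> y = Ext \<or> y = Bar" for y by (cases y) auto
  then show ?thesis by blast
qed

lemma finite_labels: "finite (A :: label set)"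
proof -
  have "A \<subseteq> {Spk, New, Ext, Bar}" using UNIV_label by blast
  then show ?thesis by (rule finite_subset) simp
qed

lemma finite_words: "finite (words a g)"
  by (induction a g rule: words.induct) (auto simp: finite_labels)

lemma Cons_words_iff: "y # w \<in> words a (x # g) \<longleftrightarrow> ok a x y \<and> w \<in> words y g"
  by auto

lemma words_length: "w \<in> words a g \<Longrightarrow> length w = length g"
  by (induction g arbitrary: a w) auto

lemma words_free: "w \<in> words a g \<Longrightarrow> free w \<le> free g"
proof (induction g arbitrary: a w)
  case (Cons x g)
  then obtain y v where "w = y # v" "ok a x y" "free v \<le> free g" by auto
  then show ?case by (cases x; cases y) (auto split: if_splits)
qed simp

lemma sum_words_Cons:
  "(\<Sum>w\<in>words a (x # g). h w) = (\<Sum>y | ok a x y. \<Sum>w\<in>words y g. h (y # w))"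
proof -
  have "(\<Sum>w\<in>words a (x # g). h w) = (\<Sum>y | ok a x y. \<Sum>w\<in>(#) y ` words y g. h w)"
    unfolding words.simps
    by (rule sum.UNION_disjoint) (auto simp: finite_labels finite_words)
  then show ?thesis by (simp add: sum.reindex)
qed

lemma ok_sets:
  "{y. ok a Spk y} = {Spk}"
  "a = Spk \<Longrightarrow> {y. ok a New y} = {Spk, New}"
  "a \<noteq> Spk \<Longrightarrow> {y. ok a New y} = {Spk, New, Ext}"
  "a = Spk \<Longrightarrow> {y. ok a Ext y} = {Spk}"
  "a \<noteq> Spk \<Longrightarrow> {y. ok a Ext y} = {Ext}"
  "a = Spk \<Longrightarrow> {y. ok a Bar y} = {New}"
  "a \<noteq> Spk \<Longrightarrow> {y. ok a Bar y} = {New, Ext}"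
  by auto

lemma tp_monom: "tp * (monom 1 n * p) = monom 1 (Suc n) * p"
  by (simp add: mult_monom flip: mult.assoc)

text \<open>After a spoke no vertex can continue a block, so the state \<open>k = 0\<close> (no block since the
  last spoke) records that the previous letter was a spoke.\<close>

lemma sum_words_wt:
  assumes "a = Spk \<longleftrightarrow> k = 0"
  shows "(\<Sum>w\<in>words a g. monom 1 (free g - free w) * wt k w) = lin k g"
  using assms
proof (induction g arbitrary: a k)
  case (Cons x g)
  have IH: "(\<Sum>w\<in>words Spk g. monom 1 (free g - free w) * wt 0 w) = lin 0 g"
    "(\<Sum>w\<in>words New g. monom 1 (free g - free w) * wt (Suc k) w) = lin (Suc k) g"
    "k \<noteq> 0 \<Longrightarrow> (\<Sum>w\<in>words Ext g. monom 1 (free g - free w) * wt k w) = lin k g"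
    using Cons.IH by auto
  \<comment> \<open>A free letter of the smaller word that is no longer free in the larger one costs
    a factor t; \<open>words_free\<close> keeps the truncated subtraction exact.\<close>
  have shift: "(\<Sum>w\<in>words b g. monom 1 (Suc (free g) - free w) * f w) =
      tp * (\<Sum>w\<in>words b g. monom 1 (free g - free w) * f w)" for b f
    unfolding sum_distrib_left tp_monom
    by (intro sum.cong) (auto dest: words_free simp: Suc_diff_le)
  have mult: "(\<Sum>w\<in>words b g. monom 1 (e w) * (c * f w)) =
      c * (\<Sum>w\<in>words b g. monom 1 (e w) * f w)" for b c f and e :: "label list \<Rightarrow> nat"
    by (simp add: sum_distrib_left mult_ac)
  show ?case
  proof (cases "k = 0")
    case True
    then have "a = Spk" using Cons.prems by simp
    then show ?thesis using True IH
      by (cases x) (auto simp: sum_words_Cons ok_sets shift mult fan_kl_def simp del: words.simps ok.simps)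
  next
    case False
    then have "a \<noteq> Spk" using Cons.prems by simp
    then show ?thesis using False IH
      by (cases x)
        (auto simp: sum_words_Cons ok_sets shift mult add_ac mult.assoc simp del: words.simps ok.simps)
  qed
qed simp

lemma lin_block_bar:
  assumes "set b \<subseteq> {Bar, Ext}"
  shows "lin k (b @ Spk # g) = arc_rec k (free b) * lin 0 g"
  using assms by (induction b arbitrary: k) (auto simp: distrib_right mult.assoc)

lemma lin_block:
  assumes "set x \<subseteq> {New, Ext}" "set b \<subseteq> {Bar, Ext}"
  shows "lin k (x @ b @ Spk # g) = word_rec k (free x) (free b) * lin 0 g"
  using assms
  by (induction x arbitrary: k) (auto simp: lin_block_bar distrib_right mult.assoc)

text \<open>The part up to the first spoke is a fan and splits off as a factor
  \<open>fan_z $ free x\<close>.\<close>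

lemma palindromic_lin:
  assumes "set g \<subseteq> {Spk, New, Ext}" "g = [] \<or> last g = Spk"
  shows "palindromic (free g) (lin 0 g)"
  using assms
proof (induction "length g" arbitrary: g rule: less_induct)
  case less
  show ?case
  proof (cases "g = []")
    case False
    then have "Spk \<in> set g" using less.prems last_in_set by metis
    then obtain x y where g: "g = x @ Spk # y" "Spk \<notin> set x" by (metis split_list_first)
    then have x: "set x \<subseteq> {New, Ext}" using less.prems by auto
    have "palindromic (free y) (lin 0 y)" using less g by (intro less.hyps) (auto split: if_splits)
    moreover have "lin 0 g = fan_z $ free x * lin 0 y"
      using lin_block[OF x, of "[]" 0 y] g by (simp add: word_rec_fan_z)
    ultimately show ?thesis using palindromic_mult palindromic_fan_z g by simp
  qed (simp add: palindromic_1)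
qed

section \<open>Weights of cyclic words\<close>

lemma wt_append: "u \<noteq> [] \<Longrightarrow> last u = Spk \<Longrightarrow> wt k (u @ v) = wt k u * wt 0 v"
proof (induction k u rule: wt.induct)
  case (2 k w)
  then show ?case by (cases "w = []") (auto simp: mult.assoc)
qed (auto split: if_splits)

lemma degree_wt: "2 * degree (wt k w) \<le> k + free w - 1"
proof (induction k w rule: wt.induct)
  case (2 k w)
  then show ?case using degree_mult_le[of "fan_kl k" "wt 0 w"] degree_fan_kl[of k] by simp
qed auto

text \<open>The rotation puts the first spoke at the end, so that every arc, also the one across the
  seam, is closed. The word with all letters \<open>Ext\<close> gets \<open>whirl_kl 0\<close>,
  which is 0.\<close>

definition cyc_wt :: "label list \<Rightarrow> int poly" where
  "cyc_wt w = (if Spk \<in> set w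
     then wt 0 (tl (dropWhile ((\<noteq>) Spk) w) @ takeWhile ((\<noteq>) Spk) w @ [Spk])
     else whirl_kl (free w))"

lemma cyc_wt_first:
  "Spk \<notin> set v \<Longrightarrow> cyc_wt (v @ Spk # r) = wt 0 (r @ v @ [Spk])"
  unfolding cyc_wt_def by (subst dropWhile_append2 takeWhile_append2, force)+ simp

text \<open>The cut may be made at any spoke: the weight factorises at spokes and the factors
  commute.\<close>

lemma cyc_wt_Spk: "cyc_wt (x @ Spk # y) = wt 0 (y @ x @ [Spk])"
proof (cases "Spk \<in> set x")
  case True
  then obtain v r where x: "x = v @ Spk # r" "Spk \<notin> set v" by (metis split_list_first)
  have "cyc_wt (x @ Spk # y) = wt 0 ((r @ [Spk]) @ (y @ v @ [Spk]))"
    using x cyc_wt_first[of v "r @ Spk # y"] by simp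
  also have "\<dots> = wt 0 (y @ v @ [Spk]) * wt 0 (r @ [Spk])" by (subst wt_append) simp_all
  also have "\<dots> = wt 0 ((y @ v @ [Spk]) @ (r @ [Spk]))" by (subst wt_append) simp_all
  finally show ?thesis using x by simp
qed (rule cyc_wt_first)

lemma cyc_wt_rotate: "cyc_wt (u @ v) = cyc_wt (v @ u)"
proof -
  have *: "cyc_wt (u @ v) = cyc_wt (v @ u)" if Spk: "Spk \<in> set u" for u v
  proof -
    obtain x y where u: "u = x @ Spk # y" using split_list[OF Spk] by blast
    have "cyc_wt (u @ v) = wt 0 ((y @ v) @ x @ [Spk])"
      by (simp only: u append.assoc append_Cons cyc_wt_Spk)
    moreover have "cyc_wt (v @ u) = wt 0 (y @ (v @ x) @ [Spk])"
      unfolding u using cyc_wt_Spk[of "v @ x" y] by (simp only: append.assoc)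
    ultimately show ?thesis by (simp only: append.assoc)
  qed
  consider "Spk \<in> set u" | "Spk \<in> set v" | "Spk \<notin> set u" "Spk \<notin> set v" by blast
  then show ?thesis
  proof cases
    case 1
    then show ?thesis by (rule *)
  next
    case 2
    then show ?thesis by (rule *[symmetric])
  next
    case 3
    then show ?thesis by (simp add: cyc_wt_def add.commute)
  qed
qed

lemma degree_cyc_wt: "free w > 0 \<Longrightarrow> 2 * degree (cyc_wt w) < free w"
proof (cases "Spk \<in> set w")
  case True
  assume "free w > 0"
  obtain x y where "w = x @ Spk # y" using split_list[OF True] by blast
  then show ?thesis
    using degree_wt[of 0 "y @ x @ [Spk]"] \<open>free w > 0\<close> by (simp add: cyc_wt_Spk) linarith
qed (simp add: cyc_wt_def degree_whirl_kl)

lemma cyc_wt_all_Spk: "n > 0 \<Longrightarrow> cyc_wt (replicate n Spk) = 1"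
proof -
  assume n: "n > 0"
  have *: "wt 0 (replicate m Spk) = 1" for m by (induction m) (auto simp: fan_kl_def)
  have "replicate n Spk = [] @ Spk # replicate (n - 1) Spk" using n by (cases n) auto
  then have "cyc_wt (replicate n Spk) = wt 0 (replicate (n - 1) Spk @ [] @ [Spk])"
    by (simp only: cyc_wt_Spk)
  also have "replicate (n - 1) Spk @ [] @ [Spk] = replicate n Spk"
    using n by (cases n) (auto simp: replicate_append_same)
  finally show ?thesis by (simp add: *)
qed

section \<open>Sums over the cyclic words above a given one\<close>

definition cwords :: "label list \<Rightarrow> label list set" where
  "cwords g = {w. w \<in> words (last w) g}"

text \<open>For the word of a flat this is the sum over its upper interval
  (\<open>sum_flats_word\<close>); the exponent is the difference of ranks.\<close>

definition cyc_total :: "label list \<Rightarrow> int poly" where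
  "cyc_total g = (\<Sum>w\<in>cwords g. monom 1 (free g - free w) * cyc_wt w)"

lemma append_words_iff:
  "length u = length g \<Longrightarrow> u @ v \<in> words a (g @ h) \<longleftrightarrow> u \<in> words a g \<and> v \<in> words (last (a # u)) h"
proof (induction g arbitrary: a u)
  case (Cons x g)
  then obtain y u' where "u = y # u'" "length u' = length g" by (cases u) auto
  then show ?case using Cons.IH[of u' y] by (auto simp: Cons_words_iff simp del: words.simps)
qed simp

lemma cwords_rotate:
  assumes "length u = length g" "length v = length h" "g \<noteq> []" "h \<noteq> []"
  shows "u @ v \<in> cwords (g @ h) \<longleftrightarrow> v @ u \<in> cwords (h @ g)"
proof -
  have "u \<noteq> []" "v \<noteq> []" using assms by auto
  then show ?thesis using assms by (auto simp: cwords_def append_words_iff)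
qed

lemma cyc_total_rotate: "cyc_total (g @ h) = cyc_total (h @ g)"
proof (cases "g = [] \<or> h = []")
  case False
  have len: "length w = length g + length h" if "w \<in> cwords (g @ h) \<or> w \<in> cwords (h @ g)" for w
    using that words_length unfolding cwords_def by fastforce
  define rot where "rot k w = drop k w @ take k w" for k and w :: "label list"
  have mem: "rot (length g) w \<in> cwords (h @ g)" if "w \<in> cwords (g @ h)"
    for w and g h :: "label list"
  proof (cases "g = [] \<or> h = []")
    case True
    then show ?thesis using that words_length unfolding cwords_def rot_def by fastforce
  next
    case False
    have l: "length w = length g + length h" 
      using that words_length unfolding cwords_def by fastforce
    then show ?thesis
      using cwords_rotate[of "take (length g) w" g "drop (length g) w" h] that False
      by (simp add: rot_def)
  qed
  show ?thesis
    unfolding cyc_total_def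
  proof (rule sum.reindex_bij_witness[where i = "rot (length h)" and j = "rot (length g)"])
    fix w assume w: "w \<in> cwords (g @ h)"
    then show "rot (length h) (rot (length g) w) = w" "rot (length g) w \<in> cwords (h @ g)"
      using len[of w] mem[OF w] by (auto simp: rot_def)
    have "free (rot (length g) w) = free w"
      using free_simps(6)[of "take (length g) w" "drop (length g) w"] by (simp add: rot_def)
    moreover have "cyc_wt (rot (length g) w) = cyc_wt w"
      using cyc_wt_rotate[of "take (length g) w" "drop (length g) w"] by (simp add: rot_def)
    ultimately show "monom 1 (free (h @ g) - free (rot (length g) w)) * cyc_wt (rot (length g) w) =
        monom 1 (free (g @ h) - free w) * cyc_wt w"
      by (simp add: add.commute)
  next
    fix w assume w: "w \<in> cwords (h @ g)"
    then show "rot (length g) (rot (length h) w) = w" "rot (length h) w \<in> cwords (g @ h)"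
      using len[of w] mem[OF w] by (auto simp: rot_def)
  qed
qed auto

text \<open>A spoke of the smaller flat persists, so all words above end in a spoke and the cyclic
  left neighbour is the fixed letter \<open>Spk\<close>.\<close>

lemma cyc_total_Spk: "cyc_total (g @ [Spk]) = lin 0 (g @ [Spk])"
proof -
  have last: "\<exists>u. w = u @ [Spk]" if "w \<in> words a (g @ [Spk])" for w a
  proof -
    have "length w = Suc (length g)" using words_length[OF that] by simp
    then obtain u y where w: "w = u @ [y]" "length u = length g"
      by (cases w rule: rev_cases) auto
    then show ?thesis using that by (simp add: append_words_iff)
  qed
  have "cwords (g @ [Spk]) = words Spk (g @ [Spk])"
  proof (intro set_eqI iffI)
    fix w assume w: "w \<in> cwords (g @ [Spk])"
    then have "\<exists>u. w = u @ [Spk]" unfolding cwords_def by (blast intro: last)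
    then show "w \<in> words Spk (g @ [Spk])" using w by (auto simp: cwords_def)
  next
    fix w assume w: "w \<in> words Spk (g @ [Spk])"
    then have "\<exists>u. w = u @ [Spk]" by (rule last)
    then show "w \<in> cwords (g @ [Spk])" using w by (auto simp: cwords_def)
  qed
  moreover have "cyc_wt w = wt 0 w" if w: "w \<in> words Spk (g @ [Spk])" for w
  proof -
    obtain u where "w = u @ [Spk]" using last[OF w] by blast
    then show ?thesis using cyc_wt_Spk[of u "[]"] by simp
  qed
  ultimately show ?thesis
    unfolding cyc_total_def using sum_words_wt[of Spk 0 "g @ [Spk]"] by simp
qed

section \<open>Cutting a cyclic word at its first spoke\<close>

definition bar :: "label list \<Rightarrow> label list" where
  "bar = map (\<lambda>x. if x = New then Bar else x)"

lemma bar_simps [simp]: "bar [] = []" "bar (New # g) = Bar # bar g" "bar (Ext # g) = Ext # bar g"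
  by (simp_all add: bar_def)

lemma free_bar: "free (bar g) = free g"
  by (induction g) (auto simp: bar_def free_def)

lemma length_bar [simp]: "length (bar g) = length g"
  by (simp add: bar_def)

lemma set_bar: "set g \<subseteq> {New, Ext} \<Longrightarrow> set (bar g) \<subseteq> {Bar, Ext}"
  by (auto simp: bar_def)

text \<open>A spoke enters at a \<open>New\<close>, or at an \<open>Ext\<close> right after another
  spoke. Barring excludes the first way, and the second hypothesis excludes the other at the
  start.\<close>

lemma words_bar_iff:
  assumes "set g \<subseteq> {New, Ext}" "a \<noteq> Spk \<or> g = [] \<or> hd g = New"
  shows "w \<in> words a (bar g) \<longleftrightarrow> w \<in> words a g \<and> Spk \<notin> set w"
  using assms
proof (induction g arbitrary: a w)
  case (Cons x g)
  then have x: "x = New \<or> x = Ext" and "set g \<subseteq> {New, Ext}" by auto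
  then have IH: "v \<in> words y (bar g) \<longleftrightarrow> v \<in> words y g \<and> Spk \<notin> set v" if "y \<noteq> Spk" for v y
    using Cons.IH that by blast
  show ?case
  proof (cases w)
    case Nil
    then show ?thesis using x by auto
  next
    case (Cons y v)
    show ?thesis
    proof (cases "y = Spk")
      case True
      then show ?thesis using x Cons Cons.prems
        by (auto simp: Cons_words_iff simp del: words.simps)
    next
      case False
      then show ?thesis using x Cons Cons.prems IH[OF False, of v]
        by (auto simp: Cons_words_iff simp del: words.simps)
    qed
  qed
qed auto

lemma sum_words_bar:
  assumes "set g \<subseteq> {New, Ext}" "a \<noteq> Spk"
  shows "(\<Sum>w\<in>words a (bar g). monom 1 (free g - free w) * h (k + free w)) = block_rec h k (free g)"
  using assms
proof (induction g arbitrary: a k)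
  case (Cons x g)
  then have IH: "(\<Sum>w\<in>words b (bar g). monom 1 (free g - free w) * h (k + free w)) =
      block_rec h k (free g)" if "b \<noteq> Spk" for b k
    using that by auto
  have shift: "(\<Sum>w\<in>words b (bar g). monom 1 (Suc (free g) - free w) * f w) =
      tp * (\<Sum>w\<in>words b (bar g). monom 1 (free g - free w) * f w)" for b f
    unfolding sum_distrib_left tp_monom
    by (intro sum.cong) (auto dest: words_free simp: Suc_diff_le free_bar)
  have "x = New \<or> x = Ext" using Cons.prems by auto
  then show ?case
    using IH[of New "Suc k"] IH[of Ext k] Cons.prems
    by (auto simp: sum_words_Cons ok_sets shift simp del: words.simps ok.simps)
qed simp

lemma sum_over_New:
  assumes "set g \<subseteq> {New, Ext}"
  shows "(\<Sum>i | i < length g \<and> g ! i = New. \<phi> (free (take i g))) = (\<Sum>j<free g. \<phi> j)"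
  using assms
proof (induction g rule: rev_induct)
  case (snoc x g)
  have "{i. i < length (g @ [x]) \<and> (g @ [x]) ! i = New} =
      {i. i < length g \<and> g ! i = New} \<union> (if x = New then {length g} else {})"
    by (auto simp: nth_append less_Suc_eq)
  moreover have "(\<Sum>i | i < length g \<and> g ! i = New. \<phi> (free (take i (g @ [x])))) =
      (\<Sum>i | i < length g \<and> g ! i = New. \<phi> (free (take i g)))"
    by (intro sum.cong) auto
  ultimately show ?case using snoc by (auto simp: add.commute)
qed simp

text \<open>Spokeless words give \<open>block_sum whirl_fps\<close>. The others are sorted by the
  position of their first spoke and cut there: the letters before it move to the end, barred because
  they must not become spokes. This yields \<open>cyc_sum\<close>.\<close>

lemma cyc_total_New:
  assumes "set g \<subseteq> {New, Ext}" "g \<noteq> []" "hd g = New"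
  shows "cyc_total g = whirl_z $ free g"
proof -
  let ?T = "\<lambda>w. monom 1 (free g - free w) * cyc_wt w"
  have fin: "finite (cwords g)"
  proof (rule finite_subset)
    show "cwords g \<subseteq> (\<Union>a. words a g)" by (auto simp: cwords_def)
  qed (auto simp: finite_words finite_labels)
  have len: "length w = length g" if "w \<in> cwords g" for w
    using that words_length by (auto simp: cwords_def)
  \<comment> \<open>As g starts with \<open>New\<close>, the left neighbour matters only through
    being a spoke or not; \<open>Ext\<close> is used below as an arbitrary non-spoke.\<close>
  have change: "w \<in> words a (bar g) \<longleftrightarrow> w \<in> words b (bar g)" if "a \<noteq> Spk" "b \<noteq> Spk" for w a b
    using assms that by (cases g) (auto simp: bar_def)
  have A: "{w \<in> cwords g. Spk \<notin> set w} = words Ext (bar g)"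
  proof (intro set_eqI iffI)
    fix w assume w: "w \<in> {w \<in> cwords g. Spk \<notin> set w}"
    then have "w \<noteq> []" using len[of w] assms by auto
    then have "last w \<noteq> Spk" using w last_in_set by force
    then show "w \<in> words Ext (bar g)"
      using w words_bar_iff[OF assms(1), of "last w" w] change[of "last w" Ext w]
      by (auto simp: cwords_def)
  next
    fix w assume w: "w \<in> words Ext (bar g)"
    then have *: "w \<in> words Ext g" "Spk \<notin> set w" using words_bar_iff[OF assms(1)] by auto
    then have "w \<noteq> []" using words_length assms by fastforce
    then have "last w \<noteq> Spk" using * last_in_set by force
    then show "w \<in> {w \<in> cwords g. Spk \<notin> set w}"
      using w * words_bar_iff[OF assms(1), of "last w" w] change[of "last w" Ext w]
      by (auto simp: cwords_def)
  qed
  have no_Spk: "(\<Sum>w\<in>{w \<in> cwords g. Spk \<notin> set w}. ?T w) = block_sum whirl_fps $ free g"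
  proof -
    have "(\<Sum>w\<in>{w \<in> cwords g. Spk \<notin> set w}. ?T w) =
        (\<Sum>w\<in>words Ext (bar g). monom 1 (free g - free w) * whirl_kl (0 + free w))"
      by (rule sum.cong[OF A]) (use A in \<open>auto simp: cyc_wt_def\<close>)
    also have "\<dots> = block_rec whirl_kl 0 (free g)" using sum_words_bar assms by blast
    also have "\<dots> = block_sum whirl_fps $ free g"
      by (simp add: block_rec_eq whirl_kl_def fps_nth_inverse)
    finally show ?thesis .
  qed
  let ?I = "{i. i < length g \<and> g ! i = New}"
  define W where "W i = {w \<in> cwords g. w ! i = Spk \<and> Spk \<notin> set (take i w)}" for i
  have split: "\<exists>g1 g2. g = g1 @ New # g2 \<and> length g1 = i" if "i \<in> ?I" for i
  proof (intro exI conjI)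
    show "g = take i g @ New # drop (Suc i) g" using that id_take_nth_drop[of i g] by simp
    show "length (take i g) = i" using that by simp
  qed
  have iff: "v @ Spk # r \<in> cwords g \<and> Spk \<notin> set v \<longleftrightarrow>
      r @ v @ [Spk] \<in> words Spk (g2 @ bar g1 @ [Spk])"
    if g: "g = g1 @ New # g2" and l: "length v = length g1" "length r = length g2" for g1 g2 v r
  proof -
    have g1: "set g1 \<subseteq> {New, Ext}" using assms(1) unfolding g by simp
    have hd: "g1 = [] \<or> hd g1 = New" using assms(3) unfolding g by (cases g1) simp_all
    have *: "last (v @ Spk # r) = last (Spk # r)" by simp
    have "v @ Spk # r \<in> cwords g \<longleftrightarrow> v \<in> words (last (Spk # r)) g1 \<and> r \<in> words Spk g2"
      unfolding cwords_def mem_Collect_eq * g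
      using l by (simp add: append_words_iff Cons_words_iff del: words.simps last.simps)
    moreover have "r @ v @ [Spk] \<in> words Spk (g2 @ bar g1 @ [Spk]) \<longleftrightarrow>
        r \<in> words Spk g2 \<and> v \<in> words (last (Spk # r)) (bar g1)"
      using l by (simp add: append_words_iff Cons_words_iff del: words.simps(2) last.simps)
    ultimately show ?thesis using words_bar_iff[OF g1, of "last (Spk # r)" v] hd by blast
  qed
  \<comment> \<open>The factor t accounts for the \<open>New\<close> of g at position i that turned
    into the spoke.\<close>
  have W_sum: "sum ?T (W i) = tp * word_rec 0 (free g - 1 - free (take i g)) (free (take i g))"
    if i: "i \<in> ?I" for i
  proof -
    obtain g1 g2 where g: "g = g1 @ New # g2" "length g1 = i" using split[OF i] by blast
    let ?h = "g2 @ bar g1 @ [Spk]"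
    have fg: "free g = Suc (free ?h)" using g by (simp add: free_bar)
    have shape: "\<exists>v r. w = v @ Spk # r \<and> length v = length g1 \<and> length r = length g2" if "w \<in> W i" for w
    proof -
      have l: "length w = length g" "w ! i = Spk" using that len by (auto simp: W_def)
      then have "w = take i w @ Spk # drop (Suc i) w" using i id_take_nth_drop[of i w] by simp
      then show ?thesis using l g i by (intro exI[of _ "take i w"] exI[of _ "drop (Suc i) w"]) auto
    qed
    have shape': "\<exists>v r. w = r @ v @ [Spk] \<and> length v = length g1 \<and> length r = length g2"
      if w: "w \<in> words Spk ?h" for w
    proof -
      have l: "length w = length g2 + length g1 + 1" using words_length[OF w] by simp
      define r where "r = take (length g2) w"
      define v where "v = take (length g1) (drop (length g2) w)"
      define z where "z = drop (length g1) (drop (length g2) w)"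
      have rvz: "w = r @ v @ z" by (simp only: r_def v_def z_def append_take_drop_id)
      have lens: "length r = length g2" "length v = length (bar g1)" "length z = 1"
        using l by (auto simp: r_def v_def z_def)
      then obtain c where c: "z = [c]" by (cases z) auto
      have "z \<in> words (last (last (Spk # r) # v)) [Spk]"
        using w lens unfolding rvz by (simp only: append_words_iff)
      then have "c = Spk" using c by simp
      then show ?thesis using rvz c lens by auto
    qed
    have "sum ?T (W i) = (\<Sum>w\<in>words Spk ?h. tp * (monom 1 (free ?h - free w) * wt 0 w))"
    proof (rule sum.reindex_bij_witness[where
          j = "\<lambda>w. drop (Suc i) w @ take i w @ [Spk]" and
          i = "\<lambda>w. take i (drop (length g2) w) @ Spk # take (length g2) w"])
      fix w assume w: "w \<in> W i"
      then obtain v r where vr: "w = v @ Spk # r" "length v = length g1" "length r = length g2"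
        using shape by blast
      have img: "drop (Suc i) w @ take i w @ [Spk] = r @ v @ [Spk]" using vr g by simp
      show "take i (drop (length g2) (drop (Suc i) w @ take i w @ [Spk])) @
          Spk # take (length g2) (drop (Suc i) w @ take i w @ [Spk]) = w"
        unfolding img using vr g by simp
      have in': "r @ v @ [Spk] \<in> words Spk ?h"
        using iff[OF g(1) vr(2,3)] w vr g by (auto simp: W_def)
      then show "drop (Suc i) w @ take i w @ [Spk] \<in> words Spk ?h" unfolding img .
      have "free w \<le> free ?h" using words_free[OF in'] vr by simp
      then have "Suc (free ?h - free w) = free g - free w" using fg by simp
      moreover have "free (r @ v @ [Spk]) = free w" "wt 0 (r @ v @ [Spk]) = cyc_wt w"
        using vr by (simp_all add: cyc_wt_Spk)
      ultimately show "tp * (monom 1 (free ?h - free (drop (Suc i) w @ take i w @ [Spk])) *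
          wt 0 (drop (Suc i) w @ take i w @ [Spk])) = ?T w"
        unfolding img tp_monom by simp
    next
      fix w assume w: "w \<in> words Spk ?h"
      then obtain v r where vr: "w = r @ v @ [Spk]" "length v = length g1" "length r = length g2"
        using shape' by blast
      have img: "take i (drop (length g2) w) @ Spk # take (length g2) w = v @ Spk # r"
        using vr g by simp
      show "drop (Suc i) (take i (drop (length g2) w) @ Spk # take (length g2) w) @
          take i (take i (drop (length g2) w) @ Spk # take (length g2) w) @ [Spk] = w"
        unfolding img using vr g by simp
      show "take i (drop (length g2) w) @ Spk # take (length g2) w \<in> W i"
        unfolding img W_def using iff[OF g(1) vr(2,3)] w vr g by (simp add: nth_append)
    qed
    also have "\<dots> = tp * lin 0 ?h"
      using sum_words_wt[of Spk 0 ?h] by (simp flip: sum_distrib_left)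
    also have "lin 0 ?h = word_rec 0 (free g2) (free g1)"
    proof -
      have "set g1 \<subseteq> {New, Ext}" "set g2 \<subseteq> {New, Ext}" using assms g by auto
      then show ?thesis using lin_block[OF _ set_bar, of g2 g1 0 "[]"] by (simp add: free_bar)
    qed
    finally show ?thesis using g by simp
  qed
  have "{w \<in> cwords g. Spk \<in> set w} = (\<Union>i\<in>?I. W i)"
  proof (intro set_eqI iffI)
    fix w assume w: "w \<in> {w \<in> cwords g. Spk \<in> set w}"
    then have "Spk \<in> set w" by simp
    from split_list_first[OF this] obtain v r where vr: "w = v @ Spk # r" "Spk \<notin> set v" by blast
    define i where "i = length v"
    have i: "i < length g" using vr len[of w] w by (auto simp: i_def)
    have g: "g = take i g @ g ! i # drop (Suc i) g" using i by (rule id_take_nth_drop)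
    define g1 where "g1 = take i g"
    define g2 where "g2 = drop (Suc i) g"
    have g': "g = g1 @ g ! i # g2" using g by (simp add: g1_def g2_def)
    have l: "length v = length g1" using i by (simp add: g1_def i_def)
    have "v @ Spk # r \<in> words (last w) (g1 @ g ! i # g2)"
      using w vr g' by (simp add: cwords_def)
    then have *: "v \<in> words (last w) g1" "ok (last (last w # v)) (g ! i) Spk"
      unfolding append_words_iff[OF l] by (auto simp: Cons_words_iff simp del: words.simps)
    have "g ! i \<in> {New, Ext}" using assms(1) i nth_mem by blast
    \<comment> \<open>An \<open>Ext\<close> becomes a spoke only right after a spoke. For the first
      spoke this could happen only across the seam, which \<open>hd g = New\<close>
      excludes.\<close>
    moreover have "g ! i \<noteq> Ext"
    proof
      assume e: "g ! i = Ext"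
      have "v \<noteq> []"
      proof
        assume "v = []"
        then have "g ! 0 = Ext" using e by (simp add: i_def)
        then show False using assms by (simp add: hd_conv_nth)
      qed
      then have "last (last w # v) \<noteq> Spk" using vr last_in_set by force
      then show False using * e by simp
    qed
    ultimately have "i \<in> ?I" using i by auto
    moreover have "w \<in> W i" using w vr by (simp add: W_def i_def)
    ultimately show "w \<in> (\<Union>i\<in>?I. W i)" by blast
  next
    fix w assume "w \<in> (\<Union>i\<in>?I. W i)"
    then obtain i where "i < length g" "w \<in> cwords g" "w ! i = Spk" by (auto simp: W_def)
    then show "w \<in> {w \<in> cwords g. Spk \<in> set w}" using len[of w] nth_mem[of i w] by simp
  qed
  moreover have "sum ?T (\<Union>i\<in>?I. W i) = (\<Sum>i\<in>?I. sum ?T (W i))"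
  proof (rule sum.UNION_disjoint)
    show "\<forall>i\<in>?I. \<forall>j\<in>?I. i \<noteq> j \<longrightarrow> W i \<inter> W j = {}"
    proof (intro ballI impI)
      have *: "W i \<inter> W j = {}" if "i < j" "j < length g" for i j
      proof -
        have "Spk \<in> set (take j w)" if w: "w \<in> W i" for w
        proof -
          have "w ! i = Spk" "length w = length g" using w len by (auto simp: W_def)
          then have "take j w ! i = Spk" "i < length (take j w)"
            using \<open>i < j\<close> \<open>j < length g\<close> by auto
          then show ?thesis by (metis nth_mem)
        qed
        then show ?thesis by (auto simp: W_def)
      qed
      fix i j assume "i \<in> ?I" "j \<in> ?I" "i \<noteq> j"
      then show "W i \<inter> W j = {}" using *[of i j] *[of j i] by (cases "i < j") auto
    qed
  qed (use fin in \<open>auto simp: W_def\<close>)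
  moreover have "(\<Sum>i\<in>?I. sum ?T (W i)) = cyc_sum (free g)"
    using W_sum sum_over_New[OF assms(1), of "\<lambda>j. tp * word_rec 0 (free g - 1 - j) j"]
    by (simp add: cyc_sum_def)
  moreover have "cyc_total g = (\<Sum>w\<in>{w \<in> cwords g. Spk \<notin> set w}. ?T w) +
      (\<Sum>w\<in>{w \<in> cwords g. Spk \<in> set w}. ?T w)"
    unfolding cyc_total_def using fin by (subst sum.union_disjoint[symmetric]) (auto intro: sum.cong)
  ultimately show ?thesis using no_Spk by (simp add: whirl_z_def cyc_fps_def)
qed

text \<open>Rotate g so that it ends in a spoke or, if it has none, begins with a new block.\<close>

lemma palindromic_cyc_total:
  assumes "set g \<subseteq> {Spk, New, Ext}" "Spk \<in> set g \<or> New \<in> set g"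
  shows "palindromic (free g) (cyc_total g)"
proof (cases "Spk \<in> set g")
  case True
  obtain x y where g: "g = x @ Spk # y" using split_list[OF True] by blast
  have "cyc_total g = cyc_total ((x @ [Spk]) @ y)" using g by simp
  also have "\<dots> = cyc_total ((y @ x) @ [Spk])" unfolding cyc_total_rotate[of "x @ [Spk]" y] by simp
  also have "\<dots> = lin 0 ((y @ x) @ [Spk])" by (rule cyc_total_Spk)
  finally have "cyc_total g = lin 0 ((y @ x) @ [Spk])" .
  moreover have "palindromic (free ((y @ x) @ [Spk])) (lin 0 ((y @ x) @ [Spk]))"
    using assms g by (intro palindromic_lin) auto
  moreover have "free ((y @ x) @ [Spk]) = free g" using g by simp
  ultimately show ?thesis by simp
next
  case False
  then have New: "New \<in> set g" using assms by blast
  obtain x y where g: "g = x @ New # y" using split_list[OF New] by blast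
  have "cyc_total g = cyc_total ((New # y) @ x)" unfolding g by (rule cyc_total_rotate)
  also have "\<dots> = whirl_z $ free ((New # y) @ x)"
    using assms False g by (intro cyc_total_New) auto
  also have "free ((New # y) @ x) = free g" using g by simp
  finally show ?thesis using palindromic_whirl_z by simp
qed


subsection \<open>Whirls as transversal matroids\<close>

text \<open>Independence in a transversal matroid; for whirls \<open>A x\<close> will be the set of
  rim endpoints of the edge x.\<close>

definition matchable :: "('e \<Rightarrow> 'v set) \<Rightarrow> 'e set \<Rightarrow> bool" where
  "matchable A X \<longleftrightarrow> (\<exists>\<phi>. inj_on \<phi> X \<and> (\<forall>x\<in>X. \<phi> x \<in> A x))"

lemma matchable_mono: "matchable A X \<Longrightarrow> Y \<subseteq> X \<Longrightarrow> matchable A Y"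
  unfolding matchable_def using inj_on_subset by blast

lemma matchable_card_le:
  assumes "matchable A X" "\<And>x. x \<in> X \<Longrightarrow> A x \<subseteq> V" "finite V"
  shows "card X \<le> card V"
proof -
  obtain \<phi> where "inj_on \<phi> X" "\<And>x. x \<in> X \<Longrightarrow> \<phi> x \<in> A x"
    using assms(1) unfolding matchable_def by blast
  then show ?thesis using assms(2,3) by (intro card_inj_on_le[of \<phi>]) auto
qed

text \<open>Moving \<open>\<phi>\<close> to agree with \<open>\<psi>\<close> on one more element of \<open>I \<inter> J\<close> must stop, since it decreases
  the number of disagreements; it stops at an element of \<open>J - I\<close> that extends the matching.\<close>

lemma matchable_augment:
  assumes "matchable A I" "matchable A J" "finite I" "finite J" "card I < card J"
  shows "\<exists>x\<in>J - I. matchable A (insert x I)"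
proof -
  obtain \<phi> \<psi> where \<phi>: "inj_on \<phi> I" "\<And>x. x \<in> I \<Longrightarrow> \<phi> x \<in> A x"
    and \<psi>: "inj_on \<psi> J" "\<And>x. x \<in> J \<Longrightarrow> \<psi> x \<in> A x"
    using assms(1,2) unfolding matchable_def by blast
  from \<phi> show ?thesis
  proof (induction "card {x \<in> I \<inter> J. \<phi> x \<noteq> \<psi> x}" arbitrary: \<phi> rule: less_induct)
    case less
    have "card (\<phi> ` I) < card (\<psi> ` J)"
      using card_image[OF less.prems(1)] card_image[OF \<psi>(1)] assms(5) by simp
    then have "\<not> \<psi> ` J \<subseteq> \<phi> ` I" using assms(3) card_mono[of "\<phi> ` I" "\<psi> ` J"] by auto
    then obtain x where x: "x \<in> J" "\<psi> x \<notin> \<phi> ` I" by blast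
    define \<chi> where "\<chi> = \<phi>(x := \<psi> x)"
    have "inj_on \<chi> (insert x I)"
    proof (rule inj_onI)
      have *: "\<chi> y \<noteq> \<chi> x" if "y \<in> I" "y \<noteq> x" for y
      proof
        assume "\<chi> y = \<chi> x"
        then have "\<psi> x = \<phi> y" using that by (simp add: \<chi>_def)
        then show False using x(2) that(1) by blast
      qed
      fix y z assume yz: "y \<in> insert x I" "z \<in> insert x I" "\<chi> y = \<chi> z"
      show "y = z"
      proof (cases "y = x \<or> z = x")
        case True
        then show ?thesis using *[of y] *[of z] yz by (metis insertE)
      next
        case False
        then have "\<phi> y = \<phi> z" "y \<in> I" "z \<in> I" using yz by (auto simp: \<chi>_def)
        then show ?thesis using inj_onD[OF less.prems(1)] by blast
      qed
    qed
    moreover have "\<chi> y \<in> A y" if "y \<in> insert x I" for y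
      using that less.prems(2)[of y] \<psi>(2)[OF x(1)] by (cases "y = x") (auto simp: \<chi>_def)
    ultimately have \<chi>: "inj_on \<chi> (insert x I)" "\<And>y. y \<in> insert x I \<Longrightarrow> \<chi> y \<in> A y" by blast+
    show ?case
    proof (cases "x \<in> I")
      case False
      then show ?thesis using x \<chi> unfolding matchable_def by blast
    next
      case True
      have "x \<in> {y \<in> I \<inter> J. \<phi> y \<noteq> \<psi> y}" using x True by force
      moreover have "x \<notin> {y \<in> I \<inter> J. \<chi> y \<noteq> \<psi> y}" by (simp add: \<chi>_def)
      moreover have "{y \<in> I \<inter> J. \<chi> y \<noteq> \<psi> y} \<subseteq> {y \<in> I \<inter> J. \<phi> y \<noteq> \<psi> y}"
        by (auto simp: \<chi>_def)
      ultimately have "{y \<in> I \<inter> J. \<chi> y \<noteq> \<psi> y} \<subset> {y \<in> I \<inter> J. \<phi> y \<noteq> \<psi> y}" by blast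
      then have "card {y \<in> I \<inter> J. \<chi> y \<noteq> \<psi> y} < card {y \<in> I \<inter> J. \<phi> y \<noteq> \<psi> y}"
        by (rule psubset_card_mono[rotated]) (simp add: assms(3))
      moreover have "insert x I = I" using True by blast
      then have "inj_on \<chi> I" "\<And>y. y \<in> I \<Longrightarrow> \<chi> y \<in> A y" using \<chi> by simp_all
      ultimately show ?thesis using less.hyps by blast
    qed
  qed
qed

text \<open>The rim unrolled: arcs become intervals of natural numbers, on which this map is
  injective as long as they have at most n elements.\<close>

definition vertex :: "nat \<Rightarrow> nat \<Rightarrow> nat" where
  "vertex n l = l mod n + 1"

definition nxt :: "nat \<Rightarrow> nat \<Rightarrow> nat" where
  "nxt n i = (if i = n then 1 else i + 1)"

definition prv :: "nat \<Rightarrow> nat \<Rightarrow> nat" where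
  "prv n i = (if i = 1 then n else i - 1)"

definition verts :: "nat \<Rightarrow> wheel_edge \<Rightarrow> nat set" where
  "verts n e = wheel_ends n e - {0}"

lemma is_forestD: "is_forest ends X \<Longrightarrow> is_cycle ends es \<Longrightarrow> \<not> set es \<subseteq> X"
  unfolding is_forest_def by blast

context
  fixes n :: nat
  assumes n: "n \<ge> 2"
begin

lemma vertex_in: "vertex n l \<in> {1..n}"
proof -
  have "l mod n < n" using n by simp
  then show ?thesis by (simp add: vertex_def)
qed

lemma vertex_pred: "i \<in> {1..n} \<Longrightarrow> vertex n (i - 1) = i"
  by (auto simp: vertex_def)

lemma nxt_vertex: "nxt n (vertex n l) = vertex n (Suc l)"
  using n by (auto simp: nxt_def vertex_def mod_Suc)

lemma vertex_eq_window:
  assumes "vertex n l = vertex n l'" "m \<le> l" "m \<le> l'" "l < m + n" "l' < m + n"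
  shows "l = l'"
proof -
  have *: "\<not> l < l'" if "l mod n = l' mod n" "m \<le> l" "l' < m + n" for l l'
  proof
    assume less: "l < l'"
    then have "n dvd l' - l" using that(1) by (metis mod_eq_dvd_iff_nat less_imp_le)
    then show False using less that(2,3) dvd_imp_le[of n "l' - l"] by simp
  qed
  have "l mod n = l' mod n" using assms(1) by (simp add: vertex_def)
  then show ?thesis using *[of l l'] *[of l' l] assms by (metis linorder_neqE_nat)
qed

lemma nxt_in: "i \<in> {1..n} \<Longrightarrow> nxt n i \<in> {1..n}"
  and prv_in: "i \<in> {1..n} \<Longrightarrow> prv n i \<in> {1..n}"
  and prv_nxt: "i \<in> {1..n} \<Longrightarrow> prv n (nxt n i) = i"
  and nxt_prv: "i \<in> {1..n} \<Longrightarrow> nxt n (prv n i) = i"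
  and nxt_neq: "i \<in> {1..n} \<Longrightarrow> nxt n i \<noteq> i"
  using n by (auto simp: nxt_def prv_def)

lemma nxt_inj: "i \<in> {1..n} \<Longrightarrow> j \<in> {1..n} \<Longrightarrow> nxt n i = nxt n j \<longleftrightarrow> i = j"
  using n by (auto simp: nxt_def split: if_splits)

lemma nxt_closed_all:
  assumes "R \<subseteq> {1..n}" "R \<noteq> {}" "\<And>i. i \<in> R \<Longrightarrow> nxt n i \<in> R"
  shows "R = {1..n}"
proof -
  obtain j where j: "j \<in> R" using assms(2) by blast
  have "j \<in> {1..n}" using j assms(1) by blast
  then have "vertex n (j - 1 + k) \<in> R" for k
  proof (induction k)
    case 0
    then show ?case using j vertex_pred by simp
  next
    case (Suc k)
    then show ?case using assms(3)[of "vertex n (j - 1 + k)"] by (simp add: nxt_vertex)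
  qed
  \<comment> \<open>The number of steps is chosen so that the total is
    \<open>n * (j - 1) + (i - 1)\<close>, congruent to i - 1, with no subtraction below 0.\<close>
  moreover have "vertex n (j - 1 + ((n - 1) * (j - 1) + (i - 1))) = i" if i: "i \<in> {1..n}" for i
  proof -
    have *: "j - 1 + ((n - 1) * (j - 1) + (i - 1)) = n * (j - 1) + (i - 1)"
      using n by (cases n) auto
    have "vertex n (j - 1 + ((n - 1) * (j - 1) + (i - 1))) = vertex n (i - 1)"
      unfolding vertex_def * by simp
    then show ?thesis using vertex_pred[OF i] by simp
  qed
  ultimately have "{1..n} \<subseteq> R" by (metis subsetI)
  then show ?thesis using assms(1) by blast
qed

lemma mem_wheel_edges [simp]:
  "Spoke i \<in> wheel_edges n \<longleftrightarrow> i \<in> {1..n}" "Rim i \<in> wheel_edges n \<longleftrightarrow> i \<in> {1..n}"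
  by (auto simp: wheel_edges_def rim_edges_def)

lemma rim_edges_iff: "e \<in> rim_edges n \<longleftrightarrow> (\<exists>i\<in>{1..n}. e = Rim i)"
  by (auto simp: rim_edges_def)

lemma rim_subset: "rim_edges n \<subseteq> wheel_edges n"
  by (simp add: wheel_edges_def)

lemma finite_wheel: "finite (wheel_edges n)"
  by (simp add: wheel_edges_def rim_edges_def)

lemma ends_Rim: "wheel_ends n (Rim i) = {i, nxt n i}"
  by (simp add: nxt_def)

lemma verts_simps [simp]:
  "i \<in> {1..n} \<Longrightarrow> verts n (Spoke i) = {i}"
  "i \<in> {1..n} \<Longrightarrow> verts n (Rim i) = {i, nxt n i}"
  by (auto simp: verts_def nxt_def)

lemma verts_subset: "e \<in> wheel_edges n \<Longrightarrow> verts n e \<subseteq> {1..n}"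
  using nxt_in by (cases e) auto

lemma card_rim: "card (rim_edges n) = n"
  by (simp add: rim_edges_def card_image inj_on_def)

section \<open>Independent sets of the whirl as matchable sets\<close>

lemma rim_cycle: "is_cycle (wheel_ends n) (map (\<lambda>l. Rim (vertex n l)) [0..<n])"
  unfolding is_cycle_def
proof (intro conjI exI[of _ "map (vertex n) [0..<n]"] allI impI)
  have inj: "inj_on (vertex n) {0..<n}"
    by (rule inj_onI, rule vertex_eq_window[of _ _ 0]) auto
  then show "distinct (map (vertex n) [0..<n])" by (simp add: distinct_map)
  show "distinct (map (\<lambda>l. Rim (vertex n l)) [0..<n])"
    using inj by (auto simp: distinct_map inj_on_def)
  fix i assume i: "i < length (map (\<lambda>l. Rim (vertex n l)) [0..<n])"
  have "vertex n (Suc i mod n) = vertex n (Suc i)" by (simp add: vertex_def)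
  moreover have "Suc i mod n < n" using n by simp
  ultimately show "wheel_ends n (map (\<lambda>l. Rim (vertex n l)) [0..<n] ! i) =
      {map (vertex n) [0..<n] ! i,
       map (vertex n) [0..<n] ! (Suc i mod length (map (\<lambda>l. Rim (vertex n l)) [0..<n]))}"
    using i by (simp add: nxt_vertex ends_Rim del: wheel_ends.simps)
qed (use n in auto)

lemma rim_not_forest: "\<not> is_forest (wheel_ends n) (rim_edges n)"
proof -
  have "set (map (\<lambda>l. Rim (vertex n l)) [0..<n]) \<subseteq> rim_edges n"
    using vertex_in by (auto simp: rim_edges_iff)
  then show ?thesis using rim_cycle is_forestD by blast
qed

text \<open>Out from the hub along a spoke, along the rim and back. The second hypothesis keeps the
  rim vertices distinct.\<close>

lemma arc_cycle:
  assumes "m \<le> l" "Suc l < m + n"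
  shows "is_cycle (wheel_ends n)
    (Spoke (vertex n m) # map (\<lambda>k. Rim (vertex n k)) [m..<Suc l] @ [Spoke (vertex n (Suc l))])"
    (is "is_cycle _ ?es")
  unfolding is_cycle_def
proof (intro conjI exI[of _ "0 # map (vertex n) [m..<Suc (Suc l)]"] allI impI)
  have inj: "inj_on (vertex n) {m..<Suc (Suc l)}"
    by (rule inj_onI, rule vertex_eq_window[of _ _ m]) (use assms in auto)
  have "0 \<notin> vertex n ` {m..<Suc (Suc l)}" by (auto simp: vertex_def)
  then show "distinct (0 # map (vertex n) [m..<Suc (Suc l)])"
    using inj by (simp add: distinct_map del: upt_Suc)
  have "inj_on (vertex n) {m..<Suc l}" using inj by (rule inj_on_subset) auto
  then have "distinct (map (\<lambda>k. Rim (vertex n k)) [m..<Suc l])"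
    by (auto simp: distinct_map inj_on_def simp del: upt_Suc)
  moreover have "vertex n m \<noteq> vertex n (Suc l)"
    using vertex_eq_window[of m "Suc l" m] assms n by auto
  ultimately show "distinct ?es" by (auto simp del: upt_Suc)
  show "length (0 # map (vertex n) [m..<Suc (Suc l)]) = length ?es"
    using assms by (simp del: upt_Suc)
  fix i assume i: "i < length ?es"
  have len: "length ?es = Suc (Suc (Suc (l - m)))" using assms by (simp add: Suc_diff_le del: upt_Suc)
  have vs: "(0 # map (vertex n) [m..<Suc (Suc l)]) ! Suc j = vertex n (m + j)" if "j \<le> Suc l - m" for j
    using that assms by (simp del: upt_Suc)
  consider "i = 0" | j where "i = Suc j" "j \<le> l - m" | "i = Suc (Suc (l - m))"
    using i unfolding len by (cases i) (auto simp: less_Suc_eq le_less)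
  then show "wheel_ends n (?es ! i) = {(0 # map (vertex n) [m..<Suc (Suc l)]) ! i,
      (0 # map (vertex n) [m..<Suc (Suc l)]) ! (Suc i mod length ?es)}"
  proof cases
    case 1
    then show ?thesis unfolding len using vs[of 0] by (simp del: upt_Suc)
  next
    case 2
    then have "?es ! i = Rim (vertex n (m + j))"
      using assms by (simp add: nth_append less_Suc_eq_le Suc_diff_le del: upt_Suc)
    moreover have "Suc i mod length ?es = Suc (Suc j)" unfolding len using 2 by simp
    ultimately show ?thesis
      using vs[of j] vs[of "Suc j"] 2 assms ends_Rim[of "vertex n (m + j)"] nxt_vertex[of "m + j"]
      by (simp add: Suc_diff_le del: upt_Suc wheel_ends.simps)
  next
    case 3
    then have "?es ! i = Spoke (vertex n (Suc l))"
      using assms by (simp add: nth_append Suc_diff_le del: upt_Suc)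
    moreover have "Suc i mod length ?es = 0" unfolding len using 3 by simp
    moreover have "(0 # map (vertex n) [m..<Suc (Suc l)]) ! i = vertex n (Suc l)"
      using vs[of "Suc (l - m)"] 3 assms by (simp add: Suc_diff_le)
    ultimately show ?thesis by auto
  qed
qed simp

text \<open>Root the forest at the hub. A rim edge that starts at a vertex reached from a spoke in
  the direction of \<open>nxt\<close> is matched with its far end, any other rim edge with its
  start, a spoke with its rim vertex. A far end carrying a spoke would close a cycle.\<close>

lemma forest_matchable:
  assumes X: "X \<subseteq> wheel_edges n" and forest: "is_forest (wheel_ends n) X"
  shows "matchable (verts n) X"
proof -
  define rooted where "rooted i \<longleftrightarrow> (\<exists>m l. m \<le> l \<and> i = vertex n l \<and>
      Spoke (vertex n m) \<in> X \<and> (\<forall>k. m \<le> k \<and> k < l \<longrightarrow> Rim (vertex n k) \<in> X))" for i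
  have rooted_Spoke: "rooted i" if "Spoke i \<in> X" for i
  proof -
    have "i = vertex n (i - 1)" using that X vertex_pred by auto
    then show ?thesis unfolding rooted_def using that
      by (intro exI[of _ "i - 1"]) auto
  qed
  have rooted_nxt: "rooted (nxt n i)" if "rooted i" "Rim i \<in> X" for i
  proof -
    obtain m l where *: "m \<le> l" "i = vertex n l" "Spoke (vertex n m) \<in> X"
      "\<forall>k. m \<le> k \<and> k < l \<longrightarrow> Rim (vertex n k) \<in> X" using \<open>rooted i\<close> unfolding rooted_def by blast
    have "Rim (vertex n k) \<in> X" if "m \<le> k \<and> k < Suc l" for k
      using that * \<open>Rim i \<in> X\<close> by (cases "k = l") auto
    then show ?thesis unfolding rooted_def using * nxt_vertex[of l]
      by (intro exI[of _ m] exI[of _ "Suc l"]) auto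
  qed
  have no_return: "Spoke (nxt n i) \<notin> X" if "rooted i" "Rim i \<in> X" for i
  proof
    assume S: "Spoke (nxt n i) \<in> X"
    obtain m l where *: "m \<le> l" "i = vertex n l" "Spoke (vertex n m) \<in> X"
      "\<forall>k. m \<le> k \<and> k < l \<longrightarrow> Rim (vertex n k) \<in> X" using \<open>rooted i\<close> unfolding rooted_def by blast
    have R: "Rim (vertex n k) \<in> X" if "m \<le> k" "k \<le> l" for k
      using that * \<open>Rim i \<in> X\<close> by (cases "k = l") auto
    show False
    \<comment> \<open>Less than a full turn gives a cycle through the hub; otherwise the walk has
      used every rim edge.\<close>
    proof (cases "Suc l < m + n")
      case True
      then show False
        using is_forestD[OF forest arc_cycle[OF *(1) True]] R * S nxt_vertex[of l]
        by (auto simp: less_Suc_eq_le simp del: upt_Suc)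
    next
      case False
      have "rim_edges n \<subseteq> X"
      proof
        fix e assume "e \<in> rim_edges n"
        then obtain j where j: "j \<in> {1..n}" "e = Rim j" by (auto simp: rim_edges_iff)
        have "inj_on (vertex n) {m..<m + n}"
          by (rule inj_onI, rule vertex_eq_window[of _ _ m]) auto
        then have "card (vertex n ` {m..<m + n}) = n" by (simp add: card_image)
        moreover have "vertex n ` {m..<m + n} \<subseteq> {1..n}" using vertex_in by blast
        ultimately have "vertex n ` {m..<m + n} = {1..n}" by (intro card_subset_eq) auto
        then obtain k where "k \<in> {m..<m + n}" "j = vertex n k" using j by blast
        then show "e \<in> X" using R[of k] False j by auto
      qed
      then show False using rim_not_forest forest unfolding is_forest_def by blast
    qed
  qed
  define \<phi> where "\<phi> e = (case e of Spoke i \<Rightarrow> i | Rim i \<Rightarrow> if rooted i then nxt n i else i)" for e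
  have idx: "i \<in> {1..n}" if "Spoke i \<in> X \<or> Rim i \<in> X" for i using that X by auto
  have "inj_on \<phi> X"
  proof (rule inj_onI)
    have *: False if "Spoke i \<in> X" "Rim j \<in> X" "\<phi> (Spoke i) = \<phi> (Rim j)" for i j
      using that no_return[of j] rooted_Spoke[of i] by (auto simp: \<phi>_def split: if_splits)
    have **: "i = j" if "Rim i \<in> X" "Rim j \<in> X" "\<phi> (Rim i) = \<phi> (Rim j)" for i j
    proof -
      have "i \<in> {1..n}" "j \<in> {1..n}" using idx that by blast+
      then show ?thesis
        using that rooted_nxt[of i] rooted_nxt[of j] nxt_inj[of i j]
        by (auto simp: \<phi>_def split: if_splits)
    qed
    fix x y assume "x \<in> X" "y \<in> X" "\<phi> x = \<phi> y"
    then show "x = y"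
    proof (cases x; cases y)
      fix i j assume "x = Rim i" "y = Rim j"
      then show "x = y" using ** \<open>x \<in> X\<close> \<open>y \<in> X\<close> \<open>\<phi> x = \<phi> y\<close> by blast
    next
      fix i j assume "x = Rim i" "y = Spoke j"
      then show "x = y" using *[of j i] \<open>x \<in> X\<close> \<open>y \<in> X\<close> \<open>\<phi> x = \<phi> y\<close> by simp
    next
      fix i j assume "x = Spoke i" "y = Rim j"
      then show "x = y" using *[of i j] \<open>x \<in> X\<close> \<open>y \<in> X\<close> \<open>\<phi> x = \<phi> y\<close> by simp
    next
      fix i j assume "x = Spoke i" "y = Spoke j"
      then show "x = y" using \<open>\<phi> x = \<phi> y\<close> by (simp add: \<phi>_def)
    qed
  qed
  moreover have "\<phi> e \<in> verts n e" if "e \<in> X" for e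
    using that idx by (cases e) (auto simp: \<phi>_def)
  ultimately show ?thesis unfolding matchable_def by blast
qed

lemma rim_matchable: "matchable (verts n) (rim_edges n)"
proof -
  define \<phi> where "\<phi> e = (case e of Spoke i \<Rightarrow> i | Rim i \<Rightarrow> i)" for e
  have "inj_on \<phi> (rim_edges n)" "\<forall>e\<in>rim_edges n. \<phi> e \<in> verts n e"
    by (auto simp: \<phi>_def inj_on_def rim_edges_iff)
  then show ?thesis unfolding matchable_def by blast
qed

lemma rank_bound_rim:
  assumes "matchable (verts n) X" "X \<subseteq> wheel_edges n" "rim_edges n \<subseteq> X"
  shows "X = rim_edges n"
proof -
  have "card X \<le> card {1..n}"
    using assms verts_subset by (intro matchable_card_le[OF assms(1)]) auto
  then have "card X \<le> card (rim_edges n)" by (simp add: card_rim)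
  moreover have "finite X" using assms(2) finite_wheel finite_subset by blast
  ultimately show ?thesis using card_seteq[OF _ assms(3)] by simp
qed

text \<open>A cycle through the hub has more edges than rim vertices, so it cannot be matched.\<close>

lemma matchable_forest:
  assumes X: "X \<subseteq> wheel_edges n" and "matchable (verts n) X"
    and "\<not> is_forest (wheel_ends n) X"
  shows "X = rim_edges n"
proof -
  obtain es where es: "is_cycle (wheel_ends n) es" "set es \<subseteq> X"
    using assms(3) unfolding is_forest_def by blast
  then obtain vs where vs: "length vs = length es" "distinct vs" "distinct es" "es \<noteq> []"
    "\<forall>i<length es. wheel_ends n (es ! i) = {vs ! i, vs ! (Suc i mod length es)}"
    unfolding is_cycle_def by blast
  have ends: "wheel_ends n e \<subseteq> set vs" if e: "e \<in> set es" for e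
  proof -
    obtain i where i: "i < length es" "es ! i = e" 
      using e unfolding in_set_conv_nth by blast
    from i(1) have "0 < length es" by linarith
    then have "Suc i mod length es < length es" by (rule mod_less_divisor)
    then have "{vs ! i, vs ! (Suc i mod length es)} \<subseteq> set vs" 
      using nth_mem[of i vs] nth_mem[of "Suc i mod length es" vs] i(1) unfolding vs(1) by simp
    moreover have "wheel_ends n e = {vs ! i, vs ! (Suc i mod length es)}"
      using vs(5)[rule_format, OF i(1)] by (simp only: i(2))
    ultimately show ?thesis by simp
  qed
  have card_eq: "card (set es) = card (set vs)" using distinct_card[OF vs(2)] distinct_card[OF vs(3)] vs(1) by simp
  have "0 \<notin> set vs"
  proof
    assume 0: "0 \<in> set vs"
    have "card (set es) \<le> card (set vs - {0})"
    proof (rule matchable_card_le)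
      show "matchable (verts n) (set es)" using assms(2) es(2) matchable_mono by blast
      show "verts n e \<subseteq> set vs - {0}" if "e \<in> set es" for e
        using ends[OF that] by (auto simp: verts_def)
    qed simp
    moreover have "card (set vs - {0}) < card (set vs)" using 0 by (intro card_Diff1_less) auto
    ultimately show False using card_eq by simp
  qed
  have Rim: "\<exists>i. e = Rim i" if "e \<in> set es" for e
    using ends[OF that] \<open>0 \<notin> set vs\<close> by (cases e) auto
  define R where "R = {i. Rim i \<in> set es}"
  have rims: "set es = Rim ` R"
  proof
    show "set es \<subseteq> Rim ` R"
    proof
      fix e assume e: "e \<in> set es"
      then obtain i where "e = Rim i" using Rim by blast
      then show "e \<in> Rim ` R" using e by (simp add: R_def)
    qed
  qed (auto simp: R_def)
  \<comment> \<open>A hub-free cycle has as many edges as vertices and each \<open>Rim i\<close>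
    contains i, so the edge indices are exactly the vertices. The other ends are vertices too, so
    this set is closed under \<open>nxt\<close> and is the whole rim.\<close>
  have RV: "R \<subseteq> set vs"
  proof
    fix i assume "i \<in> R"
    then show "i \<in> set vs" using ends[of "Rim i"] by (simp add: R_def)
  qed
  have "card R = card (set vs)"
  proof -
    have "card (Rim ` R) = card R" by (intro card_image inj_onI) simp
    then show ?thesis using card_eq unfolding rims by simp
  qed
  then have "R = set vs" using RV by (intro card_subset_eq) auto
  then have nxt_R: "nxt n i \<in> R" if "i \<in> R" for i
  proof -
    have "Rim i \<in> set es" using that by (simp add: R_def)
    then have "nxt n i \<in> set vs" using ends[of "Rim i"] unfolding ends_Rim by blast
    then show ?thesis using \<open>R = set vs\<close> by simp
  qed
  have RX: "Rim i \<in> X" if "i \<in> R" for i using that es(2) by (auto simp: R_def)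
  then have "R \<subseteq> {1..n}" using X mem_wheel_edges(2) by blast
  moreover have "R \<noteq> {}"
  proof
    assume "R = {}"
    then show False using rims vs(4) by simp
  qed
  ultimately have "R = {1..n}" using nxt_R by (rule nxt_closed_all)
  then have "rim_edges n \<subseteq> X" using RX by (auto simp: rim_edges_iff)
  with assms(2) X show ?thesis by (rule rank_bound_rim)
qed

lemma ground_whirl: "ground (whirl n) = wheel_edges n"
  using n by (simp add: whirl_def)

text \<open>The set added to the forests in the definition is precisely the one matchable set that
  contains a cycle.\<close>

lemma indeps_whirl: "indeps (whirl n) = {X. X \<subseteq> wheel_edges n \<and> matchable (verts n) X}"
proof -
  have *: "X = rim_edges n \<or> X \<subseteq> wheel_edges n \<and> is_forest (wheel_ends n) X \<longleftrightarrow>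
      X \<subseteq> wheel_edges n \<and> matchable (verts n) X" for X
  proof (cases "X = rim_edges n")
    case True
    then show ?thesis using rim_matchable rim_subset by (simp only: simp_thms)
  next
    case False
    then show ?thesis using forest_matchable[of X] matchable_forest[of X] by blast
  qed
  have "indeps (whirl n) =
      insert (rim_edges n) {X. X \<subseteq> wheel_edges n \<and> is_forest (wheel_ends n) X}"
    using n by (simp add: whirl_def graphic_matroid_def)
  also have "\<dots> = {X. X \<subseteq> wheel_edges n \<and> matchable (verts n) X}"
    by (rule set_eqI) (simp only: insert_iff mem_Collect_eq *)
  finally show ?thesis .
qed

lemma matroid_whirl: "is_matroid (whirl n)"
  unfolding is_matroid_def ground_whirl indeps_whirl
proof (intro conjI ballI allI impI)
  show "{} \<in> {X. X \<subseteq> wheel_edges n \<and> matchable (verts n) X}" by (simp add: matchable_def)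
  fix I J assume I: "I \<in> {X. X \<subseteq> wheel_edges n \<and> matchable (verts n) X}"
  show "J \<in> {X. X \<subseteq> wheel_edges n \<and> matchable (verts n) X}" if "J \<subseteq> I"
    using that I matchable_mono by blast
  assume J: "J \<in> {X. X \<subseteq> wheel_edges n \<and> matchable (verts n) X}" and "card I < card J"
  moreover have "finite I" "finite J" using I J finite_wheel finite_subset by blast+
  ultimately obtain x where "x \<in> J - I" "matchable (verts n) (insert x I)"
    using matchable_augment[of "verts n" I J] I by blast
  then show "\<exists>x\<in>J - I. insert x I \<in> {X. X \<subseteq> wheel_edges n \<and> matchable (verts n) X}"
    using I J by blast
qed (use finite_wheel in auto)

lemma loopless_whirl: "loopless (whirl n)"
proof -
  have "matchable (verts n) {e}" if "e \<in> wheel_edges n" for e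
  proof -
    obtain v where "v \<in> verts n e" using \<open>e \<in> wheel_edges n\<close> by (cases e) auto
    then show ?thesis unfolding matchable_def by (intro exI[of _ "\<lambda>_. v"]) simp
  qed
  then show ?thesis unfolding loopless_def ground_whirl indeps_whirl by simp
qed


subsection \<open>Flats of whirls\<close>

text \<open>Closure under the triangles made of a rim edge and the spokes at its ends. Up to an
  exception for the rim, this describes the flats (\<open>flats_whirl\<close>).\<close>

definition tri_closed :: "wheel_edge set \<Rightarrow> bool" where
  "tri_closed F \<longleftrightarrow> F \<subseteq> wheel_edges n \<and> (\<forall>i\<in>{1..n}.
     (Spoke i \<in> F \<and> Rim i \<in> F \<longrightarrow> Spoke (nxt n i) \<in> F) \<and>
     (Rim i \<in> F \<and> Spoke (nxt n i) \<in> F \<longrightarrow> Spoke i \<in> F) \<and>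
     (Spoke i \<in> F \<and> Spoke (nxt n i) \<in> F \<longrightarrow> Rim i \<in> F))"

text \<open>Each rim edge is credited to its forward end only, so that the size is the rank and the
  uncovered vertices are those with letter \<open>New\<close>.\<close>

definition cover :: "wheel_edge set \<Rightarrow> nat set" where
  "cover F = {i \<in> {1..n}. Spoke i \<in> F \<or> Rim (prv n i) \<in> F}"

text \<open>One edge per covered vertex gives the lower bound. For the upper bound a matching of J
  is redirected into the cover.\<close>

lemma rank_whirl:
  assumes F: "tri_closed F" shows "rank_of (whirl n) F = card (cover F)"
proof (rule antisym)
  note M = matroid_whirl
  define h where "h i = (if Spoke i \<in> F then Spoke i else Rim (prv n i))" for i
  define g where "g e = (case e of Spoke i \<Rightarrow> i | Rim i \<Rightarrow> nxt n i)" for e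
  have gh: "g (h i) = i" if "i \<in> cover F" for i
    using that nxt_prv by (auto simp: g_def h_def cover_def)
  have hv: "i \<in> verts n (h i)" "h i \<in> F" if "i \<in> cover F" for i
    using that prv_in[of i] nxt_prv[of i] by (auto simp: h_def cover_def)
  have "matchable (verts n) (h ` cover F)"
    unfolding matchable_def using gh hv(1)
    by (intro exI[of _ g]) (auto simp: inj_on_def)
  then have "h ` cover F \<in> indeps (whirl n)"
    using hv(2) F by (auto simp: indeps_whirl tri_closed_def)
  moreover have "card (h ` cover F) = card (cover F)"
    using gh by (intro card_image inj_on_inverseI[of _ g]) auto
  ultimately show "card (cover F) \<le> rank_of (whirl n) F"
    using rank_ge[OF M, of "h ` cover F" F] hv(2) by auto
next
  note M = matroid_whirl
  have T: "Spoke i \<in> F \<Longrightarrow> Rim i \<in> F \<Longrightarrow> Spoke (nxt n i) \<in> F"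
    "Rim i \<in> F \<Longrightarrow> Spoke (nxt n i) \<in> F \<Longrightarrow> Spoke i \<in> F" if "i \<in> {1..n}" for i
    using F that by (auto simp: tri_closed_def)
  obtain J where J: "J \<in> indeps (whirl n)" "J \<subseteq> F" "card J = rank_of (whirl n) F"
    using rank_witness[OF M] .
  then have idx: "i \<in> {1..n}" if "Rim i \<in> J \<or> Spoke i \<in> J" for i
    using that by (auto simp: indeps_whirl)
  obtain \<phi> where \<phi>: "inj_on \<phi> J" "\<And>e. e \<in> J \<Longrightarrow> \<phi> e \<in> verts n e"
    using J(1) by (auto simp: indeps_whirl matchable_def)
  have \<phi>_Spoke: "\<phi> (Spoke i) = i" if "Spoke i \<in> J" for i
    using \<phi>(2)[OF that] idx that by auto
  have \<phi>_Rim: "\<phi> (Rim i) = i \<or> \<phi> (Rim i) = nxt n i" if "Rim i \<in> J" for i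
    using \<phi>(2)[OF that] idx that by auto
  have \<phi>_rooted: "Spoke (\<phi> (Rim i)) \<in> F" if "Rim i \<in> J" "Spoke i \<in> F" for i
    using \<phi>_Rim[of i] T(1)[of i] that idx J(2) by auto
  \<comment> \<open>Only rim edges starting at a vertex without spoke are redirected, to their
    forward end. By triangle closure that end has no spoke in F, whereas all other values of \<psi>
    do, so injectivity can be checked within each kind.\<close>
  define \<psi> where "\<psi> e = (case e of Spoke i \<Rightarrow> i
    | Rim i \<Rightarrow> if Spoke i \<in> F then \<phi> (Rim i) else nxt n i)" for e
  have free_end: "Spoke (nxt n i) \<notin> F" if "Rim i \<in> J" "Spoke i \<notin> F" for i
    using T(2)[of i] that idx J(2) by auto
  have "inj_on \<psi> J"
  proof (rule inj_onI)
    have *: False if "Spoke i \<in> J" "Rim j \<in> J" "\<psi> (Spoke i) = \<psi> (Rim j)" for i j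
    proof (cases "Spoke j \<in> F")
      case True
      then have "\<phi> (Spoke i) = \<phi> (Rim j)" using that \<phi>_Spoke by (simp add: \<psi>_def)
      then show False using inj_onD[OF \<phi>(1)] that by blast
    next
      case False
      then show False using that free_end[of j] J(2) by (auto simp: \<psi>_def)
    qed
    have **: "i = j" if "Rim i \<in> J" "Rim j \<in> J" "\<psi> (Rim i) = \<psi> (Rim j)" for i j
    proof -
      have ij: "i \<in> {1..n}" "j \<in> {1..n}" using idx that by blast+
      show ?thesis
      proof (cases "Spoke i \<in> F"; cases "Spoke j \<in> F")
        assume "Spoke i \<in> F" "Spoke j \<in> F"
        then have "\<phi> (Rim i) = \<phi> (Rim j)" using that by (simp add: \<psi>_def)
        then show ?thesis using inj_onD[OF \<phi>(1)] that by blast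
      next
        assume "Spoke i \<in> F" "Spoke j \<notin> F"
        then show ?thesis using that \<phi>_rooted[of i] free_end[of j] by (simp add: \<psi>_def)
      next
        assume "Spoke i \<notin> F" "Spoke j \<in> F"
        then show ?thesis using that \<phi>_rooted[of j] free_end[of i] by (simp add: \<psi>_def)
      next
        assume "Spoke i \<notin> F" "Spoke j \<notin> F"
        then show ?thesis using that nxt_inj[OF ij] by (simp add: \<psi>_def)
      qed
    qed
    fix x y assume "x \<in> J" "y \<in> J" "\<psi> x = \<psi> y"
    then show "x = y"
    proof (cases x; cases y)
      fix i j assume "x = Rim i" "y = Rim j"
      then show "x = y" using ** \<open>x \<in> J\<close> \<open>y \<in> J\<close> \<open>\<psi> x = \<psi> y\<close> by blast
    next
      fix i j assume "x = Rim i" "y = Spoke j"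
      then show "x = y" using *[of j i] \<open>x \<in> J\<close> \<open>y \<in> J\<close> \<open>\<psi> x = \<psi> y\<close> by simp
    next
      fix i j assume "x = Spoke i" "y = Rim j"
      then show "x = y" using *[of i j] \<open>x \<in> J\<close> \<open>y \<in> J\<close> \<open>\<psi> x = \<psi> y\<close> by simp
    next
      fix i j assume "x = Spoke i" "y = Spoke j"
      then show "x = y" using \<open>\<psi> x = \<psi> y\<close> by (simp add: \<psi>_def)
    qed
  qed
  moreover have "\<psi> e \<in> cover F" if e: "e \<in> J" for e
  proof (cases e)
    case (Spoke i)
    then show ?thesis using e idx J(2) by (auto simp: \<psi>_def cover_def)
  next
    case (Rim i)
    then have i: "i \<in> {1..n}" "Rim i \<in> J" "Rim i \<in> F" using e idx J(2) by auto
    show ?thesis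
    proof (cases "Spoke i \<in> F")
      case True
      then show ?thesis
        using Rim i \<phi>_rooted[of i] \<phi>_Rim[of i] nxt_in[of i] by (auto simp: \<psi>_def cover_def)
    next
      case False
      then show ?thesis using Rim i nxt_in[of i] prv_nxt[of i] by (auto simp: \<psi>_def cover_def)
    qed
  qed
  moreover have "finite (cover F)" by (simp add: cover_def)
  ultimately have "card J \<le> card (cover F)" by (intro card_inj_on_le[of \<psi>]) auto
  then show "rank_of (whirl n) F \<le> card (cover F)" using J(3) by simp
qed

lemma rank_verts_le:
  assumes "\<And>e. e \<in> X \<Longrightarrow> verts n e \<subseteq> V" "finite V"
  shows "rank_of (whirl n) X \<le> card V"
proof -
  obtain J where J: "J \<in> indeps (whirl n)" "J \<subseteq> X" "card J = rank_of (whirl n) X"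
    using rank_witness[OF matroid_whirl] .
  then show ?thesis
    using matchable_card_le[of "verts n" J V] assms by (auto simp: indeps_whirl)
qed

text \<open>B already has as many elements as V has vertices, so an edge inside V cannot raise the
  rank.\<close>

lemma flat_spanning:
  assumes F: "F \<in> flats (whirl n)" and B: "B \<subseteq> F" "B \<in> indeps (whirl n)"
    and e: "e \<in> wheel_edges n" "verts n e \<subseteq> V" "\<And>b. b \<in> B \<Longrightarrow> verts n b \<subseteq> V"
    "finite V" "card V \<le> card B"
  shows "e \<in> F"
proof (rule ccontr)
  note M = matroid_whirl
  assume "e \<notin> F"
  then have "rank_of (whirl n) F < rank_of (whirl n) (insert e F)"
    using F e(1) by (auto simp: flats_def ground_whirl)
  moreover have "verts n b \<subseteq> V" if "b \<in> insert e B" for b using that e(2,3) by blast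
  then have "rank_of (whirl n) (insert e B) \<le> card B"
    using order_trans[OF rank_verts_le[OF _ e(4)] e(5)] by blast
  then have "rank_of (whirl n) (insert e B) = rank_of (whirl n) B"
    using rank_indep[OF M B(2)] rank_mono[OF M subset_insertI, of B e] by simp
  then have "rank_of (whirl n) (insert e F) = rank_of (whirl n) F"
    using rank_insert_absorb[OF M B(1)] by blast
  ultimately show False by simp
qed

lemma flat_tri_closed:
  assumes F: "F \<in> flats (whirl n)" shows "tri_closed F"
  unfolding tri_closed_def
proof (intro conjI ballI impI)
  show "F \<subseteq> wheel_edges n" using flat_subset[OF F] by (simp add: ground_whirl)
  fix i assume i: "i \<in> {1..n}"
  note i' = nxt_in[OF i] nxt_neq[OF i]
  have indep: "{a, b} \<in> indeps (whirl n)"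
    if "a \<in> wheel_edges n" "b \<in> wheel_edges n" "u \<in> verts n a" "v \<in> verts n b" "u \<noteq> v" for a b u v
  proof -
    have "matchable (verts n) {a, b}"
      unfolding matchable_def using that
      by (intro exI[of _ "\<lambda>x. if x = a then u else v"]) (auto simp: inj_on_def)
    then show ?thesis using that by (simp add: indeps_whirl)
  qed
  have span: "c \<in> F" if "{a, b} \<subseteq> F" "{a, b} \<in> indeps (whirl n)" "a \<noteq> b" "c \<in> wheel_edges n"
    "\<And>x. x \<in> {a, b, c} \<Longrightarrow> verts n x \<subseteq> {i, nxt n i}" for a b c
    using that i'(2) by (intro flat_spanning[OF F that(1,2), of c "{i, nxt n i}"]) auto
  show "Spoke (nxt n i) \<in> F" if "Spoke i \<in> F \<and> Rim i \<in> F"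
    using that i i' by (intro span[of "Spoke i" "Rim i"] indep[of _ _ i "nxt n i"]) auto
  show "Spoke i \<in> F" if "Rim i \<in> F \<and> Spoke (nxt n i) \<in> F"
    using that i i' by (intro span[of "Rim i" "Spoke (nxt n i)"] indep[of _ _ i "nxt n i"]) auto
  show "Rim i \<in> F" if "Spoke i \<in> F \<and> Spoke (nxt n i) \<in> F"
    using that i i' by (intro span[of "Spoke i" "Spoke (nxt n i)"] indep[of _ _ i "nxt n i"]) auto
qed

lemma flat_rim:
  assumes F: "F \<in> flats (whirl n)" and rim: "rim_edges n \<subseteq> F" shows "F = wheel_edges n"
proof
  show "F \<subseteq> wheel_edges n" using flat_subset[OF F] by (simp add: ground_whirl)
  have "rim_edges n \<in> indeps (whirl n)" using rim_matchable rim_subset by (simp add: indeps_whirl)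
  then show "wheel_edges n \<subseteq> F"
    using flat_spanning[OF F rim, of _ "{1..n}"] verts_subset rim_subset card_rim by auto
qed

text \<open>Compare F with a flat G of equal rank that contains F and a further edge; both cover the
  same vertices. A vertex with a spoke in G but not in F passes this property to its predecessor, so
  no vertex or every vertex has it. In the latter case F contains the rim.\<close>

lemma tri_closed_flat:
  assumes F: "tri_closed F" and rim: "rim_edges n \<subseteq> F \<Longrightarrow> F = wheel_edges n"
  shows "F \<in> flats (whirl n)"
proof (rule ccontr)
  note M = matroid_whirl
  have sub: "F \<subseteq> wheel_edges n" using F by (simp add: tri_closed_def)
  assume "F \<notin> flats (whirl n)"
  then obtain x where x: "x \<in> wheel_edges n - F"
    "\<not> rank_of (whirl n) F < rank_of (whirl n) (insert x F)"
    using sub by (auto simp: flats_def ground_whirl)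
  then have "rank_of (whirl n) (insert x F) = rank_of (whirl n) F"
    using rank_mono[OF M subset_insertI, of F x] by simp
  then obtain G where G: "G \<in> flats (whirl n)" "insert x F \<subseteq> G" "rank_of (whirl n) G = rank_of (whirl n) F"
    using flat_spanned[OF M, of F x] x sub by (auto simp: ground_whirl)
  have GT: "tri_closed G" using flat_tri_closed[OF G(1)] .
  have "cover F \<subseteq> cover G" using G(2) by (auto simp: cover_def)
  moreover have "card (cover F) = card (cover G)" using G(3) rank_whirl F GT by simp
  moreover have "finite (cover G)" by (simp add: cover_def)
  ultimately have cov: "cover F = cover G" by (metis card_subset_eq)
  have TF: "Spoke i \<in> F \<Longrightarrow> Rim i \<in> F \<Longrightarrow> Spoke (nxt n i) \<in> F"
    "Spoke i \<in> F \<Longrightarrow> Spoke (nxt n i) \<in> F \<Longrightarrow> Rim i \<in> F" if "i \<in> {1..n}" for i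
    using F that by (auto simp: tri_closed_def)
  have TG: "Rim i \<in> G \<Longrightarrow> Spoke (nxt n i) \<in> G \<Longrightarrow> Spoke i \<in> G" if "i \<in> {1..n}" for i
    using GT that by (auto simp: tri_closed_def)
  define R where "R = {i \<in> {1..n}. Spoke i \<in> G \<and> Spoke i \<notin> F}"
  have Rim_R: "Rim (prv n i) \<in> F" if "i \<in> R" for i
  proof -
    have "i \<in> cover F" unfolding cov using that by (auto simp: R_def cover_def)
    then show ?thesis using that by (auto simp: R_def cover_def)
  qed
  have prv_R: "prv n i \<in> R" if "i \<in> R" for i
  proof -
    have i: "i \<in> {1..n}" "Spoke i \<in> G" "Spoke i \<notin> F" using that by (auto simp: R_def)
    note p = prv_in[OF i(1)] nxt_prv[OF i(1)]
    have "Spoke (prv n i) \<in> G" using TG[OF p(1)] Rim_R[OF that] G(2) i p(2) by auto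
    moreover have "Spoke (prv n i) \<notin> F" using TF(1)[OF p(1)] Rim_R[OF that] i p(2) by auto
    ultimately show ?thesis using p by (simp add: R_def)
  qed
  have R_empty: "R = {}"
  proof (rule ccontr)
    assume R: "R \<noteq> {}"
    have "{1..n} - R = {}"
    proof (rule ccontr)
      assume "{1..n} - R \<noteq> {}"
      then have "{1..n} - R = {1..n}"
        using prv_R prv_nxt nxt_in by (intro nxt_closed_all) (blast, blast, metis DiffD1 DiffD2 DiffI)
      moreover have "R \<subseteq> {1..n}" by (auto simp: R_def)
      ultimately show False using R by blast
    qed
    then have all: "i \<in> R" if "i \<in> {1..n}" for i using that by blast
    have "rim_edges n \<subseteq> F"
    proof
      fix e assume "e \<in> rim_edges n"
      then obtain i where i: "i \<in> {1..n}" "e = Rim i" by (auto simp: rim_edges_iff)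
      then show "e \<in> F" using Rim_R[OF all[OF nxt_in[OF i(1)]]] prv_nxt by simp
    qed
    then show False using rim R by (auto simp: R_def)
  qed
  \<comment> \<open>With no new spokes, a new rim edge would have its forward end covered in F by a
    spoke; the triangles of G and then of F put the edge into F.\<close>
  have "G \<subseteq> F"
  proof
    fix e assume e: "e \<in> G"
    have Gsub: "G \<subseteq> wheel_edges n" using GT by (simp add: tri_closed_def)
    have spokes: "Spoke i \<in> F" if "Spoke i \<in> G" for i
      using R_empty that Gsub by (auto simp: R_def)
    show "e \<in> F"
    proof (cases e)
      case (Spoke i)
      then show ?thesis using spokes e by simp
    next
      case (Rim j)
      then have j: "j \<in> {1..n}" using e Gsub by auto
      then have "nxt n j \<in> cover G" using Rim e nxt_in prv_nxt by (simp add: cover_def)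
      then have "nxt n j \<in> cover F" using cov by simp
      then consider "Spoke (nxt n j) \<in> F" | "Rim j \<in> F" using prv_nxt[OF j] by (auto simp: cover_def)
      then show ?thesis
      proof cases
        case 1
        then have "Spoke j \<in> F" using spokes TG[OF j] Rim e G(2) by blast
        then show ?thesis using TF(2)[OF j] 1 Rim by simp
      qed (use Rim in simp)
    qed
  qed
  then show False using G(2) x by blast
qed

lemma flats_whirl:
  "flats (whirl n) = {F. tri_closed F \<and> (rim_edges n \<subseteq> F \<longrightarrow> F = wheel_edges n)}"
  using flat_tri_closed flat_rim tri_closed_flat by blast

end


subsection \<open>Flats as cyclic words\<close>

context
  fixes n :: nat
  assumes n: "n \<ge> 2"
begin

definition lab :: "wheel_edge set \<Rightarrow> nat \<Rightarrow> label" where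
  "lab F i = (if Spoke i \<in> F then Spk else if Rim (prv n i) \<in> F then Ext else New)"

definition word :: "wheel_edge set \<Rightarrow> label list" where
  "word F = map (lab F) [1..<Suc n]"

lemma length_word: "length (word F) = n"
  by (simp add: word_def del: upt_Suc)

lemma word_nth: "i \<in> {1..n} \<Longrightarrow> word F ! (i - 1) = lab F i"
  by (auto simp: word_def simp del: upt_Suc)

lemma words_nth_iff:
  "w \<in> words a g \<longleftrightarrow> length w = length g \<and> (\<forall>k<length g. ok ((a # w) ! k) (g ! k) (w ! k))"
proof (induction g arbitrary: a w)
  case (Cons x g)
  show ?case
  proof (cases w)
    case (Cons y v)
    then show ?thesis
      using Cons.IH[of v y]
      by (auto simp: Cons_words_iff All_less_Suc2 simp del: words.simps)
  qed auto
qed simp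

lemma cwords_iff:
  assumes "length g = n"
  shows "w \<in> cwords g \<longleftrightarrow>
    length w = n \<and> (\<forall>i\<in>{1..n}. ok (w ! (prv n i - 1)) (g ! (i - 1)) (w ! (i - 1)))"
proof -
  have "(last w # w) ! (i - 1) = w ! (prv n i - 1)" if "length w = n" "i \<in> {1..n}" for i
  proof (cases "i = 1")
    case True
    have "w \<noteq> []" using that n by auto
    then show ?thesis using True that by (simp add: prv_def last_conv_nth)
  next
    case False
    then have "i - 1 = Suc (i - 1 - 1)" using that by auto
    then have "(last w # w) ! (i - 1) = w ! (i - 1 - 1)" by (metis nth_Cons_Suc)
    then show ?thesis using False by (simp add: prv_def)
  qed
  moreover have "(\<forall>k<n. P k) \<longleftrightarrow> (\<forall>i\<in>{1..n}. P (i - 1))" for P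
  proof
    assume *: "\<forall>i\<in>{1..n}. P (i - 1)"
    show "\<forall>k<n. P k"
    proof (intro allI impI)
      fix k assume "k < n"
      then show "P k" using *[rule_format, of "Suc k"] by simp
    qed
  qed auto
  ultimately show ?thesis unfolding cwords_def mem_Collect_eq words_nth_iff assms by auto
qed

lemma word_in_cwords_iff:
  "word F \<in> cwords (word G) \<longleftrightarrow> (\<forall>i\<in>{1..n}. ok (lab F (prv n i)) (lab G i) (lab F i))"
  unfolding cwords_iff[OF length_word] using word_nth prv_in[OF n] by (simp add: length_word)

lemma tri_closedD:
  assumes "tri_closed n F" "i \<in> {1..n}"
  shows "Spoke (prv n i) \<in> F \<Longrightarrow> Rim (prv n i) \<in> F \<Longrightarrow> Spoke i \<in> F"
    "Rim (prv n i) \<in> F \<Longrightarrow> Spoke i \<in> F \<Longrightarrow> Spoke (prv n i) \<in> F"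
    "Spoke (prv n i) \<in> F \<Longrightarrow> Spoke i \<in> F \<Longrightarrow> Rim (prv n i) \<in> F"
proof -
  have "\<forall>j\<in>{1..n}. (Spoke j \<in> F \<and> Rim j \<in> F \<longrightarrow> Spoke (nxt n j) \<in> F) \<and>
      (Rim j \<in> F \<and> Spoke (nxt n j) \<in> F \<longrightarrow> Spoke j \<in> F) \<and>
      (Spoke j \<in> F \<and> Spoke (nxt n j) \<in> F \<longrightarrow> Rim j \<in> F)"
    using assms(1) unfolding tri_closed_def[OF n] by blast
  from bspec[OF this prv_in[OF n assms(2)]]
  show "Spoke (prv n i) \<in> F \<Longrightarrow> Rim (prv n i) \<in> F \<Longrightarrow> Spoke i \<in> F"
    "Rim (prv n i) \<in> F \<Longrightarrow> Spoke i \<in> F \<Longrightarrow> Spoke (prv n i) \<in> F"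
    "Spoke (prv n i) \<in> F \<Longrightarrow> Spoke i \<in> F \<Longrightarrow> Rim (prv n i) \<in> F"
    unfolding nxt_prv[OF n assms(2)] by blast+
qed

text \<open>The label \<open>Spk\<close> hides the rim edge before the vertex; triangle closure
  recovers it from the label of the predecessor.\<close>

lemma Rim_mem_iff:
  assumes "tri_closed n F" "i \<in> {1..n}"
  shows "Rim (prv n i) \<in> F \<longleftrightarrow> lab F i = Ext \<or> lab F i = Spk \<and> lab F (prv n i) = Spk"
  using tri_closedD[OF assms] by (auto simp: lab_def)

lemma Spoke_mem_iff: "Spoke i \<in> F \<longleftrightarrow> lab F i = Spk"
  by (simp add: lab_def)

lemma edge_subsetI:
  assumes "F \<subseteq> wheel_edges n"
    and "\<And>i. i \<in> {1..n} \<Longrightarrow> Spoke i \<in> F \<Longrightarrow> Spoke i \<in> G"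
    and "\<And>i. i \<in> {1..n} \<Longrightarrow> Rim (prv n i) \<in> F \<Longrightarrow> Rim (prv n i) \<in> G"
  shows "F \<subseteq> G"
proof
  fix e assume e: "e \<in> F"
  show "e \<in> G"
  proof (cases e)
    case (Rim i)
    then have i: "i \<in> {1..n}" using e assms(1) mem_wheel_edges[OF n] by blast
    then show ?thesis using assms(3)[OF nxt_in[OF n i]] Rim e prv_nxt[OF n i] by simp
  next
    case (Spoke i)
    then have i: "i \<in> {1..n}" using e assms(1) mem_wheel_edges[OF n] by blast
    then show ?thesis using assms(2)[OF i] Spoke e by simp
  qed
qed

lemma word_inj:
  assumes "tri_closed n F" "tri_closed n G" "word F = word G"
  shows "F = G"
proof -
  have lab: "lab F i = lab G i" if "i \<in> {1..n}" for i
    using word_nth[OF that, of F] word_nth[OF that, of G] assms(3) by simp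
  have *: "F \<subseteq> G" if "tri_closed n F" "tri_closed n G" "\<And>i. i \<in> {1..n} \<Longrightarrow> lab F i = lab G i" for F G
  proof (rule edge_subsetI)
    show "F \<subseteq> wheel_edges n" using that(1) by (simp add: tri_closed_def[OF n])
  next
    fix i assume i: "i \<in> {1..n}"
    show "Spoke i \<in> G" if "Spoke i \<in> F"
      using \<open>Spoke i \<in> F\<close> \<open>\<And>i. i \<in> {1..n} \<Longrightarrow> lab F i = lab G i\<close>[OF i] by (simp add: Spoke_mem_iff)
    show "Rim (prv n i) \<in> G" if "Rim (prv n i) \<in> F"
      using \<open>Rim (prv n i) \<in> F\<close> \<open>\<And>i. i \<in> {1..n} \<Longrightarrow> lab F i = lab G i\<close>[OF i]
        \<open>\<And>i. i \<in> {1..n} \<Longrightarrow> lab F i = lab G i\<close>[OF prv_in[OF n i]]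
      unfolding Rim_mem_iff[OF \<open>tri_closed n F\<close> i] Rim_mem_iff[OF \<open>tri_closed n G\<close> i] by simp
  qed
  show ?thesis
  proof
    show "F \<subseteq> G" by (rule *[OF assms(1,2) lab])
    show "G \<subseteq> F" by (rule *[OF assms(2,1) lab[symmetric]])
  qed
qed

lemma word_mem_cwords:
  assumes F: "tri_closed n F" and "G \<subseteq> F"
  shows "word F \<in> cwords (word G)"
  unfolding word_in_cwords_iff
proof
  fix i assume i: "i \<in> {1..n}"
  show "ok (lab F (prv n i)) (lab G i) (lab F i)"
    using assms(2) tri_closedD[OF F i] by (auto simp: lab_def)
qed

text \<open>The rim edges are rebuilt as in \<open>Rim_mem_iff\<close>; the result is closed under
  triangles because \<open>Ext\<close> never follows a spoke in w.\<close>

lemma word_surj: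
  assumes G: "tri_closed n G" and w: "w \<in> cwords (word G)"
  shows "\<exists>F. tri_closed n F \<and> G \<subseteq> F \<and> word F = w"
proof -
  define lw where "lw i = w ! (i - 1)" for i
  have w': "length w = n"
    "\<forall>i\<in>{1..n}. ok (w ! (prv n i - 1)) (word G ! (i - 1)) (w ! (i - 1))"
    using w unfolding cwords_iff[OF length_word] by blast+
  have ok: "ok (lw (prv n i)) (lab G i) (lw i)" if "i \<in> {1..n}" for i
    using w'(2)[rule_format, OF that] unfolding lw_def word_nth[OF that] .
  have lw: "lw i \<noteq> Bar" "lw (prv n i) = Spk \<Longrightarrow> lw i \<noteq> Ext" if "i \<in> {1..n}" for i
    using ok[OF that] by (cases "lab G i"; auto split: if_splits)+
  define F where "F = {e \<in> wheel_edges n. case e of Spoke i \<Rightarrow> lw i = Spk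
    | Rim i \<Rightarrow> lw (nxt n i) = Ext \<or> lw (nxt n i) = Spk \<and> lw i = Spk}"
  have SF: "Spoke i \<in> F \<longleftrightarrow> lw i = Spk" if "i \<in> {1..n}" for i
    using that by (simp add: F_def mem_wheel_edges[OF n])
  have RF: "Rim i \<in> F \<longleftrightarrow> lw (nxt n i) = Ext \<or> lw (nxt n i) = Spk \<and> lw i = Spk" if "i \<in> {1..n}" for i
    using that by (simp add: F_def mem_wheel_edges[OF n])
  have "tri_closed n F"
    unfolding tri_closed_def[OF n]
  proof (intro conjI ballI)
    show "F \<subseteq> wheel_edges n" by (auto simp: F_def)
    fix i assume i: "i \<in> {1..n}"
    note i' = nxt_in[OF n i]
    have "lw i = Spk \<Longrightarrow> lw (nxt n i) \<noteq> Ext" using lw(2)[OF i'] prv_nxt[OF n i] by simp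
    then show "Spoke i \<in> F \<and> Rim i \<in> F \<longrightarrow> Spoke (nxt n i) \<in> F"
      "Rim i \<in> F \<and> Spoke (nxt n i) \<in> F \<longrightarrow> Spoke i \<in> F"
      "Spoke i \<in> F \<and> Spoke (nxt n i) \<in> F \<longrightarrow> Rim i \<in> F"
      unfolding SF[OF i] SF[OF i'] RF[OF i] by auto
  qed
  moreover have "G \<subseteq> F"
  proof (rule edge_subsetI)
    show "G \<subseteq> wheel_edges n" using G by (simp add: tri_closed_def[OF n])
    fix i assume i: "i \<in> {1..n}"
    show "Spoke i \<in> F" if "Spoke i \<in> G" using that ok[OF i] SF[OF i] by (simp add: lab_def)
    show "Rim (prv n i) \<in> F" if R: "Rim (prv n i) \<in> G"
    proof (cases "Spoke i \<in> G")
      case True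
      then have "Spoke (prv n i) \<in> G" using tri_closedD(2)[OF G i] R by blast
      then have "lw (prv n i) = Spk" "lw i = Spk"
        using ok[OF i] ok[OF prv_in[OF n i]] True by (simp_all add: lab_def)
      then show ?thesis using RF[OF prv_in[OF n i]] nxt_prv[OF n i] by simp
    next
      case False
      then have "lw i = (if lw (prv n i) = Spk then Spk else Ext)"
        using ok[OF i] R by (simp add: lab_def)
      then show ?thesis using RF[OF prv_in[OF n i]] nxt_prv[OF n i] by (simp split: if_splits)
    qed
  qed
  moreover have "word F = w"
  proof (rule nth_equalityI)
    show "length (word F) = length w" using w'(1) by (simp add: length_word)
    fix k assume "k < length (word F)"
    then have k: "Suc k \<in> {1..n}" by (simp add: length_word)
    have "lab F (Suc k) = lw (Suc k)"
      using SF[OF k] RF[OF prv_in[OF n k]] nxt_prv[OF n k] lw(1)[OF k]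
      by (cases "lw (Suc k)") (auto simp: lab_def)
    then show "word F ! k = w ! k" using word_nth[OF k, of F] by (simp add: lw_def)
  qed
  ultimately show ?thesis by blast
qed

text \<open>The vertices labelled \<open>New\<close> are exactly those outside the cover.\<close>

lemma free_word: "tri_closed n F \<Longrightarrow> rank_of (whirl n) F + free (word F) = n"
proof -
  assume F: "tri_closed n F"
  have "free (word F) = card {i \<in> {1..n}. lab F i = New}"
  proof -
    have "free (word F) = length (filter (\<lambda>i. lab F i = New) [1..<Suc n])"
      unfolding free_def word_def filter_map length_map
      by (intro arg_cong[of _ _ length] filter_cong) (auto simp: lab_def)
    also have "\<dots> = card {i \<in> {1..n}. lab F i = New}"
      unfolding distinct_length_filter[OF distinct_upt]
      by (rule arg_cong[of _ _ card]) auto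
    finally show ?thesis .
  qed
  moreover have "{i \<in> {1..n}. lab F i = New} = {1..n} - cover n F"
    by (auto simp: lab_def cover_def[OF n])
  moreover have "cover n F \<subseteq> {1..n}" by (auto simp: cover_def[OF n])
  then have "card ({1..n} - cover n F) + card (cover n F) = n"
    using card_mono[of "{1..n}" "cover n F"] by (simp add: card_Diff_subset finite_subset)
  ultimately show ?thesis using rank_whirl[OF n F] by simp
qed

lemma tri_closed_ground: "tri_closed n (wheel_edges n)"
  using nxt_in[OF n] by (auto simp: tri_closed_def[OF n] mem_wheel_edges[OF n])

lemma word_ground: "word (wheel_edges n) = replicate n Spk"
  by (rule nth_equalityI)
    (auto simp: word_def lab_def mem_wheel_edges[OF n] simp del: upt_Suc)

lemma set_word: "set (word F) \<subseteq> {Spk, New, Ext}"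
  by (auto simp: word_def lab_def)

lemma rk_whirl: "rk (whirl n) = n"
  using free_word[OF tri_closed_ground]
  by (simp add: rk_def ground_whirl[OF n] word_ground free_def)

text \<open>With the whole rim in F, a single spoke would spread around the rim by triangle closure
  until F is everything.\<close>

lemma rim_word:
  assumes F: "tri_closed n F" and "F \<noteq> wheel_edges n" and "rim_edges n \<subseteq> F"
  shows "Spk \<notin> set (word F)" "New \<notin> set (word F)"
proof -
  have rim: "Rim i \<in> F" if "i \<in> {1..n}" for i using that assms(3) by (auto simp: rim_edges_def)
  have "lab F i = Ext" if "i \<in> {1..n}" for i
  proof -
    have "Spoke i \<notin> F"
    proof
      assume S: "Spoke i \<in> F"
      have "Spoke (nxt n j) \<in> F" if "j \<in> {1..n}" "Spoke j \<in> F" for j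
        using tri_closedD(1)[OF F nxt_in[OF n that(1)]] that rim by (simp add: prv_nxt[OF n])
      then have "{j \<in> {1..n}. Spoke j \<in> F} = {1..n}"
        using S \<open>i \<in> {1..n}\<close> nxt_in[OF n] by (intro nxt_closed_all[OF n]) blast+
      then have "Spoke j \<in> F" if "j \<in> {1..n}" for j using that by blast
      then have "wheel_edges n \<subseteq> F"
        using assms(3) unfolding wheel_edges_def by blast
      then show False using assms(2) F by (auto simp: tri_closed_def[OF n])
    qed
    then show ?thesis using rim[OF prv_in[OF n \<open>i \<in> {1..n}\<close>]] by (simp add: lab_def)
  qed
  then have "set (word F) \<subseteq> {Ext}" by (auto simp: word_def simp del: upt_Suc)
  then show "Spk \<notin> set (word F)" "New \<notin> set (word F)" by auto
qed

lemma sum_flats_word: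
  assumes G: "tri_closed n G"
  shows "(\<Sum>F\<in>{F \<in> flats (whirl n). G \<subseteq> F}.
      monom 1 (rank_of (whirl n) F - rank_of (whirl n) G) * cyc_wt (word F)) = cyc_total (word G)"
proof -
  let ?T = "{F. tri_closed n F \<and> G \<subseteq> F}"
  let ?h = "\<lambda>F. monom 1 (free (word G) - free (word F)) * cyc_wt (word F)"
  have fin: "finite ?T"
    by (rule finite_subset[of _ "Pow (wheel_edges n)"])
      (auto simp: tri_closed_def[OF n] finite_wheel[OF n])
  have "rank_of (whirl n) F - rank_of (whirl n) G = free (word G) - free (word F)"
    if "tri_closed n F" for F using free_word[OF that] free_word[OF G] by linarith
  then have "(\<Sum>F\<in>{F \<in> flats (whirl n). G \<subseteq> F}.
      monom 1 (rank_of (whirl n) F - rank_of (whirl n) G) * cyc_wt (word F)) =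
      (\<Sum>F\<in>{F \<in> flats (whirl n). G \<subseteq> F}. ?h F)"
    by (intro sum.cong) (auto simp: flats_whirl[OF n])
  \<comment> \<open>Apart from flats, \<open>?T\<close> can contain only the bare rim, whose word
    has weight \<open>whirl_kl 0 = 0\<close>.\<close>
  also have "\<dots> = (\<Sum>F\<in>?T. ?h F)"
  proof (rule sum.mono_neutral_left[OF fin])
    show "\<forall>F\<in>?T - {F \<in> flats (whirl n). G \<subseteq> F}. ?h F = 0"
    proof
      fix F assume "F \<in> ?T - {F \<in> flats (whirl n). G \<subseteq> F}"
      then have "tri_closed n F" "F \<noteq> wheel_edges n" "rim_edges n \<subseteq> F"
        by (auto simp: flats_whirl[OF n])
      then have "Spk \<notin> set (word F)" "New \<notin> set (word F)" by (rule rim_word)+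
      moreover have "Bar \<notin> set (word F)" using set_word by blast
      ultimately have "free (word F) = 0" "Spk \<notin> set (word F)"
        by (auto simp: free_def filter_empty_conv)
      then show "?h F = 0" by (simp add: cyc_wt_def whirl_kl_0)
    qed
  qed (auto simp: flats_whirl[OF n])
  also have "\<dots> = (\<Sum>w\<in>cwords (word G). monom 1 (free (word G) - free w) * cyc_wt w)"
  proof (rule sum.reindex_bij_betw)
    show "bij_betw word ?T (cwords (word G))"
      unfolding bij_betw_def
    proof
      show "inj_on word ?T" unfolding inj_on_def using word_inj by blast
      show "word ` ?T = cwords (word G)"
        using word_mem_cwords word_surj[OF G] by (auto simp: image_iff) metis
    qed
  qed
  finally show ?thesis by (simp add: cyc_total_def)
qed

lemma z_poly_whirl_ge2: "z_poly (whirl n) = whirl_z $ n"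
proof -
  note M = matroid_whirl[OF n] and ll = loopless_whirl[OF n]
  have TG: "tri_closed n G" if "G \<in> flats (whirl n)" for G
    using that by (simp add: flats_whirl[OF n])
  have corank: "rk (whirl n) - rank_of (whirl n) G = free (word G)" if "G \<in> flats (whirl n)" for G
    using free_word[OF TG[OF that]] by (simp add: rk_whirl)
  have "z_poly (whirl n) = (\<Sum>F\<in>flats (whirl n). monom 1 (rank_of (whirl n) F) * cyc_wt (word F))"
  proof (rule z_poly_eqI[OF M ll])
    show "cyc_wt (word (ground (whirl n))) = 1"
      using n by (simp add: ground_whirl[OF n] word_ground cyc_wt_all_Spk)
    fix G assume G: "G \<in> flats (whirl n)"
    show "2 * degree (cyc_wt (word G)) < rk (whirl n) - rank_of (whirl n) G"
      if ne: "G \<noteq> ground (whirl n)"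
    proof -
      have "G \<subset> ground (whirl n)" using flat_subset[OF G] ne by blast
      then have "rank_of (whirl n) G < rk (whirl n)"
        unfolding rk_def using flat_rank_strict[OF M G] by blast
      then have "free (word G) > 0" using corank[OF G] by simp
      then show ?thesis unfolding corank[OF G] by (rule degree_cyc_wt)
    qed
    \<comment> \<open>Otherwise all letters are \<open>Ext\<close> and G contains the rim; but a
      flat containing the rim is the ground set, whose letters are spokes.\<close>
    have "Spk \<in> set (word G) \<or> New \<in> set (word G)"
    proof (rule ccontr)
      assume *: "\<not> ?thesis"
      then have lab: "lab G i = Ext" if "i \<in> {1..n}" for i
      proof -
        have "lab G i \<in> set (word G)" using that by (auto simp: word_def simp del: upt_Suc)
        then show ?thesis using set_word[of G] * by (metis empty_iff insert_iff subsetD)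
      qed
      have "rim_edges n \<subseteq> G"
      proof
        fix e assume "e \<in> rim_edges n"
        then obtain i where i: "i \<in> {1..n}" "e = Rim i" by (auto simp: rim_edges_def)
        then show "e \<in> G"
          using lab[OF nxt_in[OF n i(1)]] prv_nxt[OF n i(1)] by (auto simp: lab_def split: if_splits)
      qed
      then have "G = wheel_edges n" using G by (auto simp: flats_whirl[OF n])
      then show False using * n by (simp add: word_ground)
    qed
    then show "palindromic (rk (whirl n) - rank_of (whirl n) G)
        (\<Sum>F\<in>{F \<in> flats (whirl n). G \<subseteq> F}.
          monom 1 (rank_of (whirl n) F - rank_of (whirl n) G) * cyc_wt (word F))"
      unfolding sum_flats_word[OF TG[OF G]] corank[OF G]
      using palindromic_cyc_total set_word by blast
  qed
  also have "\<dots> = cyc_total (word {})"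
    using sum_flats_word[of "{}"] by (simp add: tri_closed_def[OF n] rank_empty[OF M])
  also have "word {} = replicate n New"
    by (rule nth_equalityI) (auto simp: word_def lab_def simp del: upt_Suc)
  also have "cyc_total (replicate n New) = whirl_z $ free (replicate n New)"
    using n by (intro cyc_total_New) auto
  also have "free (replicate n New) = n" by (simp add: free_def)
  finally show ?thesis .
qed

end

text \<open>The first whirl is a single edge, outside the model by cyclic words, which starts at n =
  2. Here f = 1 on both flats, giving 1 + t.\<close>

lemma z_poly_whirl_1: "z_poly (whirl (Suc 0)) = whirl_z $ Suc 0"
proof -
  let ?W = "whirl (Suc 0)" and ?E = "{Spoke (Suc 0)}"
  have W: "?W = \<lparr>ground = ?E, indeps = Pow ?E\<rparr>"
  proof -
    have "is_forest (wheel_ends (Suc 0)) X" if X: "X \<subseteq> ?E" for X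
    proof -
      have False if es: "is_cycle (wheel_ends (Suc 0)) es" "set es \<subseteq> X" for es
      proof -
        have "es \<noteq> []" "distinct es" using es by (auto simp: is_cycle_def)
        moreover have "set es \<subseteq> ?E" using es X by blast
        ultimately have "es = [Spoke (Suc 0)]"
          by (cases es; cases "tl es") auto
        then have "\<exists>v. {0, 1} = {v :: nat}" using es(1) by (auto simp: is_cycle_def length_Suc_conv)
        then show False by auto
      qed
      then show ?thesis unfolding is_forest_def by blast
    qed
    then show ?thesis by (auto simp: whirl_def graphic_matroid_def)
  qed
  have sub: "X \<subseteq> ?E \<longleftrightarrow> X = {} \<or> X = ?E" for X :: "wheel_edge set" by auto
  have M: "is_matroid ?W"
    unfolding is_matroid_def W by (auto simp: sub)
  have ll: "loopless ?W" unfolding loopless_def W by simp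
  have rank: "rank_of ?W {} = 0" "rank_of ?W ?E = 1"
    using rank_indep[OF M, of "{}"] rank_indep[OF M, of ?E] by (simp_all add: W)
  have flats: "flats ?W = {{}, ?E}"
    using rank unfolding flats_def by (auto simp: W sub)
  have rk: "rk ?W = 1" using rank by (simp add: rk_def W)
  have "z_poly ?W = (\<Sum>F\<in>flats ?W. monom 1 (rank_of ?W F) * 1)"
  proof (rule z_poly_eqI[OF M ll])
    show "2 * degree 1 < rk ?W - rank_of ?W F" if "F \<in> flats ?W" "F \<noteq> ground ?W" for F
      using that flats rank rk by (auto simp: W)
    fix G assume "G \<in> flats ?W"
    then consider "G = {}" | "G = ?E" using flats by blast
    then show "palindromic (rk ?W - rank_of ?W G)
        (\<Sum>F\<in>{F \<in> flats ?W. G \<subseteq> F}. monom 1 (rank_of ?W F - rank_of ?W G) * 1)"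
    proof cases
      case 1
      then have "{F \<in> flats ?W. G \<subseteq> F} = {{}, ?E}" using flats by auto
      then show ?thesis unfolding \<open>{F \<in> flats ?W. G \<subseteq> F} = {{}, ?E}\<close>
        using 1 rank rk palindromic_1_tp by simp
    next
      case 2
      then have "{F \<in> flats ?W. G \<subseteq> F} = {?E}" using flats by auto
      then show ?thesis unfolding \<open>{F \<in> flats ?W. G \<subseteq> F} = {?E}\<close>
        using 2 rank rk palindromic_1 by simp
    qed
  qed simp
  also have "\<dots> = 1 + tp" using flats rank by simp
  also have "\<dots> = whirl_z $ Suc 0"
    using log_deriv_coeff[OF whirl_z_eq fan_z_0, of "Suc 0"] fan_z_Suc[of 0] fan_z_0
    by (simp add: whirl_z_0)
  finally show ?thesis .
qed

theorem theorem6p11: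
  fixes t :: "int poly" and u :: "int poly fps"
  defines "t \<equiv> [:0, 1:]" and "u \<equiv> fps_X"
  shows "Abs_fps (\<lambda>n. if n = 0 then 0 else z_poly (whirl n)) =
    fps_right_inverse
      (fps_sqrt1 ((1 - fps_const (t + 1) * u) ^ 2 - 4 * fps_const t * u ^ 2)) 1 - 1"
proof -
  have t: "t = tp" by (simp add: t_def monom_Suc monom_0)
  have "Abs_fps (\<lambda>n. if n = 0 then 0 else z_poly (whirl n)) = whirl_z"
  proof (rule fps_ext)
    fix n :: nat
    consider "n = 0" | "n = 1" | "n \<ge> 2" by linarith
    then show "Abs_fps (\<lambda>n. if n = 0 then 0 else z_poly (whirl n)) $ n = whirl_z $ n"
      by cases (simp_all add: whirl_z_0 z_poly_whirl_1 z_poly_whirl_ge2)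
  qed
  then show ?thesis unfolding t u_def by (simp only: whirl_z_closed_form[symmetric])
qed

end
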